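(* Let $n,m\ge1$. There exists $\delta>0$ such that the following holds for every $T\in(0,\infty]$. Let $u_1,u_2\in X_T$ with $|u_1|=|u_2|=1$ be solutions, in the mild sense, to $$\partial_t u+(-\Delta)^{1/2}u=u\,|d_{1/2}u|_{od}^2\ \text{ in }\mathbb{R}^n\times(0,T)$$ with the same initial data $u_1(0)=u_2(0)=a\in\mathcal{A}$, $|a|=1$, and suppose $$\limsup_{R\searrow0}\,[u_i]_{X_R}\le\delta\quad\text{for }i=1,2.$$ Then $u_1\equiv u_2$ in $X_T$.
   Context: Functions are defined on $\mathbb{R}^n$ or $\mathbb{R}^n\times(0,T)$ with values in $\mathbb{R}^m$. Put $\gamma_n=\Gamma(\frac{n+1}{2})/\pi^{(n+1)/2}$. For measurable $v$ on $\mathbb{R}^n$ the fractional gradient is $d_{1/2}v(x,y)=\sqrt{\gamma_n/2}\,\frac{v(x)-v(y)}{|x-y|^{1/2}}$, with off-diagonal modulus $$|d_{1/2}v|_{od}^2(x)=\frac{\gamma_n}{2}\int_{\mathbb{R}^n}\frac{|v(x+h)-v(x)|^2}{|h|^{n+1}}\,dh\in[0,\infty].$$ For functions of $(x,t)$, $d_{1/2}$ and $\nabla$ act in $x$ only ($\nabla$ in the weak sense). Poisson kernel: $p_t(x)=t^{-n}p(x/t)$, $p(x)=\gamma_n(1+|x|^2)^{-(n+1)/2}$; $S(t)f=p_t*f$. For $a\in L^\infty(\mathbb{R}^n;\mathbb{R}^m)$ and $v(\cdot,t)=p_t*a$, $$[a]_{\mathcal{A}_\infty}^2=\sup_{r>0}\sup_{x\in\mathbb{R}^n}\int_0^r\frac{1}{|B_r(x)|}\int_{B_r(x)}|d_{1/2}v|_{od}^2(y,s)\,dy\,ds,$$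 and $\mathcal{A}=\{a\in L^\infty(\mathbb{R}^n;\mathbb{R}^m):[a]_{\mathcal{A}_\infty}<\infty\}$. For measurable $u:\mathbb{R}^n\times(0,T)\to\mathbb{R}^m$ (suprema are essential, over $0<t<T$, $x\in\mathbb{R}^n$), $$[u]_{X_T^{(0)}}=\sup t^{1/2}|d_{1/2}u|_{od}(x,t)+\sup\Big(\int_0^t\frac{1}{|B_t(x)|}\int_{B_t(x)}|d_{1/2}u|_{od}^2(y,s)\,dy\,ds\Big)^{1/2},$$ $$[u]_{X_T^{(1)}}=\sup t^{3/2}|d_{1/2}\nabla u|_{od}(x,t)+\sup\Big(\int_0^t\frac{1}{|B_t(x)|}\int_{B_t(x)}s^2|d_{1/2}\nabla u|_{od}^2(y,s)\,dy\,ds\Big)^{1/2},$$ $[u]_{X_T}=[u]_{X_T^{(0)}}+[u]_{X_T^{(1)}}$, $|||u|||_{X_T}=\operatorname{ess\,sup}|u|+[u]_{X_T}$, and $X_T$ is the Banach space of all $u$ with $|||u|||_{X_T}<\infty$. For $R<T$, $[u]_{X_R}$ is computed for the restriction of $u$ to $\mathbb{R}^n\times(0,R)$. Mild solution with initial data $a$: $u(t)=S(t)a+\int_0^tS(t-s)\big(u\,|d_{1/2}u|_{od}^2\big)(s)\,ds$ for $0<t<T$. *)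

theory Defs
  imports "HOL-Analysis.Analysis" "HOL-Probability.Essential_Supremum"
begin

text \<open>
  Functions on $R^n \times (0,T)$ are total functions on \<open>(real^'n) \<times> real\<close>; only their values on
  \<open>slab T\<close> matter. All measurability and null-set notions refer to Lebesgue (not Borel) measure.
\<close>

definition slab :: "ereal \<Rightarrow> ('a \<times> real) set" where
  "slab T = {(x, t). 0 < t \<and> ereal t < T}"

definition ennreal_sqrt :: "ennreal \<Rightarrow> ennreal" where
  "ennreal_sqrt x = (if x = top then top else ennreal (sqrt (enn2real x)))"

definition ball_average :: "'a::euclidean_space \<Rightarrow> real \<Rightarrow> ('a \<Rightarrow> ennreal) \<Rightarrow> ennreal" where
  "ball_average x r g =
     (\<integral>\<^sup>+ y \<in> ball x r. g y \<partial>lebesgue) / emeasure lebesgue (ball x r)"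

definition gamma_const :: "nat \<Rightarrow> real" where
  "gamma_const n = Gamma ((real n + 1) / 2) / pi powr ((real n + 1) / 2)"


subsection \<open>The off-diagonal modulus of the half gradient\<close>

text \<open>The square $|d_{1/2} v|_{od}^2 (x)$. The value space is general so that it also applies to the
  matrix-valued gradient, whose \<open>norm\<close> is the Frobenius norm.\<close>

definition od_sq :: "(real^'n \<Rightarrow> 'b::real_normed_vector) \<Rightarrow> real^'n \<Rightarrow> ennreal" where
  "od_sq v x = ennreal (gamma_const CARD('n) / 2) *
     (\<integral>\<^sup>+ h. ennreal ((norm (v (x + h) - v x))\<^sup>2 / norm h ^ (CARD('n) + 1)) \<partial>lebesgue)"

definition od :: "(real^'n \<Rightarrow> 'b::real_normed_vector) \<Rightarrow> real^'n \<Rightarrow> ennreal" where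
  "od v x = ennreal_sqrt (od_sq v x)"


subsection \<open>The Poisson semigroup\<close>

definition poisson_profile :: "real^'n \<Rightarrow> real" where
  "poisson_profile x =
     gamma_const CARD('n) * (1 + (norm x)\<^sup>2) powr (- ((real CARD('n) + 1) / 2))"

definition poisson_kernel :: "real \<Rightarrow> real^'n \<Rightarrow> real" where
  "poisson_kernel t x = poisson_profile (x /\<^sub>R t) / t ^ CARD('n)"

definition poisson_semigroup ::
    "real \<Rightarrow> (real^'n \<Rightarrow> 'b::euclidean_space) \<Rightarrow> real^'n \<Rightarrow> 'b" where
  "poisson_semigroup t f x = (LINT y|lebesgue. poisson_kernel t (x - y) *\<^sub>R f y)"


subsection \<open>The space of initial data\<close>

definition A_seminorm_sq :: "(real^'n \<Rightarrow> real^'m) \<Rightarrow> ennreal" where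
  "A_seminorm_sq a =
     (SUP r \<in> {0<..}. SUP x. \<integral>\<^sup>+ s \<in> {0<..<r}.
        ball_average x r (od_sq (poisson_semigroup s a)) \<partial>lebesgue)"

definition A_space :: "(real^'n \<Rightarrow> real^'m) set" where
  "A_space = {a \<in> borel_measurable lebesgue.
     esssup lebesgue (\<lambda>x. ennreal (norm (a x))) < top \<and> A_seminorm_sq a < top}"


subsection \<open>Weak spatial gradient\<close>

primrec C_k :: "nat \<Rightarrow> ('a::euclidean_space \<Rightarrow> real) \<Rightarrow> bool" where
  "C_k 0 f = continuous_on UNIV f"
| "C_k (Suc k) f = ((\<forall>x. f differentiable (at x)) \<and>
     (\<forall>b\<in>Basis. C_k k (\<lambda>x. frechet_derivative f (at x) b)))"

definition test_function :: "'a::euclidean_space set \<Rightarrow> ('a \<Rightarrow> real) \<Rightarrow> bool" where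
  "test_function U \<phi> \<longleftrightarrow> (\<forall>k. C_k k \<phi>) \<and>
     compact (closure {z. \<phi> z \<noteq> 0}) \<and> closure {z. \<phi> z \<noteq> 0} \<subseteq> U"

definition locally_integrable_on ::
    "('a::euclidean_space \<Rightarrow> 'b::euclidean_space) \<Rightarrow> 'a set \<Rightarrow> bool" where
  "locally_integrable_on f U \<longleftrightarrow>
     (\<forall>K. compact K \<and> K \<subseteq> U \<longrightarrow> set_integrable lebesgue K f)"

text \<open>\<open>G\<close> has entries \<open>G z $ i $ j\<close> $= \partial_{x_j} u_i (z)$; there is no derivative in time.\<close>

definition weak_gradient ::
    "ereal \<Rightarrow> ((real^'n) \<times> real \<Rightarrow> real^'m) \<Rightarrow> ((real^'n) \<times> real \<Rightarrow> real^'n^'m) \<Rightarrow> bool" where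
  "weak_gradient T u G \<longleftrightarrow>
     locally_integrable_on u (slab T) \<and> locally_integrable_on G (slab T) \<and>
     (\<forall>\<phi> j. test_function (slab T) \<phi> \<longrightarrow>
        (LINT z|lebesgue. frechet_derivative \<phi> (at z) (axis j 1, 0) *\<^sub>R u z) =
        - (LINT z|lebesgue. \<phi> z *\<^sub>R column j (G z)))"


subsection \<open>The solution space\<close>

text \<open>With \<open>k = 0\<close>, \<open>w = u\<close> this is $[u]_{X_T^{(0)}}$; with \<open>k = 1\<close> and \<open>w\<close> the spatial gradient
  of \<open>u\<close> it is $[u]_{X_T^{(1)}}$.\<close>

definition X_part ::
    "nat \<Rightarrow> ereal \<Rightarrow> ((real^'n) \<times> real \<Rightarrow> 'b::euclidean_space) \<Rightarrow> ennreal" where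
  "X_part k T w =
     esssup (lebesgue_on (slab T))
       (\<lambda>(x, t). ennreal (t powr (real k + 1 / 2)) * od (\<lambda>y. w (y, t)) x) +
     esssup (lebesgue_on (slab T))
       (\<lambda>(x, t). ennreal_sqrt (\<integral>\<^sup>+ s \<in> {0<..<t}.
          ball_average x t (\<lambda>y. ennreal (s ^ (2 * k)) * od_sq (\<lambda>y. w (y, s)) y) \<partial>lebesgue))"

definition X0_seminorm :: "ereal \<Rightarrow> ((real^'n) \<times> real \<Rightarrow> real^'m) \<Rightarrow> ennreal" where
  "X0_seminorm T u = X_part 0 T u"

text \<open>A weak gradient is unique up to null sets, so the infimum below is over a single value, and is
  infinite precisely if that value is or no weak gradient exists.\<close>

definition X1_seminorm :: "ereal \<Rightarrow> ((real^'n) \<times> real \<Rightarrow> real^'m) \<Rightarrow> ennreal" where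
  "X1_seminorm T u = (INF G \<in> {G. weak_gradient T u G}. X_part 1 T G)"

definition X_seminorm :: "ereal \<Rightarrow> ((real^'n) \<times> real \<Rightarrow> real^'m) \<Rightarrow> ennreal" where
  "X_seminorm T u = X0_seminorm T u + X1_seminorm T u"

definition X_norm :: "ereal \<Rightarrow> ((real^'n) \<times> real \<Rightarrow> real^'m) \<Rightarrow> ennreal" where
  "X_norm T u = esssup (lebesgue_on (slab T)) (\<lambda>z. ennreal (norm (u z))) + X_seminorm T u"

text \<open>Elements are representatives of classes modulo equality almost everywhere on \<open>slab T\<close>.\<close>

definition X_space :: "ereal \<Rightarrow> ((real^'n) \<times> real \<Rightarrow> real^'m) set" where
  "X_space T = {u \<in> borel_measurable (lebesgue_on (slab T)). X_norm T u < top}"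


subsection \<open>Mild solutions\<close>

text \<open>The source term \<open>u |d u|\<^sup>2\<close>. For \<open>u\<close> in \<open>X_space T\<close> the modulus is finite
  almost everywhere on \<open>slab T\<close>, so \<open>enn2real\<close> loses nothing.\<close>

definition source ::
    "((real^'n) \<times> real \<Rightarrow> real^'m) \<Rightarrow> real \<Rightarrow> real^'n \<Rightarrow> real^'m" where
  "source u s y = enn2real (od_sq (\<lambda>y. u (y, s)) y) *\<^sub>R u (y, s)"

definition duhamel ::
    "((real^'n) \<times> real \<Rightarrow> real^'m) \<Rightarrow> real \<Rightarrow> real^'n \<Rightarrow> real^'m" where
  "duhamel u t x =
     (LINT s:{0<..<t}|lebesgue. poisson_semigroup (t - s) (source u s) x)"

definition mild_solution ::
    "ereal \<Rightarrow> (real^'n \<Rightarrow> real^'m) \<Rightarrow> ((real^'n) \<times> real \<Rightarrow> real^'m) \<Rightarrow> bool" where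
  "mild_solution T a u \<longleftrightarrow>
     (AE (x, t) in lebesgue_on (slab T). u (x, t) = poisson_semigroup t a x + duhamel u t x)"

end

theory Submission
  imports Defs "HOL-Probability.Distributions"
begin

text \<open>
  Let $w = u_1 - u_2$ and $G_i = |d_{1/2} u_i|_{od}^2$. Because $|u_1| = |u_2| = 1$, we have
  $w \cdot u_1 = |w|^2/2 = - w \cdot u_2$, hence
  $w \cdot (u_1 G_1 - u_2 G_2) = \frac12 |w|^2 (G_1 + G_2)$: the fractional gradient of $w$ never
  enters. As $w$ solves the linear equation with right-hand side $u_1 G_1 - u_2 G_2$, a Kato
  inequality in mild form gives
  $$|w|^2(t) \le \int_0^t S(t-s)\big(|w|^2 (G_1+G_2)\big)(s)\,ds.$$
  It is obtained by telescoping over a fine time mesh, using the semigroup property and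
  the spatial continuity of $w$ at positive times. The $X^{(0)}$ bounds
  make $\int_0^t S(t-s)(G_1+G_2)(s)\,ds$ small near the initial time, so a supremum argument yields
  $w = 0$ there; later $G_1+G_2$ is bounded and the same argument advances by steps of fixed length.
\<close>

section \<open>Changes of variables and Gaussian integrals\<close>

text \<open>The difference w is known only as a bounded space-time integral, so instead of a chain
  rule for |w|^2, w(t) is compared with w(s) for s close to t. The cancellation concerns w and the
  source at the same point, whereas one step pairs w(x,t) with the source at (y,s). For the
  telescoped errors to vanish with the mesh, each must be o(1) times the step length, uniformly in
  x. Continuity provides this on times bounded away from 0 only, because G_1 + G_2 may grow like
  1/s. The telescoping therefore starts at some \<epsilon> > 0. Its starting term need not be
  uniformly small, as w is merely bounded near time 0; it is controlled pointwise by the portion of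
  a convergent Duhamel integral carried by times before \<epsilon>. Two constants are kept apart:
  one of arbitrary size, valid up to T, makes all integrals converge, and a small one near time 0
  makes the supremum argument contract. The bounds in the definition of X hold almost everywhere
  only; Borel versions are chosen so that the bounds up to T hold at every point.\<close>

lemma nn_integral_lborel_reflect:
  fixes f :: "'a::euclidean_space \<Rightarrow> ennreal"
  assumes [measurable]: "f \<in> borel_measurable borel"
  shows "(\<integral>\<^sup>+y. f (x - y) \<partial>lborel) = (\<integral>\<^sup>+y. f y \<partial>lborel)"
proof -
  have "(\<integral>\<^sup>+y. f y \<partial>lborel) =
      (\<integral>\<^sup>+y. f y \<partial>density (distr lborel borel (\<lambda>y. x + (-1) *\<^sub>R y)) (\<lambda>_. \<bar>-1::real\<bar>^DIM('a)))"
    using lborel_affine[of "-1" x] by simp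
  also have "\<dots> = (\<integral>\<^sup>+y. f (x - y) \<partial>lborel)"
    by (simp add: nn_integral_density nn_integral_distr)
  finally show ?thesis ..
qed

lemma nn_integral_lborel_translate:
  fixes f :: "'a::euclidean_space \<Rightarrow> ennreal"
  assumes [measurable]: "f \<in> borel_measurable borel"
  shows "(\<integral>\<^sup>+y. f (y + x) \<partial>lborel) = (\<integral>\<^sup>+y. f y \<partial>lborel)"
proof -
  have "(\<integral>\<^sup>+y. f y \<partial>lborel) = (\<integral>\<^sup>+y. f y \<partial>distr lborel borel (\<lambda>y. x + y))"
    using lborel_distr_plus[of x] by simp
  also have "\<dots> = (\<integral>\<^sup>+y. f (y + x) \<partial>lborel)"
    by (simp add: nn_integral_distr add.commute)
  finally show ?thesis ..
qed

text \<open>The change of variables for absolutely integrable functions is an equivalence: one side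
  is integrable iff the other is. For nonnegative functions this settles the infinite case as well,
  since both sides are then \<open>top\<close>.\<close>

lemma nn_integral_change_of_variables_real:
  fixes f g g' :: "real \<Rightarrow> real"
  assumes S [measurable]: "S \<in> sets borel" "g ` S \<in> sets borel"
    and [measurable]: "f \<in> borel_measurable borel"
      "g \<in> borel_measurable borel" "g' \<in> borel_measurable borel"
    and der: "\<And>x. x \<in> S \<Longrightarrow> (g has_field_derivative g' x) (at x)"
    and inj: "inj_on g S"
    and nn: "\<And>x. 0 \<le> f x"
  shows "(\<integral>\<^sup>+x\<in>g ` S. ennreal (f x) \<partial>lborel) = (\<integral>\<^sup>+x\<in>S. ennreal (\<bar>g' x\<bar> * f (g x)) \<partial>lborel)"
proof -
  have eq: "(\<integral>\<^sup>+x\<in>A. ennreal (h x) \<partial>lborel) = (\<integral>\<^sup>+x. ennreal (indicator A x *\<^sub>R h x) \<partial>lebesgue)"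
    for h :: "real \<Rightarrow> real" and A
    by (simp add: nn_integral_completion) (rule nn_integral_cong, auto simp: indicator_def)
  have si: "h absolutely_integrable_on A \<longleftrightarrow> (\<integral>\<^sup>+x\<in>A. ennreal (h x) \<partial>lborel) < \<infinity>"
    if [measurable]: "h \<in> borel_measurable borel" "A \<in> sets borel" and "\<And>x. 0 \<le> h x"
    for h :: "real \<Rightarrow> real" and A
    unfolding eq set_integrable_def using that
    by (subst integrable_iff_bounded)
       (auto simp: measurable_completion intro!: measurable_completion)
  have val: "(\<integral>\<^sup>+x\<in>A. ennreal (h x) \<partial>lborel) = ennreal (integral A h)"
    if "h absolutely_integrable_on A" and "\<And>x. 0 \<le> h x"
    for h :: "real \<Rightarrow> real" and A
    unfolding eq using that
    by (subst nn_integral_eq_integral)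
       (auto simp: set_integrable_def set_lebesgue_integral_def
         set_lebesgue_integral_eq_integral(2)[OF that(1), symmetric] indicator_def)
  note cv = has_absolute_integral_change_of_variables_1'[of S g g' f, OF _ _ inj]
  have cv': "(\<lambda>x. \<bar>g' x\<bar> * f (g x)) absolutely_integrable_on S \<and>
           integral S (\<lambda>x. \<bar>g' x\<bar> * f (g x)) = b
     \<longleftrightarrow> f absolutely_integrable_on (g ` S) \<and> integral (g ` S) f = b" for b
    by (rule cv) (use der S in \<open>auto intro: DERIV_subset\<close>)
  show ?thesis
  proof (cases "f absolutely_integrable_on (g ` S)")
    case True
    then have "(\<lambda>x. \<bar>g' x\<bar> * f (g x)) absolutely_integrable_on S"
      "integral S (\<lambda>x. \<bar>g' x\<bar> * f (g x)) = integral (g ` S) f"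
      using cv' by blast+
    then show ?thesis using True nn by (subst (1 2) val) auto
  next
    case False
    then have "\<not> (\<lambda>x. \<bar>g' x\<bar> * f (g x)) absolutely_integrable_on S"
      using cv' by blast
    then show ?thesis using False nn si[of f "g ` S"] si[of "\<lambda>x. \<bar>g' x\<bar> * f (g x)" S]
      by (simp add: less_top[symmetric])
  qed
qed

text \<open>This integral performs the subordination: A = t^2 + |x|^2 with s = (n+1)/2 produces the
  power in the Poisson kernel, and A = t^2 with s = 1/2 produces its total mass.\<close>

lemma nn_integral_scaled_Gamma:
  fixes A s :: real
  assumes "A > 0" "s > 0"
  shows "(\<integral>\<^sup>+v\<in>{0<..}. ennreal (v powr (s - 1) * exp (- A * v)) \<partial>lborel) = ennreal (Gamma s * A powr - s)"
proof -
  have "ennreal (Gamma s) = (\<integral>\<^sup>+t. ennreal (indicator {0..} t * t powr (s - 1) / exp t) \<partial>lborel)"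
    using assms by (rule_tac Gamma_conv_nn_integral_real) auto
  also have "\<dots> = ennreal \<bar>A\<bar> * (\<integral>\<^sup>+t. ennreal (indicator {0..} (0 + A*t) * (0+A*t) powr (s - 1) / exp (0+A*t)) \<partial>lborel)"
    using assms by (subst nn_integral_real_affine[where t=0 and c=A]) auto
  also have "(\<integral>\<^sup>+t. ennreal (indicator {0..} (0 + A*t) * (0+A*t) powr (s - 1) / exp (0+A*t)) \<partial>lborel)
     = (\<integral>\<^sup>+t. ennreal (A powr (s-1)) * (ennreal (t powr (s - 1) * exp (- A * t)) * indicator {0<..} t) \<partial>lborel)"
    by (intro nn_integral_cong)
      (use assms in \<open>auto simp: indicator_def zero_le_mult_iff ennreal_mult[symmetric] powr_mult exp_minus field_simps
       split: if_splits\<close>)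
  also have "ennreal \<bar>A\<bar> * \<dots> = ennreal \<bar>A\<bar> * ennreal (A powr (s-1)) *
     (\<integral>\<^sup>+v\<in>{0<..}. ennreal (v powr (s - 1) * exp (- A * v)) \<partial>lborel)"
    by (subst nn_integral_cmult) (auto simp: mult.assoc)
  also have "ennreal \<bar>A\<bar> * ennreal (A powr (s-1)) = ennreal (A powr s)"
    using assms by (simp add: ennreal_mult[symmetric] powr_diff)
  finally have *: "ennreal (Gamma s) = ennreal (A powr s) * (\<integral>\<^sup>+v\<in>{0<..}. ennreal (v powr (s - 1) * exp (- A * v)) \<partial>lborel)" .
  have "ennreal (Gamma s * A powr - s) = ennreal (A powr - s) * ennreal (Gamma s)"
    using assms by (simp add: ennreal_mult[symmetric] mult.commute)
  also have "\<dots> = ennreal (A powr - s) * ennreal (A powr s) * (\<integral>\<^sup>+v\<in>{0<..}. ennreal (v powr (s - 1) * exp (- A * v)) \<partial>lborel)"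
    unfolding * by (simp add: mult.assoc)
  also have "ennreal (A powr - s) * ennreal (A powr s) = 1"
    using assms by (simp add: ennreal_mult[symmetric] powr_add[symmetric])
  finally show ?thesis by simp
qed

lemma nn_integral_gaussian_real:
  fixes c :: real
  assumes "c > 0"
  shows "(\<integral>\<^sup>+x. ennreal (exp (- c * x\<^sup>2)) \<partial>lborel) = ennreal (sqrt (pi / c))"
proof -
  \<comment> \<open>This variance turns the exponent -x^2 / (2 \<sigma>^2) of the normal density
    into -c x^2.\<close>
  define \<sigma> where "\<sigma> = 1 / sqrt (2 * c)"
  have \<sigma>: "\<sigma> > 0" "2 * \<sigma>\<^sup>2 = 1 / c" using assms by (auto simp: \<sigma>_def power_divide)
  have *: "normal_density 0 \<sigma> x = sqrt (c / pi) * exp (- c * x\<^sup>2)" for x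
    using assms unfolding normal_density_def
    by (simp add: \<sigma>(2) real_sqrt_divide mult.assoc[symmetric] mult.commute[of 2 pi] )
       (simp add: \<sigma>(2) mult.assoc real_sqrt_divide)
  interpret prob_space "density lborel (normal_density 0 \<sigma>)"
    using \<sigma> by (rule_tac prob_space_normal_density) auto
  have "(\<integral>\<^sup>+x. ennreal (normal_density 0 \<sigma> x) \<partial>lborel) = 1"
    using emeasure_space_1 by (simp add: emeasure_density)
  then have "ennreal (sqrt (c/pi)) * (\<integral>\<^sup>+x. ennreal (exp (- c * x\<^sup>2)) \<partial>lborel) = 1"
    unfolding * using assms by (simp add: ennreal_mult nn_integral_cmult)
  then have "ennreal (sqrt (pi/c)) * (ennreal (sqrt (c/pi)) * (\<integral>\<^sup>+x. ennreal (exp (- c * x\<^sup>2)) \<partial>lborel)) = ennreal (sqrt (pi/c))"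
    by simp
  moreover have "ennreal (sqrt (pi/c)) * ennreal (sqrt (c/pi)) = 1"
    using assms by (simp add: ennreal_mult[symmetric] real_sqrt_mult[symmetric])
  ultimately show ?thesis by (simp add: mult.assoc[symmetric])
qed

lemma nn_integral_gaussian:
  fixes z :: "'a::euclidean_space" and c :: real
  assumes "c > 0"
  shows "(\<integral>\<^sup>+y. ennreal (exp (- c * (norm (y - z))\<^sup>2)) \<partial>lborel) = ennreal ((pi / c) powr (DIM('a) / 2))"
proof -
  have n: "exp (- c * (norm y)\<^sup>2) = (\<Prod>b\<in>Basis. exp (- c * (y \<bullet> b)\<^sup>2))" for y :: 'a
    unfolding exp_sum[symmetric, OF finite_Basis] power2_norm_eq_inner
    by (subst euclidean_inner) (simp add: sum_distrib_left power2_eq_square)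
  have "(\<integral>\<^sup>+y. ennreal (exp (- c * (norm (y - z))\<^sup>2)) \<partial>lborel) = (\<integral>\<^sup>+y. ennreal (exp (- c * (norm (y::'a))\<^sup>2)) \<partial>lborel)"
    using nn_integral_lborel_translate[of "\<lambda>y. ennreal (exp (- c * (norm y)\<^sup>2))" "-z"] by simp
  also have "\<dots> = (\<integral>\<^sup>+y. (\<Prod>b\<in>Basis. ennreal (exp (- c * ((y::'a) \<bullet> b)\<^sup>2))) \<partial>lborel)"
    unfolding n by (subst prod_ennreal) auto
  also have "\<dots> = (\<Prod>b\<in>(Basis::'a set). \<integral>\<^sup>+x. ennreal (exp (- c * x\<^sup>2)) \<partial>lborel)"
    by (rule nn_integral_lborel_prod) auto
  also have "\<dots> = ennreal (sqrt (pi / c)) ^ DIM('a)"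
    unfolding nn_integral_gaussian_real[OF assms] by simp
  also have "\<dots> = ennreal ((pi / c) powr (DIM('a) / 2))"
    using assms by (simp add: ennreal_power powr_half_sqrt[symmetric] powr_realpow[symmetric] powr_powr)
  finally show ?thesis .
qed

text \<open>Completing the square about a/(a+b) x splits off the dependence on x and leaves a
  translated Gaussian with parameter a+b.\<close>

lemma gaussian_convolution:
  fixes x :: "'a::euclidean_space" and a b :: real
  assumes "a > 0" "b > 0"
  shows "(\<integral>\<^sup>+y. ennreal (exp (- a * (norm (x - y))\<^sup>2) * exp (- b * (norm y)\<^sup>2)) \<partial>lborel) =
    ennreal ((pi / (a + b)) powr (DIM('a) / 2) * exp (- (a * b / (a + b)) * (norm x)\<^sup>2))"
proof -
  have ab: "a + b > 0" using assms by simp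
  have sq: "a * (norm (x - y))\<^sup>2 + b * (norm y)\<^sup>2 =
     (a + b) * (norm (y - (a / (a + b)) *\<^sub>R x))\<^sup>2 + (a * b / (a + b)) * (norm x)\<^sup>2" for y
  proof -
    have "(a + b) * (norm (y - q *\<^sub>R x))\<^sup>2 =
       (a + b) * (y \<bullet> y) - 2 * ((a + b) * q) * (x \<bullet> y) + ((a + b) * q) * q * (x \<bullet> x)" for q
      unfolding power2_norm_eq_inner by (simp add: algebra_simps inner_commute)
    note this[of "a / (a + b)"]
    also have "(a + b) * (a / (a + b)) = a" using ab by simp
    finally have 1: "(a + b) * (norm (y - (a / (a + b)) *\<^sub>R x))\<^sup>2 = (a + b) * (y \<bullet> y) - 2 * a * (x \<bullet> y) + a * (a / (a + b)) * (x \<bullet> x)" .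
    have 2: "a * (a / (a + b)) + a * b / (a + b) = a"
      using ab by (simp add: add_divide_distrib[symmetric] distrib_left[symmetric])
    have "(a + b) * (norm (y - (a / (a + b)) *\<^sub>R x))\<^sup>2 + (a * b / (a + b)) * (norm x)\<^sup>2 =
       (a + b) * (y \<bullet> y) - 2 * a * (x \<bullet> y) + (a * (a / (a + b)) + a * b / (a + b)) * (x \<bullet> x)"
      unfolding 1 by (simp add: power2_norm_eq_inner distrib_right)
    also have "\<dots> = a * (norm (x - y))\<^sup>2 + b * (norm y)\<^sup>2"
      unfolding 2 power2_norm_eq_inner by (simp add: algebra_simps inner_commute)
    finally show ?thesis ..
  qed
  have "(\<integral>\<^sup>+y. ennreal (exp (- a * (norm (x - y))\<^sup>2) * exp (- b * (norm y)\<^sup>2)) \<partial>lborel) =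
    (\<integral>\<^sup>+y. ennreal (exp (- (a * b / (a + b)) * (norm x)\<^sup>2)) * ennreal (exp (- (a + b) * (norm (y - (a / (a + b)) *\<^sub>R x))\<^sup>2)) \<partial>lborel)"
    using sq by (intro nn_integral_cong) (simp add: ennreal_mult[symmetric] exp_add[symmetric] algebra_simps)
  also have "\<dots> = ennreal (exp (- (a * b / (a + b)) * (norm x)\<^sup>2)) * ennreal ((pi / (a + b)) powr (DIM('a) / 2))"
    by (subst nn_integral_cmult) (use nn_integral_gaussian[OF ab, of "(a / (a + b)) *\<^sub>R x"] in auto)
  finally show ?thesis by (simp add: ennreal_mult[symmetric] mult.commute)
qed

section \<open>The Poisson kernel and its semigroup property\<close>

text \<open>The map g(y) = s sqrt y - t / sqrt y is a bijection from the positive half-line onto the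
  real line, and g' mixes the weights 1 / sqrt y and 1 / (y sqrt y). The Gaussian integral therefore
  fixes one linear combination of the weighted integrals \<open>K1\<close> and \<open>K2\<close>,
  and the involution y -> (t/s)^2 / y fixes their ratio. The claim is about their sum.\<close>

lemma nn_integral_Cauchy_Schloemilch:
  fixes s t v :: real
  assumes st: "s > 0" "t > 0" and v: "v > 0"
  shows "(\<integral>\<^sup>+y\<in>{0<..}. ennreal ((1 + y) / (y * sqrt y) * exp (- v * (s * sqrt y - t / sqrt y)\<^sup>2)) \<partial>lborel)
    = ennreal (sqrt (pi / v) * (1 / s + 1 / t))"
proof -
  define E where "E y = exp (- v * (s * sqrt y - t / sqrt y)\<^sup>2)" for y
  have [measurable]: "E \<in> borel_measurable borel" unfolding E_def by measurable
  have E0: "E y > 0" for y unfolding E_def by simp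
  \<comment> \<open>\<open>sqrt\<close> is negative on negative reals, and the change of variables
    applied to \<open>K1\<close> below asks for an integrand that is nonnegative everywhere; hence
    the absolute value.\<close>
  define K1 where "K1 = (\<integral>\<^sup>+y\<in>{0<..}. ennreal (E y / sqrt \<bar>y\<bar>) \<partial>lborel)"
  define K2 where "K2 = (\<integral>\<^sup>+y\<in>{0<..}. ennreal (E y / (y * sqrt y)) \<partial>lborel)"
  define g where "g y = s * sqrt y - t / sqrt y" for y
  define g' where "g' y = s / (2 * sqrt y) + t / (2 * (y * sqrt y))" for y
  have [measurable]: "g \<in> borel_measurable borel" "g' \<in> borel_measurable borel"
    unfolding g_def g'_def by measurable
  have g'_pos: "g' y > 0" if "y > 0" for y using that st by (auto simp: g'_def intro!: add_pos_pos)
  have der: "(g has_field_derivative g' y) (at y)" if "y \<in> {0<..}" for y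
    using that unfolding g_def g'_def
    by (auto intro!: derivative_eq_intros simp: field_simps power2_eq_square)
  have inj: "inj_on g {0<..}"
  proof (rule inj_onI)
    fix x y :: real assume xy: "x \<in> {0<..}" "y \<in> {0<..}" "g x = g y"
    have *: "g a < g b" if "0 < a" "a < b" for a b
      unfolding g_def using that st by (intro diff_strict_mono mult_strict_left_mono divide_strict_left_mono) auto
    show "x = y" using *[of x y] *[of y x] xy by (cases x y rule: linorder_cases) auto
  qed
  have im: "g ` {0<..} = UNIV"
  proof (intro equalityI subset_UNIV subsetI)
    fix u :: real
    \<comment> \<open>With r = sqrt y, the equation g(y) = u becomes s r^2 - u r - t = 0; this is
      its positive root.\<close>
    define r where "r = (u + sqrt (u\<^sup>2 + 4 * s * t)) / (2 * s)"
    have sq: "(sqrt (u\<^sup>2 + 4 * s * t))\<^sup>2 = u\<^sup>2 + 4 * s * t" using st by simp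
    have "sqrt (u\<^sup>2 + 4 * s * t) > sqrt (u\<^sup>2)" using st by (intro real_sqrt_less_mono) simp
    then have r: "r > 0" unfolding r_def using st by (simp add: abs_real_def split: if_splits)
    have "(2 * s * r - u)\<^sup>2 = u\<^sup>2 + 4 * s * t" unfolding r_def using st sq by simp
    then have "4 * s * (s * r\<^sup>2 - u * r - t) = 0" by (simp add: power2_eq_square algebra_simps)
    then have "s * r\<^sup>2 - t = u * r" using st by simp
    then have "s * r - t / r = u" using r by (simp add: field_simps power2_eq_square)
    then have "g (r\<^sup>2) = u" unfolding g_def using r by simp
    then show "u \<in> g ` {0<..}" using r by (intro image_eqI[of _ _ "r\<^sup>2"]) auto
  qed
  have "ennreal (sqrt (pi / v)) = (\<integral>\<^sup>+u\<in>g ` {0<..}. ennreal (exp (- v * u\<^sup>2)) \<partial>lborel)"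
    unfolding im using nn_integral_gaussian_real[OF v] by simp
  also have "\<dots> = (\<integral>\<^sup>+y\<in>{0<..}. ennreal (\<bar>g' y\<bar> * exp (- v * (g y)\<^sup>2)) \<partial>lborel)"
    by (rule nn_integral_change_of_variables_real) (use der inj im in auto)
  also have "\<dots> = (\<integral>\<^sup>+y. ennreal (s / 2) * (ennreal (E y / sqrt \<bar>y\<bar>) * indicator {0<..} y)
      + ennreal (t / 2) * (ennreal (E y / (y * sqrt y)) * indicator {0<..} y) \<partial>lborel)"
  proof (rule nn_integral_cong)
    fix y :: real
    have "\<bar>g' y\<bar> * exp (- v * (g y)\<^sup>2) = s / 2 * (E y / sqrt \<bar>y\<bar>) + t / 2 * (E y / (y * sqrt y))" if "y > 0"
      using g'_pos[OF that] that unfolding E_def g_def by (simp add: g'_def field_simps)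
    then show "ennreal (\<bar>g' y\<bar> * exp (- v * (g y)\<^sup>2)) * indicator {0<..} y =
      ennreal (s / 2) * (ennreal (E y / sqrt \<bar>y\<bar>) * indicator {0<..} y)
      + ennreal (t / 2) * (ennreal (E y / (y * sqrt y)) * indicator {0<..} y)"
      using st E0[of y] by (cases "y > 0") (simp_all add: ennreal_mult[symmetric] ennreal_plus[symmetric] del: ennreal_plus)
  qed
  also have "\<dots> = ennreal (s / 2) * K1 + ennreal (t / 2) * K2"
    unfolding K1_def K2_def by (simp add: nn_integral_add nn_integral_cmult)
  finally have sum: "ennreal (sqrt (pi / v)) = ennreal (s / 2) * K1 + ennreal (t / 2) * K2" .
  \<comment> \<open>This involution exchanges s sqrt y and t / sqrt y up to sign of their
    difference, so it leaves \<open>E\<close> invariant while turning the weight of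
    \<open>K1\<close> into t/s times that of \<open>K2\<close>.\<close>
  define h where "h y = (t / s)\<^sup>2 / y" for y
  have imh: "h ` {0<..} = {0<..}"
  proof (intro equalityI subsetI)
    fix u :: real assume "u \<in> {0<..}"
    then show "u \<in> h ` {0<..}" using st by (intro image_eqI[of _ _ "h u"]) (auto simp: h_def)
  qed (use st in \<open>auto simp: h_def\<close>)
  have "K1 = (\<integral>\<^sup>+y\<in>h ` {0<..}. ennreal (E y / sqrt \<bar>y\<bar>) \<partial>lborel)" unfolding K1_def imh ..
  also have "\<dots> = (\<integral>\<^sup>+y\<in>{0<..}. ennreal (\<bar>- (t / s)\<^sup>2 / y\<^sup>2\<bar> * (E (h y) / sqrt \<bar>h y\<bar>)) \<partial>lborel)"
  proof (rule nn_integral_change_of_variables_real)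
    show "h \<in> borel_measurable borel" unfolding h_def by measurable
    show "(h has_real_derivative - (t / s)\<^sup>2 / x\<^sup>2) (at x)" if "x \<in> {0<..}" for x
      unfolding h_def using that st by (auto intro!: derivative_eq_intros simp: power2_eq_square)
    show "inj_on h {0<..}" using st by (auto intro!: inj_onI simp: h_def field_simps)
  qed (use imh E0 in \<open>auto simp: less_imp_le\<close>)
  also have "\<dots> = (\<integral>\<^sup>+y. ennreal (t / s) * (ennreal (E y / (y * sqrt y)) * indicator {0<..} y) \<partial>lborel)"
  proof (rule nn_integral_cong)
    fix y :: real
    have "\<bar>- (t / s)\<^sup>2 / y\<^sup>2\<bar> * (E (h y) / sqrt \<bar>h y\<bar>) = t / s * (E y / (y * sqrt y))" if y: "y > 0"
    proof -
      have sh: "sqrt (h y) = (t / s) / sqrt y" unfolding h_def using st y by (simp add: real_sqrt_divide)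
      have "E (h y) = exp (- v * (t / sqrt y - s * sqrt y)\<^sup>2)" unfolding E_def sh using st by simp
      also have "\<dots> = E y" unfolding E_def by (simp add: power2_commute)
      finally have Eh: "E (h y) = E y" .
      have hy: "\<bar>h y\<bar> = h y" using y by (simp add: h_def)
      have "sqrt y * sqrt y = y" using y by simp
      then show ?thesis unfolding Eh hy sh using y st
        by (simp add: field_simps power2_eq_square)
    qed
    then show "ennreal (\<bar>- (t / s)\<^sup>2 / y\<^sup>2\<bar> * (E (h y) / sqrt \<bar>h y\<bar>)) * indicator {0<..} y =
       ennreal (t / s) * (ennreal (E y / (y * sqrt y)) * indicator {0<..} y)"
      using st E0[of y] by (cases "y > 0") (simp_all add: ennreal_mult[symmetric])
  qed
  also have "\<dots> = ennreal (t / s) * K2" unfolding K2_def by (simp add: nn_integral_cmult)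
  finally have K1: "K1 = ennreal (t / s) * K2" .
  have "ennreal (sqrt (pi / v)) = (ennreal (s / 2 * (t / s)) + ennreal (t / 2)) * K2"
    unfolding sum K1 using st by (subst ennreal_mult) (auto simp: distrib_right mult.assoc)
  also have "\<dots> = ennreal t * K2" using st by (simp add: ennreal_plus[symmetric] del: ennreal_plus)
  finally have tK2: "ennreal t * K2 = ennreal (sqrt (pi / v))" ..
  have K2: "K2 = ennreal (sqrt (pi / v) / t)"
  proof -
    have "K2 = ennreal (1 / t) * (ennreal t * K2)" using st by (simp add: mult.assoc[symmetric] ennreal_mult[symmetric])
    also have "\<dots> = ennreal (sqrt (pi / v) / t)" unfolding tK2 using st v by (simp add: ennreal_mult[symmetric])
    finally show ?thesis .
  qed
  have "(\<integral>\<^sup>+y\<in>{0<..}. ennreal ((1 + y) / (y * sqrt y) * exp (- v * (s * sqrt y - t / sqrt y)\<^sup>2)) \<partial>lborel)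
    = (\<integral>\<^sup>+y. ennreal (E y / sqrt \<bar>y\<bar>) * indicator {0<..} y + ennreal (E y / (y * sqrt y)) * indicator {0<..} y \<partial>lborel)"
  proof (rule nn_integral_cong)
    fix y :: real
    have "(1 + y) / (y * sqrt y) * E y = E y / sqrt \<bar>y\<bar> + E y / (y * sqrt y)" if "y > 0"
      using that by (simp add: field_simps)
    then show "ennreal ((1 + y) / (y * sqrt y) * exp (- v * (s * sqrt y - t / sqrt y)\<^sup>2)) * indicator {0<..} y
      = ennreal (E y / sqrt \<bar>y\<bar>) * indicator {0<..} y + ennreal (E y / (y * sqrt y)) * indicator {0<..} y"
      unfolding E_def[symmetric] using E0[of y]
      by (cases "y > 0") (simp_all add: ennreal_plus[symmetric] del: ennreal_plus)
  qed
  also have "\<dots> = K1 + K2" unfolding K1_def K2_def by (simp add: nn_integral_add)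
  also have "\<dots> = ennreal (sqrt (pi / v) * (1 / s + 1 / t))"
    unfolding K1 K2 using st v
    by (simp add: ennreal_mult[symmetric] ennreal_plus[symmetric] field_simps del: ennreal_plus)
  finally show ?thesis .
qed

section \<open>Subordination and normalisation of the Poisson kernel\<close>

lemma gamma_const_pos: "gamma_const n > 0"
  unfolding gamma_const_def by (intro divide_pos_pos Gamma_real_pos) auto

lemma poisson_kernel_eq:
  fixes x :: "real^'n"
  assumes "t > 0"
  shows "poisson_kernel t x =
    gamma_const CARD('n) * t * (t\<^sup>2 + (norm x)\<^sup>2) powr (- ((real CARD('n) + 1) / 2))"
proof -
  have p: "t\<^sup>2 + (norm x)\<^sup>2 > 0" using assms by (simp add: add_pos_nonneg)
  have "1 + (norm (x /\<^sub>R t))\<^sup>2 = (t\<^sup>2 + (norm x)\<^sup>2) / t\<^sup>2"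
    using assms by (simp add: field_simps power_mult_distrib power2_eq_square)
  then have "poisson_kernel t x = gamma_const CARD('n) * ((t\<^sup>2 + (norm x)\<^sup>2) / t\<^sup>2) powr (- ((real CARD('n) + 1) / 2)) / t ^ CARD('n)"
    unfolding poisson_kernel_def poisson_profile_def by simp
  also have "((t\<^sup>2 + (norm x)\<^sup>2) / t\<^sup>2) powr (- ((real CARD('n) + 1) / 2)) =
     (t\<^sup>2 + (norm x)\<^sup>2) powr (- ((real CARD('n) + 1) / 2)) * t powr (real CARD('n) + 1)"
    using assms p by (simp add: powr_divide powr_minus powr_powr divide_simps flip: powr_numeral)
       (simp add: add_divide_distrib)
  also have "t powr (real CARD('n) + 1) = t ^ CARD('n) * t"
    using assms by (simp add: powr_add powr_realpow)
  finally show ?thesis using assms by simp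
qed

lemma poisson_kernel_pos: "t > 0 \<Longrightarrow> poisson_kernel t x > 0"
  by (simp add: poisson_kernel_eq gamma_const_pos add_pos_nonneg)

lemma poisson_kernel_measurable [measurable (raw)]:
  assumes [measurable]: "f \<in> borel_measurable M" "g \<in> borel_measurable M"
  shows "(\<lambda>x. poisson_kernel (f x) (g x :: real^'n)) \<in> borel_measurable M"
  unfolding poisson_kernel_def poisson_profile_def by measurable

text \<open>Euler's integral with A = t^2 + |x|^2. The factor Gamma((n+1)/2) that it produces is the
  numerator of \<open>gamma_const\<close>, and the power of pi in the mixing weight is its
  denominator.\<close>

lemma poisson_kernel_mixture:
  fixes x :: "real^'n"
  assumes t: "t > 0"
  shows "ennreal (poisson_kernel t x) =
    (\<integral>\<^sup>+v\<in>{0<..}. ennreal (t * pi powr (- ((real CARD('n) + 1) / 2)) *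
       (v powr ((real CARD('n) - 1) / 2) * exp (- v * (t\<^sup>2 + (norm x)\<^sup>2)))) \<partial>lborel)"
proof -
  define N where "N = real CARD('n)"
  define A where "A = t\<^sup>2 + (norm x)\<^sup>2"
  have A: "A > 0" using t by (simp add: A_def add_pos_nonneg)
  have "(\<integral>\<^sup>+v\<in>{0<..}. ennreal (t * pi powr (- ((N + 1) / 2)) * (v powr ((N - 1) / 2) * exp (- v * A))) \<partial>lborel)
    = (\<integral>\<^sup>+v. ennreal (t * pi powr (- ((N + 1) / 2))) * (ennreal (v powr ((N + 1) / 2 - 1) * exp (- A * v)) * indicator {0<..} v) \<partial>lborel)"
  proof (rule nn_integral_cong)
    fix v :: real
    have "(N - 1) / 2 = (N + 1) / 2 - 1" by (simp add: field_simps)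
    then show "ennreal (t * pi powr (- ((N + 1) / 2)) * (v powr ((N - 1) / 2) * exp (- v * A))) * indicator {0<..} v =
       ennreal (t * pi powr (- ((N + 1) / 2))) * (ennreal (v powr ((N + 1) / 2 - 1) * exp (- A * v)) * indicator {0<..} v)"
      using t by (simp add: ennreal_mult' mult.assoc mult.commute[of A])
  qed
  also have "\<dots> = ennreal (t * pi powr (- ((N + 1) / 2))) * ennreal (Gamma ((N + 1) / 2) * A powr - ((N + 1) / 2))"
    by (subst nn_integral_cmult) (use nn_integral_scaled_Gamma[OF A, of "(N + 1) / 2"] in \<open>auto simp: N_def\<close>)
  also have "\<dots> = ennreal (poisson_kernel t x)"
    unfolding poisson_kernel_eq[OF t] gamma_const_def N_def[symmetric] A_def[symmetric]
    using t by (simp add: ennreal_mult'[symmetric] powr_minus field_simps)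
  finally show ?thesis unfolding N_def A_def ..
qed

text \<open>Integrating the mixture in x first turns each Gaussian into (pi/v)^(n/2). The powers of
  v combine to v^(-1/2), whose Laplace transform at t^2 is sqrt pi / t, and all powers of pi
  cancel.\<close>

lemma nn_integral_poisson_kernel:
  assumes t: "t > 0"
  shows "(\<integral>\<^sup>+x. ennreal (poisson_kernel t (x :: real^'n)) \<partial>lborel) = 1"
proof -
  define N where "N = real CARD('n)"
  define c where "c = t * pi powr (- ((N + 1) / 2))"
  have c: "c > 0" using t by (simp add: c_def)
  have "(\<integral>\<^sup>+x. ennreal (poisson_kernel t (x :: real^'n)) \<partial>lborel) =
    (\<integral>\<^sup>+x. (\<integral>\<^sup>+v\<in>{0<..}. ennreal (c * (v powr ((N - 1) / 2) * exp (- v * (t\<^sup>2 + (norm (x :: real^'n))\<^sup>2)))) \<partial>lborel) \<partial>lborel)"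
    unfolding poisson_kernel_mixture[OF t] c_def N_def ..
  also have "\<dots> = (\<integral>\<^sup>+v. (\<integral>\<^sup>+x. ennreal (c * (v powr ((N - 1) / 2) * exp (- v * (t\<^sup>2 + (norm (x :: real^'n))\<^sup>2)))) * indicator {0<..} v \<partial>lborel) \<partial>lborel)"
    by (subst lborel_pair.Fubini') auto
  also have "\<dots> = (\<integral>\<^sup>+v. ennreal (c * pi powr (N / 2)) * (ennreal (v powr (1 / 2 - 1) * exp (- t\<^sup>2 * v)) * indicator {0<..} v) \<partial>lborel)"
  proof (rule nn_integral_cong)
    fix v :: real
    show "(\<integral>\<^sup>+x. ennreal (c * (v powr ((N - 1) / 2) * exp (- v * (t\<^sup>2 + (norm (x :: real^'n))\<^sup>2)))) * indicator {0<..} v \<partial>lborel)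
       = ennreal (c * pi powr (N / 2)) * (ennreal (v powr (1 / 2 - 1) * exp (- t\<^sup>2 * v)) * indicator {0<..} v)"
    proof (cases "v > 0")
      case v: True
      have "(\<integral>\<^sup>+x. ennreal (c * (v powr ((N - 1) / 2) * exp (- v * (t\<^sup>2 + (norm (x :: real^'n))\<^sup>2)))) * indicator {0<..} v \<partial>lborel)
        = (\<integral>\<^sup>+x. ennreal (c * v powr ((N - 1) / 2) * exp (- v * t\<^sup>2)) * ennreal (exp (- v * (norm (x - 0 :: real^'n))\<^sup>2)) \<partial>lborel)"
        by (intro nn_integral_cong) (use v c in \<open>simp add: ennreal_mult[symmetric] mult.assoc exp_add[symmetric] distrib_left\<close>)
      also have "\<dots> = ennreal (c * v powr ((N - 1) / 2) * exp (- v * t\<^sup>2)) * ennreal ((pi / v) powr (N / 2))"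
        by (subst nn_integral_cmult) (use nn_integral_gaussian[OF v, of "0::real^'n"] in \<open>auto simp: N_def\<close>)
      also have "\<dots> = ennreal (c * pi powr (N / 2) * (v powr (1 / 2 - 1) * exp (- t\<^sup>2 * v)))"
      proof -
        have "v powr ((N - 1) / 2) * (pi / v) powr (N / 2) = pi powr (N / 2) * v powr (1 / 2 - 1)"
        proof -
          have "v powr ((N - 1) / 2) * (pi / v) powr (N / 2) =
              pi powr (N / 2) * (v powr ((N - 1) / 2) / v powr (N / 2))"
            using v by (simp add: powr_divide)
          also have "v powr ((N - 1) / 2) / v powr (N / 2) = v powr ((N - 1) / 2 - N / 2)"
            by (rule powr_diff[symmetric])
          also have "(N - 1) / 2 - N / 2 = 1 / 2 - 1" by (simp add: diff_divide_distrib)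
          finally show ?thesis .
        qed
        then show ?thesis using v c by (simp add: ennreal_mult[symmetric] algebra_simps)
      qed
      finally show ?thesis using v c by (simp add: ennreal_mult)
    qed simp
  qed
  also have "\<dots> = ennreal (c * pi powr (N / 2)) * ennreal (Gamma (1/2) * (t\<^sup>2) powr - (1/2))"
    by (subst nn_integral_cmult) (use nn_integral_scaled_Gamma[of "t\<^sup>2" "1/2"] t in auto)
  also have "\<dots> = ennreal (c * pi powr (N / 2) * (sqrt pi / t))"
    using t c by (simp add: ennreal_mult[symmetric] Gamma_one_half_real powr_minus powr_half_sqrt field_simps)
  also have "c * pi powr (N / 2) * (sqrt pi / t) = pi powr (- ((N + 1) / 2)) * pi powr (N / 2) * pi powr (1 / 2)"
    unfolding c_def using t by (simp add: powr_half_sqrt)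
  also have "\<dots> = pi powr (- ((N + 1) / 2) + N / 2 + 1 / 2)"
    by (simp only: powr_add)
  also have "- ((N + 1) / 2) + N / 2 + 1 / 2 = 0" by (simp add: field_simps)
  finally show ?thesis by simp
qed

text \<open>By subordination the Poisson kernel is a mixture of the Gaussians $e^{-v|x|^2}$, and convolving
  those with parameters $a$ and $b$ gives parameter $v = ab/(a+b)$. The substitution
  $a = v(1+y)$, $b = v(1+y)/y$ separates the two mixing integrals.\<close>
lemma poisson_convolution_integrand:
  fixes x :: "real^'n"
  assumes st: "s > 0" "t > 0" and v: "v > 0"
  defines "N \<equiv> real CARD('n)" and "c \<equiv> pi powr (- ((real CARD('n) + 1) / 2))"
  defines "\<Phi> \<equiv> \<lambda>a b. s * t * c\<^sup>2 * (a * b) powr ((N - 1) / 2) * exp (- a * s\<^sup>2 - b * t\<^sup>2) *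
       ((pi / (a + b)) powr (N / 2) * exp (- (a * b / (a + b)) * (norm x)\<^sup>2))"
  assumes y: "y > 0"
  shows "(1 + y) / y * ((1 + y) / y * v * \<Phi> ((1 + y) / y * v * y) ((1 + y) / y * v)) =
     s * t * c\<^sup>2 * pi powr (N / 2) * (v powr ((N - 1) / 2) * exp (- v * ((s + t)\<^sup>2 + (norm x)\<^sup>2))) * sqrt v *
      ((1 + y) / (y * sqrt y) * exp (- v * (s * sqrt y - t / sqrt y)\<^sup>2))"
proof -
  define a where "a = v * (1 + y)"
  define b where "b = (1 + y) / y * v"
  define S where "S = a + b"
  have pos: "a > 0" "b > 0" "S > 0" using v y by (auto simp: a_def b_def S_def add_pos_pos)
  have ab: "(1 + y) / y * v * y = a" using y by (simp add: a_def)
  have S: "S = v * (1 + y)\<^sup>2 / y" unfolding S_def a_def b_def using y by (simp add: field_simps power2_eq_square)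
  \<comment> \<open>The substitution is made for this identity: the parameter ab/(a+b) of the
    convolved Gaussian becomes v, so the factor depending on x is free of y.\<close>
  have abS: "a * b = v * S" unfolding S a_def b_def using y by (simp add: field_simps power2_eq_square)
  then have q: "a * b / S = v" using pos by simp
  have sqS: "sqrt S = sqrt v * (1 + y) / sqrt y" unfolding S using y by (simp add: real_sqrt_divide real_sqrt_mult)
  have "S powr ((N - 1) / 2) * (pi / S) powr (N / 2) = pi powr (N / 2) * (S powr ((N - 1) / 2) / S powr (N / 2))"
    using pos by (simp add: powr_divide)
  also have "S powr ((N - 1) / 2) / S powr (N / 2) = S powr ((N - 1) / 2 - N / 2)"
    by (rule powr_diff[symmetric])
  also have "(N - 1) / 2 - N / 2 = - (1 / 2)" by (simp add: diff_divide_distrib)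
  finally have p: "S powr ((N - 1) / 2) * (pi / S) powr (N / 2) = pi powr (N / 2) / sqrt S"
    using pos by (simp add: powr_minus powr_half_sqrt field_simps)
  have sq: "(s * sqrt y - t / sqrt y)\<^sup>2 = s\<^sup>2 * y + t\<^sup>2 / y - 2 * s * t"
    using y by (simp add: power2_diff power_mult_distrib power_divide)
  \<comment> \<open>From (s sqrt y - t / sqrt y)^2 + (s + t)^2 = (1 + y)(s^2 + t^2 / y): the
    exponent splits into the Cauchy-Schloemilch factor and the exponent of the kernel at time s +
    t.\<close>
  have e: "- a * s\<^sup>2 - b * t\<^sup>2 = - v * (s * sqrt y - t / sqrt y)\<^sup>2 - v * (s + t)\<^sup>2"
    unfolding sq a_def b_def using y by (simp add: field_simps power2_sum)
  have "(1 + y) / y * (b * \<Phi> a b) = s * t * c\<^sup>2 * ((1 + y) / y * b) * (v powr ((N - 1) / 2)) *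
      (S powr ((N - 1) / 2) * (pi / S) powr (N / 2)) * (exp (- a * s\<^sup>2 - b * t\<^sup>2) * exp (- (a * b / S) * (norm x)\<^sup>2))"
    unfolding \<Phi>_def abS S_def[symmetric] using v pos by (simp add: powr_mult mult_ac)
  also have "\<dots> = s * t * c\<^sup>2 * ((1 + y) / y * b) * (v powr ((N - 1) / 2)) *
      (pi powr (N / 2) / sqrt S) * (exp (- v * (s * sqrt y - t / sqrt y)\<^sup>2) * exp (- v * ((s + t)\<^sup>2 + (norm x)\<^sup>2)))"
    unfolding p e q exp_add[symmetric] by (simp add: algebra_simps)
  also have "(1 + y) / y * b = S / y" unfolding S b_def using y by (simp add: field_simps power2_eq_square)
  finally have "(1 + y) / y * (b * \<Phi> a b) = s * t * c\<^sup>2 * pi powr (N / 2) * (v powr ((N - 1) / 2) *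
      exp (- v * ((s + t)\<^sup>2 + (norm x)\<^sup>2))) * (S / sqrt S / y) * exp (- v * (s * sqrt y - t / sqrt y)\<^sup>2)"
    by (simp add: mult_ac)
  also have "S / sqrt S / y = sqrt v * ((1 + y) / (y * sqrt y))"
    unfolding real_div_sqrt[OF less_imp_le[OF pos(3)]] unfolding sqS by (simp add: mult.commute)
  finally show ?thesis unfolding ab unfolding b_def[symmetric] by (simp only: mult_ac)
qed

text \<open>Tonelli isolates the Gaussian convolution in space and leaves a double integral over the
  two mixing parameters. The substitution is carried out as two scalings, each at a fixed value of
  the other variable, so only one-dimensional Jacobians appear. The y-integral is then
  \<open>nn_integral_Cauchy_Schloemilch\<close>, and the remaining v-integral is the mixture for
  time s + t.\<close>

lemma poisson_kernel_convolution:
  fixes x :: "real^'n"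
  assumes st: "s > 0" "t > 0"
  shows "(\<integral>\<^sup>+y. ennreal (poisson_kernel s (x - y)) * ennreal (poisson_kernel t y) \<partial>lborel) =
    ennreal (poisson_kernel (s + t) x)"
proof -
  define N where "N = real CARD('n)"
  define c where "c = pi powr (- ((real CARD('n) + 1) / 2))"
  define D where "D = s * t * c\<^sup>2 * pi powr (N / 2)"
  have c: "c > 0" "D > 0" using st by (auto simp: c_def D_def)
  define I :: "real \<Rightarrow> ennreal" where "I v = indicator {0<..} v" for v
  have [measurable]: "I \<in> borel_measurable borel" unfolding I_def by measurable
  have I_simps: "v > 0 \<Longrightarrow> I v = 1" "\<not> v > 0 \<Longrightarrow> I v = 0" for v by (auto simp: I_def)
  define \<Phi> where "\<Phi> = (\<lambda>a b. s * t * c\<^sup>2 * (a * b) powr ((N - 1) / 2) * exp (- a * s\<^sup>2 - b * t\<^sup>2) *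
       ((pi / (a + b)) powr (N / 2) * exp (- (a * b / (a + b)) * (norm x)\<^sup>2)))"
  have [measurable]: "case_prod \<Phi> \<in> borel_measurable (lborel \<Otimes>\<^sub>M lborel)"
    unfolding \<Phi>_def by measurable
  have \<Phi>0: "\<Phi> a b \<ge> 0" for a b unfolding \<Phi>_def using st c by simp
  have mix: "ennreal (poisson_kernel r z) =
     (\<integral>\<^sup>+v. ennreal (r * c * (v powr ((N - 1) / 2) * exp (- v * (r\<^sup>2 + (norm z)\<^sup>2)))) * I v \<partial>lborel)" 
    if "r > 0" for r and z :: "real^'n"
    unfolding poisson_kernel_mixture[OF that] c_def N_def I_def ..
  have "(\<integral>\<^sup>+y. ennreal (poisson_kernel s (x - y)) * ennreal (poisson_kernel t y) \<partial>lborel) =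
    (\<integral>\<^sup>+y. (\<integral>\<^sup>+a. (\<integral>\<^sup>+b. ennreal (s * c * (a powr ((N - 1) / 2) * exp (- a * (s\<^sup>2 + (norm (x - y))\<^sup>2)))) * I a *
       (ennreal (t * c * (b powr ((N - 1) / 2) * exp (- b * (t\<^sup>2 + (norm y)\<^sup>2)))) * I b) \<partial>lborel) \<partial>lborel) \<partial>lborel)"
    unfolding mix[OF st(1)] mix[OF st(2)] by (simp add: nn_integral_cmult nn_integral_multc)
  also have "\<dots> = (\<integral>\<^sup>+a. (\<integral>\<^sup>+y. (\<integral>\<^sup>+b. ennreal (s * c * (a powr ((N - 1) / 2) * exp (- a * (s\<^sup>2 + (norm (x - y))\<^sup>2)))) * I a *
       (ennreal (t * c * (b powr ((N - 1) / 2) * exp (- b * (t\<^sup>2 + (norm y)\<^sup>2)))) * I b) \<partial>lborel) \<partial>lborel) \<partial>lborel)"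
    by (rule lborel_pair.Fubini') measurable
  also have "\<dots> = (\<integral>\<^sup>+a. (\<integral>\<^sup>+b. (\<integral>\<^sup>+y. ennreal (s * c * (a powr ((N - 1) / 2) * exp (- a * (s\<^sup>2 + (norm (x - y))\<^sup>2)))) * I a *
       (ennreal (t * c * (b powr ((N - 1) / 2) * exp (- b * (t\<^sup>2 + (norm y)\<^sup>2)))) * I b) \<partial>lborel) \<partial>lborel) \<partial>lborel)"
    by (intro nn_integral_cong lborel_pair.Fubini') measurable
  also have "\<dots> = (\<integral>\<^sup>+a. (\<integral>\<^sup>+b. ennreal (\<Phi> a b) * I a * I b \<partial>lborel) \<partial>lborel)"
  proof (intro nn_integral_cong)
    fix a b :: real
    show "(\<integral>\<^sup>+y. ennreal (s * c * (a powr ((N - 1) / 2) * exp (- a * (s\<^sup>2 + (norm (x - y))\<^sup>2)))) * I a *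
       (ennreal (t * c * (b powr ((N - 1) / 2) * exp (- b * (t\<^sup>2 + (norm y)\<^sup>2)))) * I b) \<partial>lborel) = ennreal (\<Phi> a b) * I a * I b"
    proof (cases "a > 0 \<and> b > 0")
      case True
      have "(\<integral>\<^sup>+y. ennreal (s * c * (a powr ((N - 1) / 2) * exp (- a * (s\<^sup>2 + (norm (x - y))\<^sup>2)))) * I a *
       (ennreal (t * c * (b powr ((N - 1) / 2) * exp (- b * (t\<^sup>2 + (norm y)\<^sup>2)))) * I b) \<partial>lborel) =
       (\<integral>\<^sup>+y. ennreal (s * t * c\<^sup>2 * (a * b) powr ((N - 1) / 2) * exp (- a * s\<^sup>2 - b * t\<^sup>2)) *
          ennreal (exp (- a * (norm (x - y))\<^sup>2) * exp (- b * (norm y)\<^sup>2)) \<partial>lborel)"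
      proof (intro nn_integral_cong)
        fix y
        have "exp (- a * (s\<^sup>2 + (norm (x - y))\<^sup>2)) * exp (- b * (t\<^sup>2 + (norm y)\<^sup>2)) =
          exp (- a * s\<^sup>2 - b * t\<^sup>2) * (exp (- a * (norm (x - y))\<^sup>2) * exp (- b * (norm y)\<^sup>2))"
          by (simp add: exp_add[symmetric] algebra_simps)
        then have "s * c * (a powr ((N - 1) / 2) * exp (- a * (s\<^sup>2 + (norm (x - y))\<^sup>2))) *
            (t * c * (b powr ((N - 1) / 2) * exp (- b * (t\<^sup>2 + (norm y)\<^sup>2)))) =
           s * t * c\<^sup>2 * (a * b) powr ((N - 1) / 2) * exp (- a * s\<^sup>2 - b * t\<^sup>2) *
             (exp (- a * (norm (x - y))\<^sup>2) * exp (- b * (norm y)\<^sup>2))"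
          using True by (simp add: powr_mult power2_eq_square)
        then show "ennreal (s * c * (a powr ((N - 1) / 2) * exp (- a * (s\<^sup>2 + (norm (x - y))\<^sup>2)))) * I a *
           (ennreal (t * c * (b powr ((N - 1) / 2) * exp (- b * (t\<^sup>2 + (norm y)\<^sup>2)))) * I b) =
           ennreal (s * t * c\<^sup>2 * (a * b) powr ((N - 1) / 2) * exp (- a * s\<^sup>2 - b * t\<^sup>2)) *
          ennreal (exp (- a * (norm (x - y))\<^sup>2) * exp (- b * (norm y)\<^sup>2))"
          using True st c by (simp add: I_simps ennreal_mult'[symmetric])
      qed
      also have "\<dots> = ennreal (\<Phi> a b)"
        using True st c gaussian_convolution[of a b x]
        by (subst nn_integral_cmult) (auto simp: ennreal_mult'[symmetric] \<Phi>_def N_def)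
      finally show ?thesis using True by (simp add: I_simps)
    next
      case False
      then have "I a = 0 \<or> I b = 0" using I_simps by auto
      then show ?thesis by auto
    qed
  qed
  also have "\<dots> = (\<integral>\<^sup>+b. (\<integral>\<^sup>+a. ennreal (\<Phi> a b) * I a * I b \<partial>lborel) \<partial>lborel)"
    by (rule lborel_pair.Fubini') measurable
  \<comment> \<open>First scaling: a = b y at fixed b, with Jacobian b.\<close>
  also have "\<dots> = (\<integral>\<^sup>+b. (\<integral>\<^sup>+y. ennreal (b * \<Phi> (b * y) b) * I y * I b \<partial>lborel) \<partial>lborel)"
  proof (rule nn_integral_cong)
    fix b :: real
    show "(\<integral>\<^sup>+a. ennreal (\<Phi> a b) * I a * I b \<partial>lborel) = (\<integral>\<^sup>+y. ennreal (b * \<Phi> (b * y) b) * I y * I b \<partial>lborel)"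
    proof (cases "b > 0")
      case True
      have "(\<integral>\<^sup>+a. ennreal (\<Phi> a b) * I a * I b \<partial>lborel) = ennreal \<bar>b\<bar> * (\<integral>\<^sup>+y. ennreal (\<Phi> (0 + b * y) b) * I (0 + b * y) * I b \<partial>lborel)"
        using True by (intro nn_integral_real_affine) auto
      also have "\<dots> = (\<integral>\<^sup>+y. ennreal \<bar>b\<bar> * (ennreal (\<Phi> (0 + b * y) b) * I (0 + b * y) * I b) \<partial>lborel)"
        by (rule nn_integral_cmult[symmetric]) measurable
      also have "\<dots> = (\<integral>\<^sup>+y. ennreal (b * \<Phi> (b * y) b) * I y * I b \<partial>lborel)"
        using True by (intro nn_integral_cong)
          (auto simp: I_def indicator_def ennreal_mult'[symmetric] zero_less_mult_iff)
      finally show ?thesis .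
    qed (simp add: I_simps)
  qed
  also have "\<dots> = (\<integral>\<^sup>+y. (\<integral>\<^sup>+b. ennreal (b * \<Phi> (b * y) b) * I y * I b \<partial>lborel) \<partial>lborel)"
    by (rule lborel_pair.Fubini') measurable
  \<comment> \<open>Second scaling: b = (1+y)/y v at fixed y, with Jacobian (1+y)/y.\<close>
  also have "\<dots> = (\<integral>\<^sup>+y. (\<integral>\<^sup>+v. ennreal ((1 + y) / y * ((1 + y) / y * v * \<Phi> ((1 + y) / y * v * y) ((1 + y) / y * v))) * I y * I v \<partial>lborel) \<partial>lborel)"
  proof (rule nn_integral_cong)
    fix y :: real
    show "(\<integral>\<^sup>+b. ennreal (b * \<Phi> (b * y) b) * I y * I b \<partial>lborel) =
      (\<integral>\<^sup>+v. ennreal ((1 + y) / y * ((1 + y) / y * v * \<Phi> ((1 + y) / y * v * y) ((1 + y) / y * v))) * I y * I v \<partial>lborel)"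
    proof (cases "y > 0")
      case True
      define k where "k = (1 + y) / y"
      have k: "k > 0" using True by (simp add: k_def)
      have "(\<integral>\<^sup>+b. ennreal (b * \<Phi> (b * y) b) * I y * I b \<partial>lborel) =
        ennreal \<bar>k\<bar> * (\<integral>\<^sup>+v. ennreal ((0 + k * v) * \<Phi> ((0 + k * v) * y) (0 + k * v)) * I y * I (0 + k * v) \<partial>lborel)"
        using k by (intro nn_integral_real_affine) auto
      also have "\<dots> = (\<integral>\<^sup>+v. ennreal \<bar>k\<bar> * (ennreal ((0 + k * v) * \<Phi> ((0 + k * v) * y) (0 + k * v)) * I y * I (0 + k * v)) \<partial>lborel)"
        by (rule nn_integral_cmult[symmetric]) measurable
      also have "\<dots> = (\<integral>\<^sup>+v. ennreal (k * (k * v * \<Phi> (k * v * y) (k * v))) * I y * I v \<partial>lborel)"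
        using k by (intro nn_integral_cong)
          (auto simp: I_def indicator_def ennreal_mult'[symmetric] zero_less_mult_iff)
      finally show ?thesis unfolding k_def .
    qed (simp add: I_simps)
  qed
  also have "\<dots> = (\<integral>\<^sup>+v. (\<integral>\<^sup>+y. ennreal ((1 + y) / y * ((1 + y) / y * v * \<Phi> ((1 + y) / y * v * y) ((1 + y) / y * v))) * I y * I v \<partial>lborel) \<partial>lborel)"
    by (rule lborel_pair.Fubini') measurable
  also have "\<dots> = (\<integral>\<^sup>+v. ennreal ((s + t) * c * (v powr ((N - 1) / 2) * exp (- v * ((s + t)\<^sup>2 + (norm x)\<^sup>2)))) * I v \<partial>lborel)"
  proof (rule nn_integral_cong)
    fix v :: real
    show "(\<integral>\<^sup>+y. ennreal ((1 + y) / y * ((1 + y) / y * v * \<Phi> ((1 + y) / y * v * y) ((1 + y) / y * v))) * I y * I v \<partial>lborel) =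
      ennreal ((s + t) * c * (v powr ((N - 1) / 2) * exp (- v * ((s + t)\<^sup>2 + (norm x)\<^sup>2)))) * I v"
    proof (cases "v > 0")
      case v: True
      define e where "e = v powr ((N - 1) / 2) * exp (- v * ((s + t)\<^sup>2 + (norm x)\<^sup>2))"
      have e: "e \<ge> 0" by (simp add: e_def)
      have "(\<integral>\<^sup>+y. ennreal ((1 + y) / y * ((1 + y) / y * v * \<Phi> ((1 + y) / y * v * y) ((1 + y) / y * v))) * I y * I v \<partial>lborel) =
         (\<integral>\<^sup>+y. ennreal (D * e * sqrt v) * (ennreal ((1 + y) / (y * sqrt y) * exp (- v * (s * sqrt y - t / sqrt y)\<^sup>2)) * indicator {0<..} y) \<partial>lborel)"
      proof (rule nn_integral_cong)
        fix y :: real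
        show "ennreal ((1 + y) / y * ((1 + y) / y * v * \<Phi> ((1 + y) / y * v * y) ((1 + y) / y * v))) * I y * I v =
          ennreal (D * e * sqrt v) * (ennreal ((1 + y) / (y * sqrt y) * exp (- v * (s * sqrt y - t / sqrt y)\<^sup>2)) * indicator {0<..} y)"
        proof (cases "y > 0")
          case y: True
          have "(1 + y) / y * ((1 + y) / y * v * \<Phi> ((1 + y) / y * v * y) ((1 + y) / y * v)) =
            D * e * sqrt v * ((1 + y) / (y * sqrt y) * exp (- v * (s * sqrt y - t / sqrt y)\<^sup>2))"
            unfolding \<Phi>_def D_def e_def c_def N_def
            using poisson_convolution_integrand[OF st v y, of x] by (simp only: mult.assoc)
          then show ?thesis using y v c e by (simp add: I_simps ennreal_mult'[symmetric])
        qed (simp add: I_simps)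
      qed
      also have "\<dots> = ennreal (D * e * sqrt v) * ennreal (sqrt (pi / v) * (1 / s + 1 / t))"
        by (subst nn_integral_cmult) (use nn_integral_Cauchy_Schloemilch[OF st v] in auto)
      also have "\<dots> = ennreal (D * e * sqrt v * (sqrt (pi / v) * (1 / s + 1 / t)))"
        using c e v by (intro ennreal_mult'[symmetric]) auto
      also have "D * e * sqrt v * (sqrt (pi / v) * (1 / s + 1 / t)) = D * sqrt pi * (1 / s + 1 / t) * e"
        using v by (simp add: real_sqrt_divide)
      \<comment> \<open>Here the times add: s t (1/s + 1/t) = s + t. One of the two factors c
        cancels against the remaining powers of pi.\<close>
      also have "D * sqrt pi * (1 / s + 1 / t) = (s + t) * c"
      proof -
        have "c * (pi powr (N / 2) * sqrt pi) = pi powr (- ((N + 1) / 2) + N / 2 + 1 / 2)"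
          unfolding c_def N_def powr_add by (simp add: powr_half_sqrt)
        also have "- ((N + 1) / 2) + N / 2 + 1 / 2 = 0" by (simp add: field_simps)
        finally have 1: "c * (pi powr (N / 2) * sqrt pi) = 1" by simp
        have 2: "s * t * (1 / s + 1 / t) = s + t" using st by (simp add: field_simps)
        have "D * sqrt pi * (1 / s + 1 / t) = (s * t * (1 / s + 1 / t)) * c * (c * (pi powr (N / 2) * sqrt pi))"
          unfolding D_def by (simp add: power2_eq_square mult_ac)
        then show ?thesis unfolding 1 2 by simp
      qed
      finally show ?thesis using v by (simp add: e_def I_simps)
    qed (simp add: I_simps)
  qed
  also have "\<dots> = ennreal (poisson_kernel (s + t) x)"
    using mix[of "s + t" x] st by simp
  finally show ?thesis .
qed

section \<open>Kernel estimates and the Duhamel integral of a critical source\<close>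

lemma poisson_kernel_convolution_shift:
  fixes x z :: "real^'n"
  assumes st: "s > 0" "t > 0"
  shows "(\<integral>\<^sup>+y. ennreal (poisson_kernel s (x - y)) * ennreal (poisson_kernel t (y - z)) \<partial>lborel) =
    ennreal (poisson_kernel (s + t) (x - z))"
  using poisson_kernel_convolution[OF st, of "x - z"]
    nn_integral_lborel_translate[of "\<lambda>y. ennreal (poisson_kernel s (x - z - y)) * ennreal (poisson_kernel t y)" "- z"]
  by simp

lemma nn_integral_poisson_kernel_shift:
  assumes t: "t > 0"
  shows "(\<integral>\<^sup>+y. ennreal (poisson_kernel t (x - y :: real^'n)) \<partial>lborel) = 1"
  using nn_integral_lborel_reflect[of "\<lambda>y. ennreal (poisson_kernel t y)" x] nn_integral_poisson_kernel[OF t]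
  by simp

text \<open>For s \<ge> t/2 one has s^2 + |x|^2 \<ge> (t^2 + |x|^2)/4, and the power (n+1)/2 turns
  the factor 4 into 2^(n+1).\<close>

lemma poisson_kernel_le_time:
  fixes x :: "real^'n"
  assumes "t > 0" "t / 2 \<le> s" "s \<le> t"
  shows "poisson_kernel s x \<le> 2 ^ (CARD('n) + 1) * poisson_kernel t x"
proof -
  define k where "k = (real CARD('n) + 1) / 2"
  have s: "s > 0" using assms by linarith
  have k: "k > 0" by (simp add: k_def)
  have p: "t\<^sup>2 + (norm x)\<^sup>2 > 0" using assms by (simp add: add_pos_nonneg)
  have "(t / 2)\<^sup>2 \<le> s\<^sup>2" using assms by (intro power_mono) auto
  then have "(t\<^sup>2 + (norm x)\<^sup>2) / 4 \<le> s\<^sup>2 + (norm x)\<^sup>2"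
    by (simp add: power_divide) (smt (verit) zero_le_power2)
  then have "(s\<^sup>2 + (norm x)\<^sup>2) powr - k \<le> ((t\<^sup>2 + (norm x)\<^sup>2) / 4) powr - k"
    using p k by (intro powr_mono2') auto
  also have "\<dots> = 4 powr k * (t\<^sup>2 + (norm x)\<^sup>2) powr - k"
    using p by (simp add: powr_divide powr_minus field_simps)
  also have "4 powr k = (2 powr 2) powr k" by simp
  also have "\<dots> = 2 ^ (CARD('n) + 1)"
    unfolding powr_powr k_def by (simp add: add_divide_distrib powr_add powr_realpow)
  finally have "(s\<^sup>2 + (norm x)\<^sup>2) powr - k \<le> 2 ^ (CARD('n) + 1) * (t\<^sup>2 + (norm x)\<^sup>2) powr - k" .
  then have "s * (s\<^sup>2 + (norm x)\<^sup>2) powr - k \<le> t * (2 ^ (CARD('n) + 1) * (t\<^sup>2 + (norm x)\<^sup>2) powr - k)"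
    using assms s by (intro mult_mono) auto
  then have "gamma_const CARD('n) * (s * (s\<^sup>2 + (norm x)\<^sup>2) powr - k) \<le>
      gamma_const CARD('n) * (t * (2 ^ (CARD('n) + 1) * (t\<^sup>2 + (norm x)\<^sup>2) powr - k))"
    using gamma_const_pos[of "CARD('n)"] by (intro mult_left_mono) auto
  then show ?thesis
    unfolding poisson_kernel_eq[OF s] poisson_kernel_eq[OF assms(1)] k_def by (simp add: mult_ac)
qed

text \<open>With q = |z|/\<eta>, the triangle inequality and 2 \<eta> |y+z| \<le> \<eta>^2 + |y+z|^2
  give \<eta>^2 + |y|^2 \<le> (1+q)^2 (\<eta>^2 + |y+z|^2). The power (n+1)/2 turns the square into
  the exponent n+1.\<close>

lemma poisson_kernel_harnack:
  fixes y z :: "real^'n"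
  assumes \<eta>: "\<eta> > 0"
  shows "poisson_kernel \<eta> (y + z) \<le> (1 + norm z / \<eta>) ^ (CARD('n) + 1) * poisson_kernel \<eta> y"
proof -
  define k where "k = (real CARD('n) + 1) / 2"
  define q where "q = norm z / \<eta>"
  have k: "k > 0" by (simp add: k_def)
  have q: "q \<ge> 0" "norm z = q * \<eta>" using \<eta> by (auto simp: q_def)
  have p: "\<eta>\<^sup>2 + (norm (y + z))\<^sup>2 > 0" "\<eta>\<^sup>2 + (norm y)\<^sup>2 > 0" using \<eta> by (simp_all add: add_pos_nonneg)
  have "norm y \<le> norm (y + z) + norm z" using norm_triangle_ineq4[of "y + z" z] by simp
  then have "(norm y)\<^sup>2 \<le> (norm (y + z) + q * \<eta>)\<^sup>2" unfolding q by (intro power_mono) auto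
  also have "\<dots> = (norm (y + z))\<^sup>2 + q * (2 * \<eta> * norm (y + z)) + q\<^sup>2 * \<eta>\<^sup>2"
    by (simp add: power2_sum power_mult_distrib)
  also have "\<dots> \<le> (norm (y + z))\<^sup>2 + q * (2 * (\<eta>\<^sup>2 + (norm (y + z))\<^sup>2)) + q\<^sup>2 * \<eta>\<^sup>2"
  proof -
    have "2 * \<eta> * norm (y + z) \<le> \<eta>\<^sup>2 + (norm (y + z))\<^sup>2"
      using sum_squares_bound[of \<eta> "norm (y + z)"] by simp
    also have "\<dots> \<le> 2 * (\<eta>\<^sup>2 + (norm (y + z))\<^sup>2)" using p by simp
    finally show ?thesis using q(1) by (intro add_mono mult_left_mono order_refl)
  qed
  also have "\<dots> \<le> (norm (y + z))\<^sup>2 + q * (2 * (\<eta>\<^sup>2 + (norm (y + z))\<^sup>2)) + q\<^sup>2 * (\<eta>\<^sup>2 + (norm (y + z))\<^sup>2)"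
    using q(1) by (intro add_mono mult_left_mono) auto
  finally have "\<eta>\<^sup>2 + (norm y)\<^sup>2 \<le> (1 + q)\<^sup>2 * (\<eta>\<^sup>2 + (norm (y + z))\<^sup>2)"
    by (simp add: power2_sum algebra_simps)
  then have "(\<eta>\<^sup>2 + (norm y)\<^sup>2) / (1 + q)\<^sup>2 \<le> \<eta>\<^sup>2 + (norm (y + z))\<^sup>2"
    using q by (subst pos_divide_le_eq) (auto simp: mult.commute)
  then have "(\<eta>\<^sup>2 + (norm (y + z))\<^sup>2) powr - k \<le> ((\<eta>\<^sup>2 + (norm y)\<^sup>2) / (1 + q)\<^sup>2) powr - k"
    using p k q by (intro powr_mono2') auto
  also have "\<dots> = ((1 + q)\<^sup>2) powr k * (\<eta>\<^sup>2 + (norm y)\<^sup>2) powr - k"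
    using p q by (simp add: powr_divide powr_minus field_simps)
  also have "((1 + q)\<^sup>2) powr k = ((1 + q) powr 2) powr k" using q by simp
  also have "\<dots> = (1 + q) ^ (CARD('n) + 1)"
    unfolding powr_powr k_def using q by (simp add: add_divide_distrib powr_add powr_realpow)
  finally have "gamma_const CARD('n) * \<eta> * (\<eta>\<^sup>2 + (norm (y + z))\<^sup>2) powr - k \<le>
      gamma_const CARD('n) * \<eta> * ((1 + q) ^ (CARD('n) + 1) * (\<eta>\<^sup>2 + (norm y)\<^sup>2) powr - k)"
    using gamma_const_pos[of "CARD('n)"] \<eta> by (intro mult_left_mono) auto
  then show ?thesis
    unfolding poisson_kernel_eq[OF \<eta>] k_def q_def by (simp add: mult_ac)
qed

text \<open>Harnack in both directions bounds the difference by a multiple of the kernel itself. The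
  estimate is relative so that, integrated against a bounded function, only that multiple
  remains.\<close>

lemma poisson_kernel_diff_le:
  fixes y z :: "real^'n"
  assumes \<eta>: "\<eta> > 0"
  defines "h \<equiv> (1 + norm z / \<eta>) ^ (CARD('n) + 1)"
  shows "\<bar>poisson_kernel \<eta> (y + z) - poisson_kernel \<eta> y\<bar> \<le> ((h - 1) * h) * poisson_kernel \<eta> y"
proof -
  have 1: "poisson_kernel \<eta> (y + z) \<le> h * poisson_kernel \<eta> y"
    unfolding h_def by (rule poisson_kernel_harnack[OF \<eta>])
  have 2: "poisson_kernel \<eta> y \<le> h * poisson_kernel \<eta> (y + z)"
    using poisson_kernel_harnack[OF \<eta>, of "y + z" "- z"] by (simp add: h_def)
  have h: "h \<ge> 1" unfolding h_def using \<eta> by (intro one_le_power) simp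
  have p: "poisson_kernel \<eta> y > 0" using \<eta> by (rule poisson_kernel_pos)
  have "poisson_kernel \<eta> (y + z) - poisson_kernel \<eta> y \<le> (h - 1) * poisson_kernel \<eta> y"
    using 1 by (simp add: algebra_simps)
  also have "\<dots> \<le> (h - 1) * (h * poisson_kernel \<eta> y)"
    using h p by (intro mult_left_mono) auto
  finally have a: "poisson_kernel \<eta> (y + z) - poisson_kernel \<eta> y \<le> ((h - 1) * h) * poisson_kernel \<eta> y"
    by (simp add: mult.assoc)
  have "poisson_kernel \<eta> y - poisson_kernel \<eta> (y + z) \<le> (h - 1) * poisson_kernel \<eta> (y + z)"
    using 2 by (simp add: algebra_simps)
  also have "\<dots> \<le> (h - 1) * (h * poisson_kernel \<eta> y)"
    using h 1 by (intro mult_left_mono) auto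
  finally have b: "poisson_kernel \<eta> y - poisson_kernel \<eta> (y + z) \<le> ((h - 1) * h) * poisson_kernel \<eta> y"
    by (simp add: mult.assoc)
  show ?thesis using a b by (simp add: abs_le_iff)
qed

text \<open>Outside the ball of radius \<rho> one has 1 + |z|^2 \<le> (1 + 1/\<rho>^2) |z|^2, so
  only the prefactor \<tau> of the kernel still matters. It makes the mass of p_\<tau> outside any
  fixed ball vanish linearly as \<tau> tends to 0.\<close>

lemma poisson_kernel_tail:
  fixes z :: "real^'n"
  assumes "\<rho> > 0" "\<tau> > 0" "norm z \<ge> \<rho>"
  shows "poisson_kernel \<tau> z \<le> \<tau> * (1 + 1 / \<rho>\<^sup>2) powr ((real CARD('n) + 1) / 2) * poisson_kernel 1 z"
proof -
  define k where "k = (real CARD('n) + 1) / 2"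
  define C where "C = 1 + 1 / \<rho>\<^sup>2"
  have k: "k > 0" by (simp add: k_def)
  have C: "C > 0" using assms by (simp add: C_def add_pos_pos)
  have "\<rho>\<^sup>2 \<le> (norm z)\<^sup>2" using assms by (intro power_mono) auto
  then have "1 \<le> 1 / \<rho>\<^sup>2 * (norm z)\<^sup>2" using assms by (simp add: field_simps)
  then have "1 + (norm z)\<^sup>2 \<le> C * (norm z)\<^sup>2" unfolding C_def by (simp add: algebra_simps)
  also have "\<dots> \<le> C * (\<tau>\<^sup>2 + (norm z)\<^sup>2)" using C by (intro mult_left_mono) auto
  finally have "(1 + (norm z)\<^sup>2) / C \<le> \<tau>\<^sup>2 + (norm z)\<^sup>2" using C by (simp add: pos_divide_le_eq mult.commute)
  then have "(\<tau>\<^sup>2 + (norm z)\<^sup>2) powr - k \<le> ((1 + (norm z)\<^sup>2) / C) powr - k"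
    using k C by (intro powr_mono2') (auto intro!: divide_pos_pos add_pos_nonneg)
  also have "\<dots> = C powr k * (1 + (norm z)\<^sup>2) powr - k"
    using C by (simp add: powr_divide powr_minus field_simps)
  finally have "gamma_const CARD('n) * \<tau> * (\<tau>\<^sup>2 + (norm z)\<^sup>2) powr - k \<le>
      gamma_const CARD('n) * \<tau> * (C powr k * (1 + (norm z)\<^sup>2) powr - k)"
    using gamma_const_pos[of "CARD('n)"] assms by (intro mult_left_mono) auto
  then show ?thesis
    unfolding poisson_kernel_eq[OF assms(2)] poisson_kernel_eq[of 1 z, simplified] k_def C_def
    by (simp add: mult_ac)
qed

section \<open>The Duhamel operator as a single space-time integral\<close>

lemma nn_integral_slices:
  fixes f :: "'a::euclidean_space \<times> real \<Rightarrow> ennreal"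
  assumes [measurable]: "f \<in> borel_measurable borel"
  shows "(\<integral>\<^sup>+z. f z \<partial>lborel) = (\<integral>\<^sup>+s. (\<integral>\<^sup>+y. f (y, s) \<partial>lborel) \<partial>lborel)"
proof -
  have "(\<integral>\<^sup>+z. f z \<partial>lborel) = (\<integral>\<^sup>+z. f z \<partial>(lborel \<Otimes>\<^sub>M lborel))" unfolding lborel_prod ..
  also have "\<dots> = (\<integral>\<^sup>+s. (\<integral>\<^sup>+y. f (y, s) \<partial>lborel) \<partial>lborel)"
    by (rule lborel_pair.nn_integral_snd[symmetric]) (simp add: lborel_prod)
  finally show ?thesis .
qed

text \<open>Extending the kernel by zero outside 0 < s < t turns every exchange of integrals into
  Tonelli or Fubini for a fixed product measure, without limits of integration that depend on
  t.\<close>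

definition duhamel_kernel :: "real \<Rightarrow> real^'n \<Rightarrow> (real^'n) \<times> real \<Rightarrow> real" where
  "duhamel_kernel t x z = (if 0 < snd z \<and> snd z < t then poisson_kernel (t - snd z) (x - fst z) else 0)"

lemma duhamel_kernel_nonneg [simp]: "duhamel_kernel t x z \<ge> 0"
  unfolding duhamel_kernel_def by (auto intro!: less_imp_le poisson_kernel_pos)

lemma duhamel_kernel_measurable [measurable (raw)]:
  assumes [measurable]: "f \<in> borel_measurable M" "g \<in> borel_measurable M"
    "h \<in> borel_measurable M" 
  shows "(\<lambda>x. duhamel_kernel (f x) (g x) (h x :: (real^'n) \<times> real)) \<in> borel_measurable M"
proof -
  have [measurable]: "(\<lambda>x. fst (h x)) \<in> borel_measurable M" "(\<lambda>x. snd (h x)) \<in> borel_measurable M"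
    by (auto intro!: measurable_compose[OF assms(3)] borel_measurable_continuous_onI continuous_intros)
  show ?thesis unfolding duhamel_kernel_def by measurable
qed

lemma measurable_fst_snd_borel [measurable]:
  "(fst :: 'a::second_countable_topology \<times> 'b::second_countable_topology \<Rightarrow> 'a) \<in> borel_measurable borel"
  "(snd :: 'a::second_countable_topology \<times> 'b::second_countable_topology \<Rightarrow> 'b) \<in> borel_measurable borel"
  by (auto intro!: borel_measurable_continuous_onI continuous_intros)

text \<open>Each time slice carries mass one, so a window of times carries its length.\<close>

lemma nn_integral_duhamel_kernel_window:
  fixes x :: "real^'n"
  assumes "0 < a" "a \<le> t"
  shows "(\<integral>\<^sup>+z. ennreal (duhamel_kernel t x z * indicator {a..} (snd z)) \<partial>lborel) = ennreal (t - a)"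
proof -
  have "(\<integral>\<^sup>+z. ennreal (duhamel_kernel t x z * indicator {a..} (snd z)) \<partial>lborel) =
    (\<integral>\<^sup>+s. (\<integral>\<^sup>+y. ennreal (duhamel_kernel t x (y, s) * indicator {a..} s) \<partial>lborel) \<partial>lborel)"
    by (subst nn_integral_slices) auto
  also have "\<dots> = (\<integral>\<^sup>+s. indicator {a..<t} s \<partial>lborel)"
  proof (rule nn_integral_cong)
    fix s :: real
    show "(\<integral>\<^sup>+y. ennreal (duhamel_kernel t x (y, s) * indicator {a..} s) \<partial>lborel) = indicator {a..<t} s"
    proof (cases "s \<in> {a..<t}")
      case True
      then have "(\<integral>\<^sup>+y. ennreal (duhamel_kernel t x (y, s) * indicator {a..} s) \<partial>lborel) =
         (\<integral>\<^sup>+y. ennreal (poisson_kernel (t - s) (x - y)) \<partial>lborel)"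
        using assms by (intro nn_integral_cong) (auto simp: duhamel_kernel_def)
      also have "\<dots> = 1" using True by (intro nn_integral_poisson_kernel_shift) auto
      finally show ?thesis using True by simp
    qed (auto simp: duhamel_kernel_def indicator_def)
  qed
  also have "\<dots> = ennreal (t - a)" using assms by simp
  finally show ?thesis .
qed

text \<open>The summand 1 is the late half s \<ge> t/2. In the early half one factor 2^(n+1) comes
  from comparing times, the other from Harnack on balls of radius t/2, and the ball volume from
  averaging over them.\<close>

definition duhamel_const :: "nat \<Rightarrow> real" where
  "duhamel_const n = 1 + 2 ^ (n + 1) * 2 ^ (n + 1) / unit_ball_vol (real n)"

lemma duhamel_const_pos: "duhamel_const n > 0"
  unfolding duhamel_const_def by (intro add_pos_nonneg) auto

text \<open>On \<open>s \<ge> t/2\<close> the pointwise bound suffices. On \<open>s < t/2\<close> the kernel is comparable to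
  $p_t$, and by Harnack to its averages over balls of radius \<open>t/2\<close>, so the Carleson bound applies.\<close>
lemma duhamel_bound:
  fixes G :: "(real^'n) \<times> real \<Rightarrow> real" and x :: "real^'n"
  assumes [measurable]: "G \<in> borel_measurable borel"
    and \<kappa>: "\<kappa> \<ge> 0" and t: "t > 0"
    and pw: "AE z in lborel. 0 < snd z \<and> snd z < t \<longrightarrow> snd z * G z \<le> \<kappa>"
    and carleson: "\<And>x. (\<integral>\<^sup>+z. ennreal (G z) * indicator (ball x (t/2) \<times> {0<..<t/2}) z \<partial>lborel) \<le> ennreal (\<kappa> * (t/2) ^ CARD('n))"
  shows "(\<integral>\<^sup>+z. ennreal (duhamel_kernel t x z) * ennreal (G z) \<partial>lborel) \<le> ennreal (duhamel_const CARD('n) * \<kappa>)"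
proof -
  define \<rho> where "\<rho> = t / 2"
  have \<rho>: "\<rho> > 0" using t by (simp add: \<rho>_def)
  define c2 where "c2 = (2::real) ^ (CARD('n) + 1)"
  have c2: "c2 > 0" by (simp add: c2_def)
  define \<omega> where "\<omega> = unit_ball_vol (real CARD('n))"
  have \<omega>: "\<omega> > 0" by (simp add: \<omega>_def)
  have "(\<integral>\<^sup>+z. ennreal (duhamel_kernel t x z) * ennreal (G z) * indicator {\<rho>..} (snd z) \<partial>lborel) \<le>
    (\<integral>\<^sup>+z. ennreal (2 / t * \<kappa>) * ennreal (duhamel_kernel t x z * indicator {\<rho>..} (snd z)) \<partial>lborel)"
  proof (rule nn_integral_mono_AE, use pw in eventually_elim)
    fix z :: "(real^'n) \<times> real"
    assume z: "0 < snd z \<and> snd z < t \<longrightarrow> snd z * G z \<le> \<kappa>"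
    show "ennreal (duhamel_kernel t x z) * ennreal (G z) * indicator {\<rho>..} (snd z) \<le>
       ennreal (2 / t * \<kappa>) * ennreal (duhamel_kernel t x z * indicator {\<rho>..} (snd z))"
    proof (cases "\<rho> \<le> snd z \<and> snd z < t")
      case True
      then have s: "snd z > 0" using \<rho> by linarith
      have "G z \<le> \<kappa> / snd z" using z True s by (simp add: field_simps)
      also have "\<dots> \<le> \<kappa> / (t / 2)" using True s \<kappa> t unfolding \<rho>_def by (intro divide_left_mono) auto
      finally have "G z \<le> 2 / t * \<kappa>" by (simp add: mult.commute)
      then have "ennreal (duhamel_kernel t x z) * ennreal (G z) \<le> ennreal (duhamel_kernel t x z) * ennreal (2 / t * \<kappa>)"
        by (intro mult_left_mono ennreal_leI) auto
      then show ?thesis using True by (simp add: mult.commute)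
    qed (auto simp: duhamel_kernel_def indicator_def)
  qed
  also have "\<dots> = ennreal (2 / t * \<kappa>) * ennreal (t - \<rho>)"
    by (subst nn_integral_cmult) (use \<rho> in \<open>auto simp: nn_integral_duhamel_kernel_window \<rho>_def\<close>)
  also have "\<dots> = ennreal \<kappa>" using t \<kappa> by (simp add: ennreal_mult'[symmetric] \<rho>_def)
  finally have near: "(\<integral>\<^sup>+z. ennreal (duhamel_kernel t x z) * ennreal (G z) * indicator {\<rho>..} (snd z) \<partial>lborel) \<le> ennreal \<kappa>" .
  define I where "I = (\<integral>\<^sup>+z. ennreal (poisson_kernel t (x - fst z)) * ennreal (G z) * indicator {0<..<\<rho>} (snd z) \<partial>lborel)"
  \<comment> \<open>Harnack with |w - \<zeta>| < t/2: the value at w is at most 2^(n+1) times every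
    value in the ball, hence times the average.\<close>
  have avg: "ennreal (\<omega> * \<rho> ^ CARD('n)) * ennreal (poisson_kernel t w) \<le>
      ennreal c2 * (\<integral>\<^sup>+\<zeta>. ennreal (poisson_kernel t \<zeta>) * indicator (ball w \<rho>) \<zeta> \<partial>lborel)" for w :: "real^'n"
  proof -
    have [measurable]: "ball w \<rho> \<in> sets borel" by simp
    have "ennreal (\<omega> * \<rho> ^ CARD('n)) * ennreal (poisson_kernel t w) = ennreal (poisson_kernel t w) * emeasure lborel (ball w \<rho>)"
      using \<rho> by (simp add: emeasure_ball \<omega>_def mult.commute)
    also have "\<dots> = (\<integral>\<^sup>+\<zeta>. ennreal (poisson_kernel t w) * indicator (ball w \<rho>) \<zeta> \<partial>lborel)"
      by (simp add: nn_integral_cmult_indicator)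
    also have "\<dots> \<le> (\<integral>\<^sup>+\<zeta>. ennreal c2 * (ennreal (poisson_kernel t \<zeta>) * indicator (ball w \<rho>) \<zeta>) \<partial>lborel)"
    proof (rule nn_integral_mono)
      fix \<zeta> :: "real^'n"
      show "ennreal (poisson_kernel t w) * indicator (ball w \<rho>) \<zeta> \<le> ennreal c2 * (ennreal (poisson_kernel t \<zeta>) * indicator (ball w \<rho>) \<zeta>)"
      proof (cases "\<zeta> \<in> ball w \<rho>")
        case True
        then have "norm (w - \<zeta>) / t \<le> 1" using t by (simp add: dist_norm \<rho>_def)
        then have "(1 + norm (w - \<zeta>) / t) ^ (CARD('n) + 1) \<le> c2"
          unfolding c2_def using t by (intro power_mono) auto
        then have "(1 + norm (w - \<zeta>) / t) ^ (CARD('n) + 1) * poisson_kernel t \<zeta> \<le> c2 * poisson_kernel t \<zeta>"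
          using poisson_kernel_pos[OF t, of \<zeta>] by (intro mult_right_mono) auto
        with poisson_kernel_harnack[OF t, of \<zeta> "w - \<zeta>"]
        have "poisson_kernel t w \<le> c2 * poisson_kernel t \<zeta>" by simp
        then show ?thesis using True c2 by (simp add: ennreal_mult'[symmetric] ennreal_leI)
      qed simp
    qed
    also have "\<dots> = ennreal c2 * (\<integral>\<^sup>+\<zeta>. ennreal (poisson_kernel t \<zeta>) * indicator (ball w \<rho>) \<zeta> \<partial>lborel)"
      by (rule nn_integral_cmult) measurable
    finally show ?thesis .
  qed
  \<comment> \<open>\<open>D\<close> is the indicator of dist (x - y) \<zeta> < \<rho> as a jointly
    measurable function. For fixed z it is a ball in \<zeta>, for fixed \<zeta> a ball in y around x
    - \<zeta>; after Tonelli the inner integral is therefore over a Carleson cylinder.\<close>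
  define D :: "(((real^'n) \<times> real) \<times> (real^'n)) \<Rightarrow> ennreal"
    where "D = (\<lambda>(z, \<zeta>). indicator {0..<\<rho>} (dist (x - fst z) \<zeta>))"
  have [measurable]: "(\<lambda>z. D (f z, g z)) \<in> borel_measurable M"
    if [measurable]: "f \<in> borel_measurable M" "g \<in> borel_measurable M" for f g and M :: "'z measure"
    unfolding D_def by measurable
  have D: "D (z, \<zeta>) = indicator (ball (x - fst z) \<rho>) \<zeta>" for z \<zeta>
    unfolding D_def by (auto simp: indicator_def)
  have D': "D (z, \<zeta>) * indicator {0<..<\<rho>} (snd z) = indicator (ball (x - \<zeta>) \<rho> \<times> {0<..<\<rho>}) z" for z \<zeta>
    unfolding D_def by (cases z) (auto simp: indicator_def dist_norm algebra_simps norm_minus_commute)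
  have "ennreal (\<omega> * \<rho> ^ CARD('n)) * I =
    (\<integral>\<^sup>+z. ennreal (\<omega> * \<rho> ^ CARD('n)) * (ennreal (poisson_kernel t (x - fst z)) * ennreal (G z) * indicator {0<..<\<rho>} (snd z)) \<partial>lborel)"
    unfolding I_def by (rule nn_integral_cmult[symmetric]) measurable
  also have "\<dots> \<le> (\<integral>\<^sup>+z. ennreal c2 * (\<integral>\<^sup>+\<zeta>. ennreal (poisson_kernel t \<zeta>) * D (z, \<zeta>) \<partial>lborel) * (ennreal (G z) * indicator {0<..<\<rho>} (snd z)) \<partial>lborel)"
    unfolding D mult.assoc[symmetric] by (intro nn_integral_mono mult_right_mono avg) auto
  also have "\<dots> = (\<integral>\<^sup>+z. (\<integral>\<^sup>+\<zeta>. ennreal c2 * ennreal (poisson_kernel t \<zeta>) * D (z, \<zeta>) * (ennreal (G z) * indicator {0<..<\<rho>} (snd z)) \<partial>lborel) \<partial>lborel)"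
    by (intro nn_integral_cong)
      (subst nn_integral_cmult[symmetric], measurable, subst nn_integral_multc[symmetric], measurable, simp add: mult.assoc)
  also have "\<dots> = (\<integral>\<^sup>+\<zeta>. (\<integral>\<^sup>+z. ennreal c2 * ennreal (poisson_kernel t \<zeta>) * D (z, \<zeta>) * (ennreal (G z) * indicator {0<..<\<rho>} (snd z)) \<partial>lborel) \<partial>lborel)"
    by (rule lborel_pair.Fubini') measurable
  also have "\<dots> = (\<integral>\<^sup>+\<zeta>. ennreal c2 * ennreal (poisson_kernel t \<zeta>) * (\<integral>\<^sup>+z. ennreal (G z) * indicator (ball (x - \<zeta>) \<rho> \<times> {0<..<\<rho>}) z \<partial>lborel) \<partial>lborel)"
    unfolding D'[symmetric]
    by (subst nn_integral_cmult[symmetric]) (auto simp: mult_ac intro!: nn_integral_cong)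
  also have "\<dots> \<le> (\<integral>\<^sup>+\<zeta>. ennreal c2 * ennreal (poisson_kernel t (\<zeta> :: real^'n)) * ennreal (\<kappa> * \<rho> ^ CARD('n)) \<partial>lborel)"
    by (intro nn_integral_mono mult_left_mono carleson[folded \<rho>_def]) auto
  also have "\<dots> = ennreal c2 * ennreal (\<kappa> * \<rho> ^ CARD('n))"
    using nn_integral_poisson_kernel[OF t, where 'n='n] by (simp add: nn_integral_cmult nn_integral_multc)
  finally have "ennreal (\<omega> * \<rho> ^ CARD('n)) * I \<le> ennreal (c2 * (\<kappa> * \<rho> ^ CARD('n)))"
    using c2 by (simp add: ennreal_mult')
  then have "ennreal (1 / (\<omega> * \<rho> ^ CARD('n))) * (ennreal (\<omega> * \<rho> ^ CARD('n)) * I) \<le>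
     ennreal (1 / (\<omega> * \<rho> ^ CARD('n))) * ennreal (c2 * (\<kappa> * \<rho> ^ CARD('n)))"
    by (rule mult_left_mono) simp
  also have "\<dots> = ennreal (c2 * \<kappa> / \<omega>)"
    using \<omega> \<rho> c2 \<kappa> by (subst ennreal_mult'[symmetric]) auto
  also have "ennreal (1 / (\<omega> * \<rho> ^ CARD('n))) * (ennreal (\<omega> * \<rho> ^ CARD('n)) * I) = I"
    using \<omega> \<rho> by (simp add: mult.assoc[symmetric] ennreal_mult'[symmetric])
  finally have I: "I \<le> ennreal (c2 * \<kappa> / \<omega>)" .
  have "(\<integral>\<^sup>+z. ennreal (duhamel_kernel t x z) * ennreal (G z) \<partial>lborel) \<le>
    (\<integral>\<^sup>+z. ennreal (duhamel_kernel t x z) * ennreal (G z) * indicator {\<rho>..} (snd z) +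
      ennreal c2 * (ennreal (poisson_kernel t (x - fst z)) * ennreal (G z) * indicator {0<..<\<rho>} (snd z)) \<partial>lborel)"
  proof (rule nn_integral_mono)
    fix z :: "(real^'n) \<times> real"
    show "ennreal (duhamel_kernel t x z) * ennreal (G z) \<le> ennreal (duhamel_kernel t x z) * ennreal (G z) * indicator {\<rho>..} (snd z) +
      ennreal c2 * (ennreal (poisson_kernel t (x - fst z)) * ennreal (G z) * indicator {0<..<\<rho>} (snd z))"
    proof (cases "0 < snd z \<and> snd z < \<rho>")
      case True
      then have "duhamel_kernel t x z = poisson_kernel (t - snd z) (x - fst z)"
        using \<rho> by (simp add: duhamel_kernel_def \<rho>_def)
      also have "\<dots> \<le> c2 * poisson_kernel t (x - fst z)"
        unfolding c2_def using True t by (intro poisson_kernel_le_time) (auto simp: \<rho>_def)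
      finally have "ennreal (duhamel_kernel t x z) * ennreal (G z) \<le> ennreal (c2 * poisson_kernel t (x - fst z)) * ennreal (G z)"
        by (intro mult_right_mono ennreal_leI) auto
      then show ?thesis using True c2 by (simp add: ennreal_mult' mult.assoc)
    next
      case False
      then show ?thesis by (auto simp: duhamel_kernel_def indicator_def)
    qed
  qed
  also have "\<dots> = (\<integral>\<^sup>+z. ennreal (duhamel_kernel t x z) * ennreal (G z) * indicator {\<rho>..} (snd z) \<partial>lborel) + ennreal c2 * I"
    unfolding I_def by (simp add: nn_integral_add nn_integral_cmult)
  also have "\<dots> \<le> ennreal \<kappa> + ennreal c2 * ennreal (c2 * \<kappa> / \<omega>)"
    by (intro add_mono mult_left_mono near I) auto
  also have "\<dots> = ennreal (duhamel_const CARD('n) * \<kappa>)"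
    using \<kappa> c2 \<omega> unfolding duhamel_const_def c2_def[symmetric] \<omega>_def[symmetric]
    by (simp add: ennreal_mult'[symmetric] ennreal_plus[symmetric] distrib_left distrib_right mult_ac del: ennreal_plus)
  finally show ?thesis .
qed

text \<open>Travelling for r - s and then for t - r is travelling for t - s. A source later than r
  has not yet acted at time r, whence the indicator.\<close>

lemma duhamel_kernel_convolution:
  fixes x :: "real^'n"
  assumes r: "0 < r" "r < t"
  shows "(\<integral>\<^sup>+y. ennreal (poisson_kernel (t - r) (x - y) * duhamel_kernel r y z) \<partial>lborel) =
    ennreal (indicator {..<r} (snd z) * duhamel_kernel t x z)"
proof (cases "0 < snd z \<and> snd z < r")
  case True
  have "(\<integral>\<^sup>+y. ennreal (poisson_kernel (t - r) (x - y) * duhamel_kernel r y z) \<partial>lborel) =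
    (\<integral>\<^sup>+y. ennreal (poisson_kernel (t - r) (x - y)) * ennreal (poisson_kernel (r - snd z) (y - fst z)) \<partial>lborel)"
    using True r by (intro nn_integral_cong)
      (simp add: duhamel_kernel_def ennreal_mult'' poisson_kernel_pos less_imp_le)
  also have "\<dots> = ennreal (poisson_kernel (t - r + (r - snd z)) (x - fst z))"
    using True r by (intro poisson_kernel_convolution_shift) auto
  finally show ?thesis using True r by (simp add: duhamel_kernel_def)
qed (auto simp: duhamel_kernel_def)

lemma nn_integral_poisson_poisson:
  fixes f :: "real^'n \<Rightarrow> ennreal"
  assumes [measurable]: "f \<in> borel_measurable borel" and "0 < a" "0 < b"
  shows "(\<integral>\<^sup>+y. ennreal (poisson_kernel a (x - y)) * (\<integral>\<^sup>+w. ennreal (poisson_kernel b (y - w)) * f w \<partial>lborel) \<partial>lborel) =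
    (\<integral>\<^sup>+w. ennreal (poisson_kernel (a + b) (x - w)) * f w \<partial>lborel)"
proof -
  have "(\<integral>\<^sup>+y. ennreal (poisson_kernel a (x - y)) * (\<integral>\<^sup>+w. ennreal (poisson_kernel b (y - w)) * f w \<partial>lborel) \<partial>lborel) =
    (\<integral>\<^sup>+y. (\<integral>\<^sup>+w. ennreal (poisson_kernel a (x - y)) * ennreal (poisson_kernel b (y - w)) * f w \<partial>lborel) \<partial>lborel)"
    by (intro nn_integral_cong) (subst nn_integral_cmult[symmetric], measurable, simp add: mult.assoc)
  also have "\<dots> = (\<integral>\<^sup>+w. (\<integral>\<^sup>+y. ennreal (poisson_kernel a (x - y)) * ennreal (poisson_kernel b (y - w)) * f w \<partial>lborel) \<partial>lborel)"
    by (rule lborel_pair.Fubini') measurable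
  also have "\<dots> = (\<integral>\<^sup>+w. ennreal (poisson_kernel (a + b) (x - w)) * f w \<partial>lborel)"
    by (intro nn_integral_cong) (subst nn_integral_multc, measurable, simp add: poisson_kernel_convolution_shift assms)
  finally show ?thesis .
qed

lemma nn_integral_poisson_duhamel:
  fixes f :: "(real^'n) \<times> real \<Rightarrow> ennreal"
  assumes [measurable]: "f \<in> borel_measurable borel" and r: "0 < r" "r < t"
  shows "(\<integral>\<^sup>+y. ennreal (poisson_kernel (t - r) (x - y)) * (\<integral>\<^sup>+z. ennreal (duhamel_kernel r y z) * f z \<partial>lborel) \<partial>lborel) =
    (\<integral>\<^sup>+z. ennreal (indicator {..<r} (snd z) * duhamel_kernel t x z) * f z \<partial>lborel)"
proof -
  have "(\<integral>\<^sup>+y. ennreal (poisson_kernel (t - r) (x - y)) * (\<integral>\<^sup>+z. ennreal (duhamel_kernel r y z) * f z \<partial>lborel) \<partial>lborel) =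
    (\<integral>\<^sup>+y. (\<integral>\<^sup>+z. ennreal (poisson_kernel (t - r) (x - y) * duhamel_kernel r y z) * f z \<partial>lborel) \<partial>lborel)"
    by (intro nn_integral_cong) (subst nn_integral_cmult[symmetric], measurable, simp add: mult.assoc ennreal_mult'')
  also have "\<dots> = (\<integral>\<^sup>+z. (\<integral>\<^sup>+y. ennreal (poisson_kernel (t - r) (x - y) * duhamel_kernel r y z) * f z \<partial>lborel) \<partial>lborel)"
    by (rule lborel_pair.Fubini') measurable
  also have "\<dots> = (\<integral>\<^sup>+z. ennreal (indicator {..<r} (snd z) * duhamel_kernel t x z) * f z \<partial>lborel)"
    by (intro nn_integral_cong) (subst nn_integral_multc, measurable, simp add: duhamel_kernel_convolution r)
  finally show ?thesis .
qed

text \<open>What remains of the nonlinear term once u is forgotten. Both bounds on G are invariant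
  under G(y,s) -> \<lambda> G(\<lambda> y, \<lambda> s), so rescaling alone cannot make k small.
  They are required at every point; null sets are removed when Borel versions are chosen. The locale
  is applied to each solution and to their difference.\<close>

locale critical_source =
  fixes F :: "(real^'n) \<times> real \<Rightarrow> real^'m" and G :: "(real^'n) \<times> real \<Rightarrow> real"
    and T :: ereal and k :: real
  assumes F_measurable [measurable]: "F \<in> borel_measurable borel"
    and G_measurable [measurable]: "G \<in> borel_measurable borel"
    and F_le: "norm (F z) \<le> G z"
    and k_nonneg: "k \<ge> 0"
    and G_le: "0 < s \<Longrightarrow> ereal s < T \<Longrightarrow> s * G (y, s) \<le> k"
    and G_carleson: "0 < r \<Longrightarrow> ereal r < T \<Longrightarrow>
      (\<integral>\<^sup>+z. ennreal (G z) * indicator (ball x r \<times> {0<..<r}) z \<partial>lborel) \<le> ennreal (k * r ^ CARD('n))"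
begin

definition B :: real where "B = duhamel_const CARD('n) * k"

text \<open>The mild solution with zero initial value and source \<open>F\<close>. For the
  difference of the two sources it is w, because the terms S(t)a cancel.\<close>

definition W :: "(real^'n) \<times> real \<Rightarrow> real^'m" where
  "W z = (LINT z'|lborel. duhamel_kernel (snd z) (fst z) z' *\<^sub>R F z')"

lemma B_nonneg: "B \<ge> 0"
  unfolding B_def using duhamel_const_pos[of "CARD('n)"] k_nonneg by simp

lemma G_nonneg: "G z \<ge> 0"
  using F_le[of z] norm_ge_zero[of "F z"] by linarith

lemma W_measurable [measurable]: "W \<in> borel_measurable borel"
  unfolding W_def by measurable

lemma nn_integral_duhamel_G:
  assumes t: "0 < t" "ereal t < T"
  shows "(\<integral>\<^sup>+z. ennreal (duhamel_kernel t x z) * ennreal (G z) \<partial>lborel) \<le> ennreal B"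
  unfolding B_def
proof (rule duhamel_bound)
  have lt: "ereal s < T" if "s < t" for s
    using that t by (metis ereal_less(2) less_ereal.simps(1) order_less_trans)
  show "AE z in lborel. 0 < snd z \<and> snd z < t \<longrightarrow> snd z * G z \<le> k"
    by (intro AE_I2) (metis G_le lt prod.collapse)
  show "(\<integral>\<^sup>+z. ennreal (G z) * indicator (ball x (t/2) \<times> {0<..<t/2}) z \<partial>lborel) \<le> ennreal (k * (t/2) ^ CARD('n))" for x
    using t lt[of "t/2"] by (intro G_carleson) auto
qed (use k_nonneg t in auto)

lemma integrable_duhamel:
  fixes f :: "(real^'n) \<times> real \<Rightarrow> 'b::euclidean_space"
  assumes t: "0 < t" "ereal t < T"
    and [measurable]: "f \<in> borel_measurable borel" and le: "\<And>z. norm (f z) \<le> C * G z"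
  shows "integrable lborel (\<lambda>z. duhamel_kernel t x z *\<^sub>R f z)"
proof (rule integrableI_bounded)
  have "(\<integral>\<^sup>+z. ennreal (norm (duhamel_kernel t x z *\<^sub>R f z)) \<partial>lborel) \<le>
    (\<integral>\<^sup>+z. ennreal \<bar>C\<bar> * (ennreal (duhamel_kernel t x z) * ennreal (G z)) \<partial>lborel)"
  proof (rule nn_integral_mono)
    fix z
    have "norm (f z) \<le> \<bar>C\<bar> * G z"
      using le[of z] mult_right_mono[of C "\<bar>C\<bar>" "G z"] G_nonneg[of z] by linarith
    then have "duhamel_kernel t x z * norm (f z) \<le> \<bar>C\<bar> * (duhamel_kernel t x z * G z)"
      using mult_left_mono[of "norm (f z)" "\<bar>C\<bar> * G z" "duhamel_kernel t x z"] by (simp add: mult_ac)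
    then show "ennreal (norm (duhamel_kernel t x z *\<^sub>R f z)) \<le> ennreal \<bar>C\<bar> * (ennreal (duhamel_kernel t x z) * ennreal (G z))"
      by (simp add: ennreal_mult[symmetric] G_nonneg ennreal_leI)
  qed
  also have "\<dots> = ennreal \<bar>C\<bar> * (\<integral>\<^sup>+z. ennreal (duhamel_kernel t x z) * ennreal (G z) \<partial>lborel)"
    by (rule nn_integral_cmult) measurable
  also have "\<dots> \<le> ennreal \<bar>C\<bar> * ennreal B" by (intro mult_left_mono nn_integral_duhamel_G t) auto
  also have "\<dots> < \<infinity>" by (simp add: ennreal_mult_less_top)
  finally show "(\<integral>\<^sup>+z. ennreal (norm (duhamel_kernel t x z *\<^sub>R f z)) \<partial>lborel) < \<infinity>" .
qed measurable

lemma W_le_nn_integral: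
  assumes t: "0 < t" "ereal t < T"
  shows "ennreal (norm (W (x, t))) \<le> (\<integral>\<^sup>+z. ennreal (duhamel_kernel t x z) * ennreal (G z) \<partial>lborel)"
proof -
  have int: "integrable lborel (\<lambda>z. duhamel_kernel t x z *\<^sub>R F z)"
    using F_le by (intro integrable_duhamel[OF t, of _ 1]) auto
  have "ennreal (norm (W (x, t))) \<le> (\<integral>\<^sup>+z. ennreal (norm (duhamel_kernel t x z *\<^sub>R F z)) \<partial>lborel)"
    unfolding W_def by (simp del: norm_scaleR) (rule integral_norm_bound_ennreal[OF int])
  also have "\<dots> \<le> (\<integral>\<^sup>+z. ennreal (duhamel_kernel t x z) * ennreal (G z) \<partial>lborel)"
    by (intro nn_integral_mono) (auto simp: ennreal_mult[symmetric] G_nonneg F_le intro!: ennreal_leI mult_left_mono)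
  finally show ?thesis .
qed

lemma W_bound:
  assumes t: "0 < t" "ereal t < T"
  shows "norm (W (x, t)) \<le> B"
  using order_trans[OF W_le_nn_integral nn_integral_duhamel_G] t B_nonneg
  by (simp add: ennreal_le_iff)

text \<open>Sources before r are propagated to time r and then by S(t-r); the semigroup property
  under Fubini collects them into W(r). This restart identity takes the place of the differential
  equation in the oscillation estimates and in the Kato step.\<close>

lemma W_step:
  assumes r: "0 < r" "r < t" "ereal t < T"
  shows "W (x, t) = (LINT y|lborel. poisson_kernel (t - r) (x - y) *\<^sub>R W (y, r)) +
     (LINT z|lborel. (indicator {r..} (snd z) * duhamel_kernel t x z) *\<^sub>R F z)"
    and "integrable lborel (\<lambda>z. (indicator {r..} (snd z) * duhamel_kernel t x z) *\<^sub>R F z)"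
proof -
  have t: "0 < t" using r by simp
  have int: "integrable lborel (\<lambda>z. duhamel_kernel t x z *\<^sub>R F z)"
    using F_le by (intro integrable_duhamel[OF t r(3), of _ 1]) auto
  have int1: "integrable lborel (\<lambda>z. (indicator {..<r} (snd z) * duhamel_kernel t x z) *\<^sub>R F z)"
    by (rule Bochner_Integration.integrable_bound[OF int]) (auto simp: indicator_def)
  show int2: "integrable lborel (\<lambda>z. (indicator {r..} (snd z) * duhamel_kernel t x z) *\<^sub>R F z)"
    by (rule Bochner_Integration.integrable_bound[OF int]) (auto simp: indicator_def)
  have "W (x, t) = (LINT z|lborel. (indicator {..<r} (snd z) * duhamel_kernel t x z) *\<^sub>R F z
      + (indicator {r..} (snd z) * duhamel_kernel t x z) *\<^sub>R F z)"
    unfolding W_def by (intro Bochner_Integration.integral_cong) (auto simp: indicator_def)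
  also have "\<dots> = (LINT z|lborel. (indicator {..<r} (snd z) * duhamel_kernel t x z) *\<^sub>R F z)
     + (LINT z|lborel. (indicator {r..} (snd z) * duhamel_kernel t x z) *\<^sub>R F z)"
    by (rule Bochner_Integration.integral_add[OF int1 int2])
  also have "(LINT z|lborel. (indicator {..<r} (snd z) * duhamel_kernel t x z) *\<^sub>R F z) =
    (LINT z|lborel. (LINT y|lborel. (poisson_kernel (t - r) (x - y) * duhamel_kernel r y z) *\<^sub>R F z))"
  proof (intro Bochner_Integration.integral_cong refl)
    fix z
    have nn: "poisson_kernel (t - r) (x - y) * duhamel_kernel r y z \<ge> 0" for y
      using r by (intro mult_nonneg_nonneg) (auto intro!: less_imp_le poisson_kernel_pos)
    have "has_bochner_integral lborel (\<lambda>y. poisson_kernel (t - r) (x - y) * duhamel_kernel r y z)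
       (indicator {..<r} (snd z) * duhamel_kernel t x z)"
      by (rule has_bochner_integral_nn_integral) (use nn duhamel_kernel_convolution[OF r(1,2), of x z] in auto)
    then have "integrable lborel (\<lambda>y. poisson_kernel (t - r) (x - y) * duhamel_kernel r y z)"
      "(LINT y|lborel. poisson_kernel (t - r) (x - y) * duhamel_kernel r y z) =
       indicator {..<r} (snd z) * duhamel_kernel t x z"
      by (auto simp: has_bochner_integral_iff)
    then show "(indicator {..<r} (snd z) * duhamel_kernel t x z) *\<^sub>R F z =
      (LINT y|lborel. (poisson_kernel (t - r) (x - y) * duhamel_kernel r y z) *\<^sub>R F z)"
      by (subst integral_scaleR_left) auto
  qed
  also have "\<dots> = (LINT y|lborel. (LINT z|lborel. (poisson_kernel (t - r) (x - y) * duhamel_kernel r y z) *\<^sub>R F z))"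
  proof (rule lborel_pair.Fubini_integral)
    show "integrable (lborel \<Otimes>\<^sub>M lborel) (\<lambda>(y, z). (poisson_kernel (t - r) (x - y) * duhamel_kernel r y z) *\<^sub>R F z)"
    proof (rule integrableI_bounded)
      have "(\<integral>\<^sup>+p. ennreal (norm (case p of (y, z) \<Rightarrow> (poisson_kernel (t - r) (x - y) * duhamel_kernel r y z) *\<^sub>R F z)) \<partial>(lborel \<Otimes>\<^sub>M lborel)) =
        (\<integral>\<^sup>+z. (\<integral>\<^sup>+y. ennreal (norm ((poisson_kernel (t - r) (x - y) * duhamel_kernel r y z) *\<^sub>R F z)) \<partial>lborel) \<partial>lborel)"
        by (subst lborel_pair.nn_integral_snd[symmetric]) auto
      also have "\<dots> = (\<integral>\<^sup>+z. ennreal (indicator {..<r} (snd z) * duhamel_kernel t x z) * ennreal (norm (F z)) \<partial>lborel)"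
      proof (rule nn_integral_cong)
        fix z
        have nn: "poisson_kernel (t - r) (x - y) * duhamel_kernel r y z \<ge> 0" for y
          using r by (intro mult_nonneg_nonneg) (auto intro!: less_imp_le poisson_kernel_pos)
        have "(\<integral>\<^sup>+y. ennreal (norm ((poisson_kernel (t - r) (x - y) * duhamel_kernel r y z) *\<^sub>R F z)) \<partial>lborel) =
          (\<integral>\<^sup>+y. ennreal (poisson_kernel (t - r) (x - y) * duhamel_kernel r y z) * ennreal (norm (F z)) \<partial>lborel)"
          using nn by (intro nn_integral_cong) (simp add: ennreal_mult[symmetric] abs_of_nonneg)
        also have "\<dots> = ennreal (indicator {..<r} (snd z) * duhamel_kernel t x z) * ennreal (norm (F z))"
          using r by (subst nn_integral_multc) (auto simp: duhamel_kernel_convolution)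
        finally show "(\<integral>\<^sup>+y. ennreal (norm ((poisson_kernel (t - r) (x - y) * duhamel_kernel r y z) *\<^sub>R F z)) \<partial>lborel) =
          ennreal (indicator {..<r} (snd z) * duhamel_kernel t x z) * ennreal (norm (F z))" .
      qed
      also have "\<dots> \<le> (\<integral>\<^sup>+z. ennreal (duhamel_kernel t x z) * ennreal (G z) \<partial>lborel)"
        by (intro nn_integral_mono mult_mono ennreal_leI) (auto simp: indicator_def F_le)
      also have "\<dots> \<le> ennreal B" by (rule nn_integral_duhamel_G[OF t r(3)])
      finally show "(\<integral>\<^sup>+p. ennreal (norm (case p of (y, z) \<Rightarrow> (poisson_kernel (t - r) (x - y) * duhamel_kernel r y z) *\<^sub>R F z)) \<partial>(lborel \<Otimes>\<^sub>M lborel)) < \<infinity>"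
        by (simp add: le_less_trans[OF _ ennreal_less_top])
    qed measurable
  qed
  also have "\<dots> = (LINT y|lborel. poisson_kernel (t - r) (x - y) *\<^sub>R W (y, r))"
    unfolding W_def by (simp flip: scaleR_scaleR)
  finally show "W (x, t) = (LINT y|lborel. poisson_kernel (t - r) (x - y) *\<^sub>R W (y, r)) +
     (LINT z|lborel. (indicator {r..} (snd z) * duhamel_kernel t x z) *\<^sub>R F z)" .
qed

end

section \<open>Continuity of the Duhamel integral\<close>

lemma ennreal_integral_le_nn_integral:
  fixes f :: "'a \<Rightarrow> real"
  assumes "integrable M f"
  shows "ennreal (integral\<^sup>L M f) \<le> (\<integral>\<^sup>+x. ennreal (f x) \<partial>M)"
proof -
  have "ennreal (integral\<^sup>L M f) \<le> ennreal (LINT x|M. max 0 (f x))"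
    using assms by (intro ennreal_leI integral_mono) auto
  also have "\<dots> = (\<integral>\<^sup>+x. ennreal (max 0 (f x)) \<partial>M)"
    using assms by (intro nn_integral_eq_integral[symmetric]) auto
  also have "\<dots> = (\<integral>\<^sup>+x. ennreal (f x) \<partial>M)"
    by (intro nn_integral_cong) (auto simp: max_def ennreal_neg)
  finally show ?thesis .
qed

lemma ennreal_add_le: "ennreal (a + b) \<le> ennreal a + ennreal b"
  by (metis add.commute add_increasing2 ennreal_leI ennreal_neg ennreal_plus le_add_same_cancel1 linear nle_le zero_le add_0)

lemma integrable_poisson_kernel:
  assumes "t > 0"
  shows "integrable lborel (\<lambda>y. poisson_kernel t (x - y :: real^'n))"
    and "(LINT y|lborel. poisson_kernel t (x - y :: real^'n)) = 1"
proof -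
  have "has_bochner_integral lborel (\<lambda>y. poisson_kernel t (x - y :: real^'n)) 1"
    by (rule has_bochner_integral_nn_integral)
      (use assms in \<open>auto simp: nn_integral_poisson_kernel_shift poisson_kernel_pos less_imp_le\<close>)
  then show "integrable lborel (\<lambda>y. poisson_kernel t (x - y :: real^'n))"
    "(LINT y|lborel. poisson_kernel t (x - y :: real^'n)) = 1"
    by (auto simp: has_bochner_integral_iff)
qed

lemma integrable_poisson_kernel_bounded:
  fixes f :: "real^'n \<Rightarrow> 'b::euclidean_space"
  assumes "t > 0" and [measurable]: "f \<in> borel_measurable borel" and "\<And>y. norm (f y) \<le> C"
  shows "integrable lborel (\<lambda>y. poisson_kernel t (x - y) *\<^sub>R f y)"
proof (rule Bochner_Integration.integrable_bound)
  show "integrable lborel (\<lambda>y. C * poisson_kernel t (x - y))"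
    by (intro integrable_mult_right integrable_poisson_kernel assms)
  show "AE y in lborel. norm (poisson_kernel t (x - y) *\<^sub>R f y) \<le> norm (C * poisson_kernel t (x - y))"
    using assms(3) poisson_kernel_pos[OF assms(1)]
    by (intro AE_I2) (auto simp: abs_mult mult.commute intro!: mult_right_mono order_trans[OF assms(3) abs_ge_self])
qed measurable

text \<open>The factor (h - 1) h of \<open>poisson_kernel_diff_le\<close> as a function of q =
  |z|/\<eta>. It is continuous and vanishes at q = 0.\<close>

definition kernel_osc :: "nat \<Rightarrow> real \<Rightarrow> real" where
  "kernel_osc n q = ((1 + q) ^ (n + 1) - 1) * (1 + q) ^ (n + 1)"

lemma kernel_osc_small:
  assumes "B \<ge> 0" "\<kappa> > 0"
  obtains \<rho> where "\<rho> > 0" "\<And>q. 0 \<le> q \<Longrightarrow> q < \<rho> \<Longrightarrow> B * kernel_osc n q \<le> \<kappa>"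
proof -
  have "((\<lambda>q. B * kernel_osc n q) \<longlongrightarrow> B * kernel_osc n 0) (at 0)"
    unfolding kernel_osc_def by (intro tendsto_intros)
  then have "eventually (\<lambda>q. B * kernel_osc n q < \<kappa>) (at 0)"
    using assms by (intro order_tendstoD(2)[of _ "B * kernel_osc n 0"]) (auto simp: kernel_osc_def)
  then obtain \<rho> where "\<rho> > 0" and *: "\<And>q. q \<noteq> 0 \<Longrightarrow> dist q 0 < \<rho> \<Longrightarrow> B * kernel_osc n q < \<kappa>"
    by (auto simp: eventually_at)
  have "B * kernel_osc n q \<le> \<kappa>" if "0 \<le> q" "q < \<rho>" for q
    using *[of q] that assms by (cases "q = 0") (auto simp: kernel_osc_def)
  with \<open>\<rho> > 0\<close> that show ?thesis by blast
qed

section \<open>Oscillation of the Duhamel integral in space and time\<close>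

context critical_source
begin

lemma integrable_poisson_W:
  assumes "t > 0" "0 < r" "ereal r < T"
  shows "integrable lborel (\<lambda>y. poisson_kernel t (x - y) *\<^sub>R W (y, r))"
  using assms W_bound by (intro integrable_poisson_kernel_bounded) auto

text \<open>The sources in [r,t) see a kernel of total mass t - r, so they contribute O(t - r) as
  soon as G is bounded there.\<close>

lemma W_increment_bound:
  assumes r: "0 < r" "r < t" and M: "\<And>y s. r \<le> s \<Longrightarrow> s < t \<Longrightarrow> G (y, s) \<le> M"
    and int: "integrable lborel (\<lambda>z. (indicator {r..} (snd z) * duhamel_kernel t x z) *\<^sub>R F z)"
  shows "norm (LINT z|lborel. (indicator {r..} (snd z) * duhamel_kernel t x z) *\<^sub>R F z) \<le> M * (t - r)"
proof -
  have M0: "M \<ge> 0" using M[of r] G_nonneg r by (meson order_trans order_refl)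
  have "ennreal (norm (LINT z|lborel. (indicator {r..} (snd z) * duhamel_kernel t x z) *\<^sub>R F z)) \<le>
    (\<integral>\<^sup>+z. ennreal (norm ((indicator {r..} (snd z) * duhamel_kernel t x z) *\<^sub>R F z)) \<partial>lborel)"
    by (rule integral_norm_bound_ennreal[OF int])
  also have "\<dots> \<le> (\<integral>\<^sup>+z. ennreal M * ennreal (duhamel_kernel t x z * indicator {r..} (snd z)) \<partial>lborel)"
  proof (rule nn_integral_mono)
    fix z :: "(real^'n) \<times> real"
    have "norm (F z) \<le> M" if "r \<le> snd z" "snd z < t"
      using F_le[of z] M[of "snd z" "fst z"] that by simp
    then have "norm ((indicator {r..} (snd z) * duhamel_kernel t x z) *\<^sub>R F z) \<le> M * (duhamel_kernel t x z * indicator {r..} (snd z))"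
      by (cases "r \<le> snd z \<and> snd z < t")
         (simp_all add: mult.commute[of M] mult_left_mono, auto simp: indicator_def duhamel_kernel_def)
    then show "ennreal (norm ((indicator {r..} (snd z) * duhamel_kernel t x z) *\<^sub>R F z)) \<le>
      ennreal M * ennreal (duhamel_kernel t x z * indicator {r..} (snd z))"
      using M0 by (simp add: ennreal_mult'[symmetric] ennreal_leI)
  qed
  also have "\<dots> = ennreal M * ennreal (t - r)"
    using r by (subst nn_integral_cmult) (auto simp: nn_integral_duhamel_kernel_window)
  also have "\<dots> = ennreal (M * (t - r))" using M0 by (simp add: ennreal_mult')
  finally show ?thesis using M0 r by (simp add: ennreal_le_iff)
qed

text \<open>Restart at time s - \<eta>. The smoothed part S(\<eta>)W(s-\<eta>) varies no more than B
  times the relative oscillation of the kernel at scale \<eta>; the sources added since then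
  contribute at most M \<eta> at each of the two points.\<close>

lemma W_spatial_oscillation:
  assumes s: "0 < \<eta>" "\<eta> < s" "ereal s < T" and M: "\<And>y \<sigma>. s - \<eta> \<le> \<sigma> \<Longrightarrow> \<sigma> < s \<Longrightarrow> G (y, \<sigma>) \<le> M"
  shows "norm (W (x, s) - W (y, s)) \<le> B * kernel_osc CARD('n) (norm (x - y) / \<eta>) + 2 * (M * \<eta>)"
proof -
  define r where "r = s - \<eta>"
  have r: "0 < r" "r < s" "s - r = \<eta>" using s by (auto simp: r_def)
  have rT: "ereal r < T" using r(2) s(3) by (metis less_ereal.simps(1) order_less_trans)
  define I where "I x = (LINT z|lborel. (indicator {r..} (snd z) * duhamel_kernel s x z) *\<^sub>R F z)" for x
  define S where "S x = (LINT z|lborel. poisson_kernel \<eta> (x - z) *\<^sub>R W (z, r))" for x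
  have W: "W (x, s) = S x + I x" for x
    unfolding S_def I_def using W_step(1)[OF r(1,2) s(3), of x] r(3) by simp
  have I: "norm (I x) \<le> M * \<eta>" for x
    unfolding I_def using W_increment_bound[OF r(1,2) M W_step(2)[OF r(1,2) s(3)], of x] r by (simp add: r_def)
  have int: "integrable lborel (\<lambda>z. poisson_kernel \<eta> (x - z) *\<^sub>R W (z, r))" for x
    using integrable_poisson_W s r rT by blast
  have "S x - S y = (LINT z|lborel. (poisson_kernel \<eta> (x - z) - poisson_kernel \<eta> (y - z)) *\<^sub>R W (z, r))"
    unfolding S_def scaleR_left_diff_distrib by (rule Bochner_Integration.integral_diff[OF int int, symmetric])
  also have "norm \<dots> \<le> (LINT z|lborel. (B * kernel_osc CARD('n) (norm (x - y) / \<eta>)) * poisson_kernel \<eta> (y - z))"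
  proof (rule Bochner_Integration.integral_norm_bound_integral)
    show "integrable lborel (\<lambda>z. (poisson_kernel \<eta> (x - z) - poisson_kernel \<eta> (y - z)) *\<^sub>R W (z, r))"
      unfolding scaleR_left_diff_distrib by (intro Bochner_Integration.integrable_diff int)
    show "integrable lborel (\<lambda>z. (B * kernel_osc CARD('n) (norm (x - y) / \<eta>)) * poisson_kernel \<eta> (y - z))"
      by (intro integrable_mult_right integrable_poisson_kernel s)
    fix z
    have "\<bar>poisson_kernel \<eta> (x - z) - poisson_kernel \<eta> (y - z)\<bar> \<le> kernel_osc CARD('n) (norm (x - y) / \<eta>) * poisson_kernel \<eta> (y - z)"
      using poisson_kernel_diff_le[OF s(1), of "y - z" "x - y"] by (simp add: kernel_osc_def)
    then have "\<bar>poisson_kernel \<eta> (x - z) - poisson_kernel \<eta> (y - z)\<bar> * norm (W (z, r)) \<le>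
      (kernel_osc CARD('n) (norm (x - y) / \<eta>) * poisson_kernel \<eta> (y - z)) * B"
      using W_bound[OF r(1) rT] by (intro mult_mono) auto
    then show "norm ((poisson_kernel \<eta> (x - z) - poisson_kernel \<eta> (y - z)) *\<^sub>R W (z, r)) \<le> (B * kernel_osc CARD('n) (norm (x - y) / \<eta>)) * poisson_kernel \<eta> (y - z)"
      by (simp add: mult_ac)
  qed
  also have "\<dots> = B * kernel_osc CARD('n) (norm (x - y) / \<eta>)"
    by (simp add: integrable_poisson_kernel(2)[OF s(1)])
  finally have "norm (S x - S y) \<le> B * kernel_osc CARD('n) (norm (x - y) / \<eta>)" .
  moreover have "W (x, s) - W (y, s) = (S x - S y) + (I x - I y)" unfolding W by simp
  moreover have "norm ((S x - S y) + (I x - I y)) \<le> norm (S x - S y) + (norm (I x) + norm (I y))"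
    by (meson norm_triangle_ineq norm_triangle_ineq4 add_left_mono order_trans)
  ultimately show ?thesis using I[of x] I[of y] by simp
qed

lemma G_bound:
  assumes "0 < \<epsilon>" "\<epsilon> \<le> s" "ereal s < T"
  shows "G (y, s) \<le> k / \<epsilon>"
proof -
  have "G (y, s) \<le> k / s" using G_le[of s y] assms by (simp add: field_simps)
  also have "\<dots> \<le> k / \<epsilon>" using assms k_nonneg by (intro divide_left_mono) auto
  finally show ?thesis .
qed

text \<open>The p_\<tau>-average of |W(x,s) - W(y,s)| is at most 3 \<kappa>: spatial continuity
  gives 2 \<kappa> for y near x, and the kernel tail with |W| \<le> B gives \<kappa> for the rest.
  The time increment at x costs 4 \<kappa> more. Uniformity in x and s is essential, since the bound
  is used at every point of a mesh.\<close>

lemma W_kernel_oscillation: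
  assumes \<epsilon>: "0 < \<epsilon>" and t: "ereal t < T" and \<kappa>: "\<kappa> > 0"
  obtains h where "h > 0"
    "\<And>s \<tau> x. \<epsilon> \<le> s \<Longrightarrow> 0 < \<tau> \<Longrightarrow> \<tau> \<le> h \<Longrightarrow> s + \<tau> \<le> t \<Longrightarrow>
      (\<integral>\<^sup>+y. ennreal (poisson_kernel \<tau> (x - y) * norm (W (x, s + \<tau>) - W (y, s))) \<partial>lborel) \<le> ennreal (7 * \<kappa>)"
proof -
  define M where "M = k / (\<epsilon> / 2)"
  have M0: "M \<ge> 0" using \<epsilon> k_nonneg by (simp add: M_def)
  have M: "G (y, \<sigma>) \<le> M" if "\<epsilon> / 2 \<le> \<sigma>" "\<sigma> \<le> t" for y \<sigma>
  proof -
    have "ereal \<sigma> < T" using that t by (metis ereal_less_eq(3) order_le_less_trans)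
    then show ?thesis unfolding M_def using that \<epsilon> by (intro G_bound) auto
  qed
  \<comment> \<open>The first entry keeps the window [s - \<eta>, s) at times \<ge> \<epsilon>/2,
    where G \<le> M; the second makes the contribution 2 M \<eta> of that window at most
    \<kappa>.\<close>
  define \<eta> where "\<eta> = min (\<epsilon> / 2) (\<kappa> / (2 * M + 1))"
  have \<eta>: "\<eta> > 0" using \<epsilon> \<kappa> M0 by (auto simp: \<eta>_def)
  have \<eta>_le: "\<eta> \<le> \<epsilon> / 2" unfolding \<eta>_def by (rule min.cobounded1)
  have "2 * (M * \<eta>) \<le> 2 * (M * (\<kappa> / (2 * M + 1)))" using M0 by (intro mult_left_mono) (auto simp: \<eta>_def)
  also have "\<dots> \<le> \<kappa>" using M0 \<kappa> by (simp add: field_simps)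
  finally have M\<eta>: "2 * (M * \<eta>) \<le> \<kappa>" .
  obtain q0 where q0: "q0 > 0" "\<And>q. 0 \<le> q \<Longrightarrow> q < q0 \<Longrightarrow> B * kernel_osc CARD('n) q \<le> \<kappa>"
    using kernel_osc_small[OF B_nonneg \<kappa>] by blast
  \<comment> \<open>The near region |x - y| < \<rho> is exactly where |x - y|/\<eta> < q0.\<close>
  define \<rho> where "\<rho> = q0 * \<eta>"
  have \<rho>: "\<rho> > 0" using q0 \<eta> by (simp add: \<rho>_def)
  define C where "C = (1 + 1 / \<rho>\<^sup>2) powr ((real CARD('n) + 1) / 2)"
  have C: "C \<ge> 0" by (simp add: C_def)
  \<comment> \<open>The two entries make the tail contribution 2 B C \<tau> and the increment M
    \<tau> at most \<kappa> each.\<close>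
  define h where "h = min (\<kappa> / (2 * B * C + 1)) (\<kappa> / (M + 1))"
  have BC: "2 * B * C \<ge> 0" using B_nonneg C by simp
  have h: "h > 0" unfolding h_def min_less_iff_conj using \<kappa> BC M0 by (intro conjI divide_pos_pos; linarith)
  have hBC: "2 * B * C * \<tau> \<le> \<kappa>" if "0 < \<tau>" "\<tau> \<le> h" for \<tau>
  proof -
    have "2 * B * C * \<tau> \<le> 2 * B * C * (\<kappa> / (2 * B * C + 1))" using BC that by (intro mult_left_mono) (auto simp: h_def)
    also have "\<dots> \<le> \<kappa>" using BC \<kappa> by (simp add: field_simps)
    finally show ?thesis .
  qed
  have hM: "M * \<tau> \<le> \<kappa>" if "0 < \<tau>" "\<tau> \<le> h" for \<tau>
  proof -
    have "M * \<tau> \<le> M * (\<kappa> / (M + 1))" using M0 that by (intro mult_left_mono) (auto simp: h_def)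
    also have "\<dots> \<le> \<kappa>" using M0 \<kappa> by (simp add: field_simps)
    finally show ?thesis .
  qed
  have main: "(\<integral>\<^sup>+y. ennreal (poisson_kernel \<tau> (x - y) * norm (W (x, s + \<tau>) - W (y, s))) \<partial>lborel) \<le> ennreal (7 * \<kappa>)"
    if s: "\<epsilon> \<le> s" and \<tau>: "0 < \<tau>" "\<tau> \<le> h" and st: "s + \<tau> \<le> t" for s \<tau> x
  proof -
    have sT: "ereal s < T" "ereal (s + \<tau>) < T" using st \<tau> t
      by (metis ereal_less_eq(3) order_le_less_trans le_add_same_cancel1 less_imp_le order_trans,
          metis ereal_less_eq(3) order_le_less_trans)
    have s0: "s > 0" using s \<epsilon> by simp
    have P0: "poisson_kernel \<tau> z > 0" "poisson_kernel 1 z > 0" for z :: "real^'n" using \<tau> by (auto intro: poisson_kernel_pos)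
    have "poisson_kernel \<tau> (x - y) * norm (W (x, s) - W (y, s)) \<le>
      2 * \<kappa> * poisson_kernel \<tau> (x - y) + 2 * B * C * \<tau> * poisson_kernel 1 (x - y)" for y
    proof (cases "norm (x - y) < \<rho>")
      case True
      then have "norm (x - y) / \<eta> < q0" using \<eta> unfolding \<rho>_def by (simp add: divide_less_eq)
      then have "B * kernel_osc CARD('n) (norm (x - y) / \<eta>) \<le> \<kappa>" using \<eta> by (intro q0) auto
      moreover have "norm (W (x, s) - W (y, s)) \<le> B * kernel_osc CARD('n) (norm (x - y) / \<eta>) + 2 * (M * \<eta>)"
        using \<eta> \<eta>_le s \<epsilon> st \<tau> sT by (intro W_spatial_oscillation M) auto
      ultimately have "norm (W (x, s) - W (y, s)) \<le> 2 * \<kappa>" using M\<eta> by linarith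
      then have "poisson_kernel \<tau> (x - y) * norm (W (x, s) - W (y, s)) \<le> poisson_kernel \<tau> (x - y) * (2 * \<kappa>)"
        using P0 by (intro mult_left_mono) (auto intro: less_imp_le)
      moreover have "2 * B * C * \<tau> * poisson_kernel 1 (x - y) \<ge> 0" using BC \<tau> P0(2)[of "x - y"] by simp
      ultimately show ?thesis by (simp add: mult_ac)
    next
      case False
      have "norm (W (x, s) - W (y, s)) \<le> 2 * B"
        using norm_triangle_ineq4[of "W (x, s)" "W (y, s)"] W_bound[OF s0 sT(1), of x] W_bound[OF s0 sT(1), of y] by linarith
      moreover have "poisson_kernel \<tau> (x - y) \<le> \<tau> * C * poisson_kernel 1 (x - y)"
        unfolding C_def using False \<rho> \<tau> by (intro poisson_kernel_tail) auto
      ultimately have "poisson_kernel \<tau> (x - y) * norm (W (x, s) - W (y, s)) \<le> (\<tau> * C * poisson_kernel 1 (x - y)) * (2 * B)"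
        using \<tau> C P0(2)[of "x - y"] by (intro mult_mono) auto
      moreover have "2 * \<kappa> * poisson_kernel \<tau> (x - y) \<ge> 0" using \<kappa> P0(1)[of "x - y"] by simp
      ultimately show ?thesis by (simp add: mult_ac)
    qed
    then have "(\<integral>\<^sup>+y. ennreal (poisson_kernel \<tau> (x - y) * norm (W (x, s) - W (y, s))) \<partial>lborel) \<le>
      (\<integral>\<^sup>+y. ennreal (2 * \<kappa>) * ennreal (poisson_kernel \<tau> (x - y)) + ennreal (2 * B * C * \<tau>) * ennreal (poisson_kernel 1 (x - y)) \<partial>lborel)"
      using \<kappa> BC \<tau> P0 by (intro nn_integral_mono)
        (simp add: ennreal_mult'[symmetric] ennreal_plus[symmetric] less_imp_le ennreal_leI del: ennreal_plus)
    also have "\<dots> = ennreal (2 * \<kappa>) + ennreal (2 * B * C * \<tau>)"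
      using \<tau> by (simp add: nn_integral_add nn_integral_cmult nn_integral_poisson_kernel_shift)
    also have "\<dots> \<le> ennreal (3 * \<kappa>)"
      using hBC[OF \<tau>] BC \<tau> \<kappa> by (simp add: ennreal_plus[symmetric] del: ennreal_plus)
    finally have int1: "(\<integral>\<^sup>+y. ennreal (poisson_kernel \<tau> (x - y) * norm (W (x, s) - W (y, s))) \<partial>lborel) \<le> ennreal (3 * \<kappa>)" .
    \<comment> \<open>The time increment reduces to the spatial estimate: by the restart identity,
      W(x,s+\<tau>) - W(x,s) is the p_\<tau>-average of W(y,s) - W(x,s) plus the new sources
      \<open>I\<close>, hence at most 3 \<kappa> + \<kappa>.\<close>
    define I where "I = (LINT z|lborel. (indicator {s..} (snd z) * duhamel_kernel (s + \<tau>) x z) *\<^sub>R F z)"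
    have ss: "0 < s" "s < s + \<tau>" using s0 \<tau> by auto
    have I: "norm I \<le> M * \<tau>"
      unfolding I_def using W_increment_bound[OF ss M W_step(2)[OF ss sT(2)], of x] s \<epsilon> st by simp
    have iP: "integrable lborel (\<lambda>y. poisson_kernel \<tau> (x - y) *\<^sub>R W (y, s))"
       "integrable lborel (\<lambda>y. poisson_kernel \<tau> (x - y) *\<^sub>R W (x, s))"
      by (auto intro!: integrable_poisson_W integrable_scaleR_left integrable_poisson_kernel \<tau>(1) s0 sT)
    have "W (x, s + \<tau>) - W (x, s) = (LINT y|lborel. poisson_kernel \<tau> (x - y) *\<^sub>R W (y, s))
        - (LINT y|lborel. poisson_kernel \<tau> (x - y) *\<^sub>R W (x, s)) + I"
      using W_step(1)[OF ss sT(2), of x] integrable_poisson_kernel[OF \<tau>(1), of x] unfolding I_def by simp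
    also have "(LINT y|lborel. poisson_kernel \<tau> (x - y) *\<^sub>R W (y, s))
        - (LINT y|lborel. poisson_kernel \<tau> (x - y) *\<^sub>R W (x, s)) =
       (LINT y|lborel. poisson_kernel \<tau> (x - y) *\<^sub>R (W (y, s) - W (x, s)))"
      unfolding scaleR_right_diff_distrib by (rule Bochner_Integration.integral_diff[OF iP, symmetric])
    finally have eq: "W (x, s + \<tau>) - W (x, s) = (LINT y|lborel. poisson_kernel \<tau> (x - y) *\<^sub>R (W (y, s) - W (x, s))) + I" .
    have "integrable lborel (\<lambda>y. poisson_kernel \<tau> (x - y) *\<^sub>R (W (y, s) - W (x, s)))"
      unfolding scaleR_right_diff_distrib by (intro Bochner_Integration.integrable_diff iP)
    then have "ennreal (norm (LINT y|lborel. poisson_kernel \<tau> (x - y) *\<^sub>R (W (y, s) - W (x, s)))) \<le>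
       (\<integral>\<^sup>+y. ennreal (norm (poisson_kernel \<tau> (x - y) *\<^sub>R (W (y, s) - W (x, s)))) \<partial>lborel)"
      by (rule integral_norm_bound_ennreal)
    also have "\<dots> = (\<integral>\<^sup>+y. ennreal (poisson_kernel \<tau> (x - y) * norm (W (x, s) - W (y, s))) \<partial>lborel)"
      using P0 by (intro nn_integral_cong) (simp add: norm_minus_commute less_imp_le)
    also note int1
    finally have "norm (LINT y|lborel. poisson_kernel \<tau> (x - y) *\<^sub>R (W (y, s) - W (x, s))) \<le> 3 * \<kappa>"
      using \<kappa> by (simp add: ennreal_le_iff)
    then have diff: "norm (W (x, s + \<tau>) - W (x, s)) \<le> 4 * \<kappa>"
      unfolding eq using I hM[OF \<tau>] norm_triangle_le[of _ I "4 * \<kappa>"] by (smt (verit) norm_triangle_ineq)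
    have "(\<integral>\<^sup>+y. ennreal (poisson_kernel \<tau> (x - y) * norm (W (x, s + \<tau>) - W (y, s))) \<partial>lborel) \<le>
      (\<integral>\<^sup>+y. ennreal (4 * \<kappa>) * ennreal (poisson_kernel \<tau> (x - y)) + ennreal (poisson_kernel \<tau> (x - y) * norm (W (x, s) - W (y, s))) \<partial>lborel)"
    proof (rule nn_integral_mono)
      fix y
      have "norm (W (x, s + \<tau>) - W (y, s)) \<le> 4 * \<kappa> + norm (W (x, s) - W (y, s))"
        using diff norm_triangle_ineq[of "W (x, s + \<tau>) - W (x, s)" "W (x, s) - W (y, s)"] by simp
      then have "poisson_kernel \<tau> (x - y) * norm (W (x, s + \<tau>) - W (y, s)) \<le>
         poisson_kernel \<tau> (x - y) * (4 * \<kappa> + norm (W (x, s) - W (y, s)))"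
        using P0 by (intro mult_left_mono) (auto intro: less_imp_le)
      then show "ennreal (poisson_kernel \<tau> (x - y) * norm (W (x, s + \<tau>) - W (y, s))) \<le>
        ennreal (4 * \<kappa>) * ennreal (poisson_kernel \<tau> (x - y)) + ennreal (poisson_kernel \<tau> (x - y) * norm (W (x, s) - W (y, s)))"
        using \<kappa> P0[of "x - y"]
        by (simp add: ennreal_mult'[symmetric] ennreal_plus[symmetric] less_imp_le ennreal_leI distrib_left mult.commute del: ennreal_plus)
    qed
    also have "\<dots> = ennreal (4 * \<kappa>) + (\<integral>\<^sup>+y. ennreal (poisson_kernel \<tau> (x - y) * norm (W (x, s) - W (y, s))) \<partial>lborel)"
      using \<tau> by (simp add: nn_integral_add nn_integral_cmult nn_integral_poisson_kernel_shift)
    also have "\<dots> \<le> ennreal (4 * \<kappa>) + ennreal (3 * \<kappa>)" by (intro add_left_mono int1)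
    also have "\<dots> = ennreal (7 * \<kappa>)" using \<kappa> by (simp add: ennreal_plus[symmetric] del: ennreal_plus)
    finally show ?thesis .
  qed
  show ?thesis by (rule that[OF h main])
qed

end

section \<open>Kato's inequality in mild form\<close>

context critical_source
begin

text \<open>Integrating $c \cdot W(x,t)$ with $c = W(x,t)$ against the semigroup and absorbing half of
  $|c|^2$ replaces Jensen's inequality.\<close>
lemma norm_W_sq_step:
  assumes r: "0 < r" "r < t" "ereal t < T"
    and M: "\<And>y s. r \<le> s \<Longrightarrow> s < t \<Longrightarrow> G (y, s) \<le> M"
    and balance: "AE z in lborel. 0 < snd z \<and> ereal (snd z) < T \<longrightarrow> 2 * (W z \<bullet> F z) \<le> (norm (W z))\<^sup>2 * G z"
  shows "ennreal ((norm (W (x, t)))\<^sup>2) \<le>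
    (\<integral>\<^sup>+y. ennreal (poisson_kernel (t - r) (x - y)) * ennreal ((norm (W (y, r)))\<^sup>2) \<partial>lborel) +
    (\<integral>\<^sup>+z. ennreal (indicator {r..} (snd z) * duhamel_kernel t x z) * ennreal ((norm (W z))\<^sup>2 * G z) \<partial>lborel) +
    (\<integral>\<^sup>+z. ennreal (indicator {r..} (snd z) * duhamel_kernel t x z) * ennreal (2 * M * norm (W (x, t) - W z)) \<partial>lborel)"
proof -
  define c where "c = W (x, t)"
  define P where "P y = poisson_kernel (t - r) (x - y)" for y
  define K where "K z = indicator {r..} (snd z) * duhamel_kernel t x z" for z
  have [measurable]: "P \<in> borel_measurable borel" "K \<in> borel_measurable borel"
    unfolding P_def K_def by measurable
  have P0: "P y \<ge> 0" for y unfolding P_def using r by (intro less_imp_le poisson_kernel_pos) simp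
  have K0: "K z \<ge> 0" for z unfolding K_def by simp
  have rT: "ereal r < T" using r by (metis less_ereal.simps(1) order_less_trans)
  have M0: "M \<ge> 0" using M[of r] G_nonneg r by (meson order_trans order_refl)
  have iPW: "integrable lborel (\<lambda>y. P y *\<^sub>R W (y, r))"
    unfolding P_def using r rT by (intro integrable_poisson_W) auto
  have iP: "integrable lborel P" "(LINT y|lborel. P y) = 1"
    unfolding P_def using integrable_poisson_kernel[of "t - r" x] r by auto
  have "norm ((norm (W (y, r)))\<^sup>2) \<le> B\<^sup>2" for y
    using W_bound[OF r(1) rT, of y] by (auto intro!: power_mono)
  then have iPW2: "integrable lborel (\<lambda>y. P y *\<^sub>R (norm (W (y, r)))\<^sup>2)"
    unfolding P_def using r by (intro integrable_poisson_kernel_bounded) auto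
  have iKF: "integrable lborel (\<lambda>z. K z *\<^sub>R F z)"
    unfolding K_def by (rule W_step(2)[OF r])
  have "(norm c)\<^sup>2 = c \<bullet> ((LINT y|lborel. P y *\<^sub>R W (y, r)) + (LINT z|lborel. K z *\<^sub>R F z))"
    unfolding power2_norm_eq_inner using W_step(1)[OF r, of x] unfolding c_def P_def K_def by simp
  also have "\<dots> = (LINT y|lborel. c \<bullet> (P y *\<^sub>R W (y, r))) + (LINT z|lborel. c \<bullet> (K z *\<^sub>R F z))"
    using iPW iKF by (simp add: inner_right_distrib del: inner_scaleR_right)
  also have "(LINT y|lborel. c \<bullet> (P y *\<^sub>R W (y, r))) \<le> (LINT y|lborel. (norm c)\<^sup>2 / 2 * P y + (P y *\<^sub>R (norm (W (y, r)))\<^sup>2) / 2)"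
  proof (rule integral_mono)
    show "integrable lborel (\<lambda>y. c \<bullet> (P y *\<^sub>R W (y, r)))" by (intro integrable_inner_right iPW)
    show "integrable lborel (\<lambda>y. (norm c)\<^sup>2 / 2 * P y + (P y *\<^sub>R (norm (W (y, r)))\<^sup>2) / 2)"
      using iP iPW2 by simp
    fix y
    have "c \<bullet> W (y, r) \<le> ((norm c)\<^sup>2 + (norm (W (y, r)))\<^sup>2) / 2"
      using norm_cauchy_schwarz[of c "W (y, r)"] sum_squares_bound[of "norm c" "norm (W (y, r))"] by simp
    then have "P y * (c \<bullet> W (y, r)) \<le> P y * (((norm c)\<^sup>2 + (norm (W (y, r)))\<^sup>2) / 2)"
      by (intro mult_left_mono P0)
    then show "c \<bullet> (P y *\<^sub>R W (y, r)) \<le> (norm c)\<^sup>2 / 2 * P y + (P y *\<^sub>R (norm (W (y, r)))\<^sup>2) / 2"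
      by (simp add: field_simps)
  qed
  also have "\<dots> = (norm c)\<^sup>2 / 2 + (LINT y|lborel. P y *\<^sub>R (norm (W (y, r)))\<^sup>2) / 2"
    using iP iPW2 by simp
  finally have "(norm c)\<^sup>2 \<le> (LINT y|lborel. P y *\<^sub>R (norm (W (y, r)))\<^sup>2) + 2 * (LINT z|lborel. c \<bullet> (K z *\<^sub>R F z))"
    by simp
  also have "2 * (LINT z|lborel. c \<bullet> (K z *\<^sub>R F z)) = (LINT z|lborel. 2 * (c \<bullet> (K z *\<^sub>R F z)))"
    by simp
  finally have "ennreal ((norm c)\<^sup>2) \<le> ennreal (LINT y|lborel. P y *\<^sub>R (norm (W (y, r)))\<^sup>2) + ennreal (LINT z|lborel. 2 * (c \<bullet> (K z *\<^sub>R F z)))"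
    by (rule order_trans[OF ennreal_leI ennreal_add_le])
  also have "\<dots> \<le> (\<integral>\<^sup>+y. ennreal (P y *\<^sub>R (norm (W (y, r)))\<^sup>2) \<partial>lborel) + (\<integral>\<^sup>+z. ennreal (2 * (c \<bullet> (K z *\<^sub>R F z))) \<partial>lborel)"
    by (intro add_mono ennreal_integral_le_nn_integral integrable_mult_right integrable_inner_right iPW2 iKF)
  also have "(\<integral>\<^sup>+y. ennreal (P y *\<^sub>R (norm (W (y, r)))\<^sup>2) \<partial>lborel) = (\<integral>\<^sup>+y. ennreal (P y) * ennreal ((norm (W (y, r)))\<^sup>2) \<partial>lborel)"
    by (simp add: ennreal_mult' P0)
  also have "(\<integral>\<^sup>+z. ennreal (2 * (c \<bullet> (K z *\<^sub>R F z))) \<partial>lborel) \<le>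
     (\<integral>\<^sup>+z. ennreal (K z) * ennreal ((norm (W z))\<^sup>2 * G z) + ennreal (K z) * ennreal (2 * M * norm (c - W z)) \<partial>lborel)"
  proof (rule nn_integral_mono_AE, use balance in eventually_elim)
    fix z :: "(real^'n) \<times> real"
    assume bal: "0 < snd z \<and> ereal (snd z) < T \<longrightarrow> 2 * (W z \<bullet> F z) \<le> (norm (W z))\<^sup>2 * G z"
    show "ennreal (2 * (c \<bullet> (K z *\<^sub>R F z))) \<le> ennreal (K z) * ennreal ((norm (W z))\<^sup>2 * G z) + ennreal (K z) * ennreal (2 * M * norm (c - W z))"
    proof (cases "r \<le> snd z \<and> snd z < t")
      case True
      then have "0 < snd z \<and> ereal (snd z) < T" using r by (metis less_ereal.simps(1) order_less_trans order_less_le_trans)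
      then have 1: "2 * (W z \<bullet> F z) \<le> (norm (W z))\<^sup>2 * G z" using bal by simp
      have "norm (F z) \<le> M" using F_le[of z] M[of "snd z" "fst z"] True by simp
      \<comment> \<open>The balance is known for W and F at the same point z, so c is replaced by W
        z; the price M |c - W z| is the third term of the claim.\<close>
      then have "(c - W z) \<bullet> F z \<le> norm (c - W z) * M"
        by (meson mult_left_mono norm_cauchy_schwarz norm_ge_zero order_trans)
      with 1 have "2 * (c \<bullet> F z) \<le> (norm (W z))\<^sup>2 * G z + 2 * M * norm (c - W z)"
        by (simp add: inner_diff_left mult.commute)
      then have "K z * (2 * (c \<bullet> F z)) \<le> K z * ((norm (W z))\<^sup>2 * G z + 2 * M * norm (c - W z))"
        by (rule mult_left_mono[OF _ K0])
      then have "ennreal (2 * (c \<bullet> (K z *\<^sub>R F z))) \<le> ennreal (K z * ((norm (W z))\<^sup>2 * G z) + K z * (2 * M * norm (c - W z)))"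
        by (intro ennreal_leI) (simp add: distrib_left mult_ac)
      then show ?thesis using K0[of z] M0 G_nonneg[of z] by (simp add: ennreal_mult')
    next
      case False
      then have "K z = 0" unfolding K_def by (auto simp: indicator_def duhamel_kernel_def)
      then show ?thesis by simp
    qed
  qed
  also have "\<dots> = (\<integral>\<^sup>+z. ennreal (K z) * ennreal ((norm (W z))\<^sup>2 * G z) \<partial>lborel) + (\<integral>\<^sup>+z. ennreal (K z) * ennreal (2 * M * norm (c - W z)) \<partial>lborel)"
    by (rule nn_integral_add) measurable
  finally show ?thesis unfolding c_def P_def K_def by (simp add: add.assoc add_left_mono)
qed

end

text \<open>The identity for two sphere-valued maps in the form in which the Kato argument uses it.
  Null sets are harmless, as it is only integrated against the kernel.\<close>

locale balanced_source = critical_source F G T k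
  for F :: "(real^'n) \<times> real \<Rightarrow> real^'m" and G T k +
  assumes balance: "AE z in lborel. 0 < snd z \<and> ereal (snd z) < T \<longrightarrow> 2 * (W z \<bullet> F z) \<le> (norm (W z))\<^sup>2 * G z"
begin

definition g :: "(real^'n) \<times> real \<Rightarrow> ennreal" where
  "g z = ennreal ((norm (W z))\<^sup>2)"

lemma g_measurable [measurable]: "g \<in> borel_measurable borel"
  unfolding g_def by measurable

text \<open>The error of \<open>norm_W_sq_step\<close> is integrated slice by slice: each slice is a
  kernel oscillation, and there are r' - r of them in measure. An error proportional to the step
  length is what survives summation over a mesh with arbitrarily many steps.\<close>

lemma g_step:
  assumes \<epsilon>: "0 < \<epsilon>" and t: "ereal t < T" and \<kappa>: "\<kappa> > 0"
  obtains h where "h > 0"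
    "\<And>r r' x. \<epsilon> \<le> r \<Longrightarrow> r < r' \<Longrightarrow> r' \<le> r + h \<Longrightarrow> r' \<le> t \<Longrightarrow>
      g (x, r') \<le> (\<integral>\<^sup>+y. ennreal (poisson_kernel (r' - r) (x - y)) * g (y, r) \<partial>lborel) +
       (\<integral>\<^sup>+z. ennreal (indicator {r..} (snd z) * duhamel_kernel r' x z) * (g z * ennreal (G z)) \<partial>lborel) +
       ennreal ((r' - r) * \<kappa>)"
proof -
  define M where "M = k / \<epsilon>"
  have M0: "M \<ge> 0" using \<epsilon> k_nonneg by (simp add: M_def)
  \<comment> \<open>The 7 is that of \<open>W_kernel_oscillation\<close>, and 2 M is the weight of
    the error in \<open>norm_W_sq_step\<close>; the added 1 covers M = 0.\<close>
  define \<kappa>' where "\<kappa>' = \<kappa> / (7 * (2 * M + 1))"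
  have \<kappa>': "\<kappa>' > 0" using \<kappa> M0 by (simp add: \<kappa>'_def)
  have "2 * M * (7 * \<kappa>') \<le> (2 * M + 1) * (7 * \<kappa>')" using \<kappa>' by (intro mult_right_mono) auto
  also have "\<dots> = \<kappa>" unfolding \<kappa>'_def using M0 by (simp add: field_simps)
  finally have M\<kappa>: "2 * M * (7 * \<kappa>') \<le> \<kappa>" .
  obtain h where h: "h > 0" and osc:
    "\<And>s \<tau> x. \<epsilon> \<le> s \<Longrightarrow> 0 < \<tau> \<Longrightarrow> \<tau> \<le> h \<Longrightarrow> s + \<tau> \<le> t \<Longrightarrow>
      (\<integral>\<^sup>+y. ennreal (poisson_kernel \<tau> (x - y) * norm (W (x, s + \<tau>) - W (y, s))) \<partial>lborel) \<le> ennreal (7 * \<kappa>')"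
    using W_kernel_oscillation[OF \<epsilon> t \<kappa>'] by blast
  have main: "g (x, r') \<le> (\<integral>\<^sup>+y. ennreal (poisson_kernel (r' - r) (x - y)) * g (y, r) \<partial>lborel) +
       (\<integral>\<^sup>+z. ennreal (indicator {r..} (snd z) * duhamel_kernel r' x z) * (g z * ennreal (G z)) \<partial>lborel) +
       ennreal ((r' - r) * \<kappa>)"
    if r: "\<epsilon> \<le> r" "r < r'" "r' \<le> r + h" "r' \<le> t" for r r' x
  proof -
    have r0: "0 < r" using r \<epsilon> by simp
    have rT: "ereal s < T" if "s \<le> r'" for s
    proof -
      have "ereal s \<le> ereal t" using that r by simp
      then show ?thesis using t by (rule order_le_less_trans)
    qed
    have M: "G (y, s) \<le> M" if "r \<le> s" "s < r'" for y s
      unfolding M_def using that r \<epsilon> rT[of s] by (intro G_bound) auto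
    have "(\<integral>\<^sup>+z. ennreal (indicator {r..} (snd z) * duhamel_kernel r' x z) * ennreal (2 * M * norm (W (x, r') - W z)) \<partial>lborel)
      = (\<integral>\<^sup>+s. (\<integral>\<^sup>+y. ennreal (indicator {r..} s * duhamel_kernel r' x (y, s)) * ennreal (2 * M * norm (W (x, r') - W (y, s))) \<partial>lborel) \<partial>lborel)"
      by (subst nn_integral_slices) auto
    also have "\<dots> \<le> (\<integral>\<^sup>+s. ennreal (2 * M) * ennreal (7 * \<kappa>') * indicator {r..<r'} s \<partial>lborel)"
    proof (rule nn_integral_mono)
      fix s :: real
      show "(\<integral>\<^sup>+y. ennreal (indicator {r..} s * duhamel_kernel r' x (y, s)) * ennreal (2 * M * norm (W (x, r') - W (y, s))) \<partial>lborel)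
         \<le> ennreal (2 * M) * ennreal (7 * \<kappa>') * indicator {r..<r'} s"
      proof (cases "s \<in> {r..<r'}")
        case True
        then have "(\<integral>\<^sup>+y. ennreal (indicator {r..} s * duhamel_kernel r' x (y, s)) * ennreal (2 * M * norm (W (x, r') - W (y, s))) \<partial>lborel)
          = (\<integral>\<^sup>+y. ennreal (2 * M) * ennreal (poisson_kernel (r' - s) (x - y) * norm (W (x, s + (r' - s)) - W (y, s))) \<partial>lborel)"
          using r0 M0 by (intro nn_integral_cong)
            (simp add: duhamel_kernel_def ennreal_mult'[symmetric] poisson_kernel_pos less_imp_le mult_ac)
        also have "\<dots> = ennreal (2 * M) * (\<integral>\<^sup>+y. ennreal (poisson_kernel (r' - s) (x - y) * norm (W (x, s + (r' - s)) - W (y, s))) \<partial>lborel)"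
          by (rule nn_integral_cmult) measurable
        also have "\<dots> \<le> ennreal (2 * M) * ennreal (7 * \<kappa>')"
          using True r by (intro mult_left_mono osc) auto
        finally show ?thesis using True by simp
      qed (auto simp: indicator_def duhamel_kernel_def)
    qed
    also have "\<dots> = ennreal (2 * M) * ennreal (7 * \<kappa>') * ennreal (r' - r)"
      using r by (simp add: nn_integral_cmult_indicator)
    also have "\<dots> \<le> ennreal ((r' - r) * \<kappa>)"
      using M\<kappa> M0 \<kappa>' r by (simp add: ennreal_mult'[symmetric] mult.commute[of "r' - r"] ennreal_leI mult_right_mono)
    finally have err: "(\<integral>\<^sup>+z. ennreal (indicator {r..} (snd z) * duhamel_kernel r' x z) * ennreal (2 * M * norm (W (x, r') - W z)) \<partial>lborel)
      \<le> ennreal ((r' - r) * \<kappa>)" .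
    have eqG: "ennreal ((norm (W z))\<^sup>2 * G z) = g z * ennreal (G z)" for z
      unfolding g_def by (simp add: ennreal_mult G_nonneg)
    show ?thesis
      using add_left_mono[OF err] norm_W_sq_step[OF r0 r(2) rT[OF order_refl] M balance, of x]
      unfolding eqG g_def[symmetric] by (meson order_trans)
  qed
  show ?thesis by (rule that[OF h main])
qed

end

section \<open>Telescoping, the limit at time 0, and absorption by the supremum\<close>

context balanced_source
begin

lemma g_finite_bound: "0 < t \<Longrightarrow> ereal t < T \<Longrightarrow> g (x, t) \<le> ennreal (B\<^sup>2)"
  unfolding g_def using W_bound[of t x] B_nonneg by (intro ennreal_leI power_mono) auto

text \<open>On a mesh finer than h the errors add up to (t - \<epsilon>) \<kappa>, which is below
  any prescribed e. Starting from a positive \<epsilon> gives one h for all steps, since the bound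
  k/\<epsilon> on G is available from there on.\<close>

lemma kato_from:
  assumes \<epsilon>: "0 < \<epsilon>" "\<epsilon> < t" and t: "ereal t < T"
  shows "g (x, t) \<le> (\<integral>\<^sup>+y. ennreal (poisson_kernel (t - \<epsilon>) (x - y)) * g (y, \<epsilon>) \<partial>lborel) +
    (\<integral>\<^sup>+z. ennreal (duhamel_kernel t x z) * (g z * ennreal (G z)) \<partial>lborel)"
proof (rule ennreal_le_epsilon)
  fix e :: real assume e: "e > 0"
  define \<kappa> where "\<kappa> = e / t"
  have t0: "t > 0" using \<epsilon> by simp
  have \<kappa>: "\<kappa> > 0" using e t0 by (simp add: \<kappa>_def)
  obtain h where h: "h > 0" and step: "\<And>r r' x. \<epsilon> \<le> r \<Longrightarrow> r < r' \<Longrightarrow> r' \<le> r + h \<Longrightarrow> r' \<le> t \<Longrightarrow>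
      g (x, r') \<le> (\<integral>\<^sup>+y. ennreal (poisson_kernel (r' - r) (x - y)) * g (y, r) \<partial>lborel) +
       (\<integral>\<^sup>+z. ennreal (indicator {r..} (snd z) * duhamel_kernel r' x z) * (g z * ennreal (G z)) \<partial>lborel) +
       ennreal ((r' - r) * \<kappa>)"
    using g_step[OF \<epsilon>(1) t \<kappa>] by blast
  obtain N where N: "(t - \<epsilon>) / h < real (Suc N)"
    using reals_Archimedean2[of "(t - \<epsilon>) / h"] by (meson less_trans lessI of_nat_less_iff)
  define d where "d = (t - \<epsilon>) / real (Suc N)"
  have d: "d > 0" unfolding d_def using \<epsilon> by simp
  have dh: "d \<le> h" unfolding d_def using N h by (simp add: field_simps)
  define r where "r j = \<epsilon> + real j * d" for j
  have rN: "r (Suc N) = t" unfolding r_def d_def by (simp add: field_simps)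
  have r\<epsilon>: "\<epsilon> \<le> r j" "0 < r j" for j unfolding r_def using d \<epsilon> by (auto intro!: add_pos_nonneg)
  have rmono: "r j < t" if "j \<le> N" for j
    unfolding rN[symmetric] r_def using that d by simp
  have rS: "r (Suc j) = r j + d" for j unfolding r_def by (simp add: algebra_simps)
  define f where "f z = g z * ennreal (G z)" for z
  have [measurable]: "f \<in> borel_measurable borel" unfolding f_def by measurable
  \<comment> \<open>\<open>a s\<close> is S(t-s)g(s) at x, and \<open>J s\<close> is the share of
    sources before s in the Duhamel integral. Along the mesh \<open>a\<close> grows by at most the
    growth of \<open>J\<close> plus d \<kappa> per step.\<close>
  define a where "a s = (\<integral>\<^sup>+y. ennreal (poisson_kernel (t - s) (x - y)) * g (y, s) \<partial>lborel)" for s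
  define J where "J s = (\<integral>\<^sup>+z. ennreal (indicator {..<s} (snd z) * duhamel_kernel t x z) * f z \<partial>lborel)" for s
  have claim: "a (r j) \<le> a \<epsilon> + J (r j) + ennreal (real j * d * \<kappa>)" if "j \<le> N" for j
    using that
  proof (induction j)
    case 0
    then show ?case by (simp add: r_def)
  next
    case (Suc j)
    let ?s = "r j" and ?s' = "r (Suc j)"
    have s: "0 < ?s" "?s < ?s'" "?s' < t" "?s' - ?s = d"
      using r\<epsilon> rS d rmono[OF Suc.prems] by auto
    define f' where "f' z = indicator {?s..} (snd z) * f z" for z :: "(real^'n) \<times> real"
    have [measurable]: "f' \<in> borel_measurable borel" unfolding f'_def by measurable
    have "a ?s' \<le> (\<integral>\<^sup>+y. ennreal (poisson_kernel (t - ?s') (x - y)) *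
        ((\<integral>\<^sup>+w. ennreal (poisson_kernel d (y - w)) * g (w, ?s) \<partial>lborel) +
         (\<integral>\<^sup>+z. ennreal (duhamel_kernel ?s' y z) * f' z \<partial>lborel) + ennreal (d * \<kappa>)) \<partial>lborel)"
      unfolding a_def
    proof (intro nn_integral_mono mult_left_mono)
      fix y
      have eq: "ennreal (indicator {?s..} (snd z) * duhamel_kernel ?s' y z) * (g z * ennreal (G z)) =
         ennreal (duhamel_kernel ?s' y z) * f' z" for z
        unfolding f'_def f_def by (simp add: indicator_def)
      show "g (y, ?s') \<le> (\<integral>\<^sup>+w. ennreal (poisson_kernel d (y - w)) * g (w, ?s) \<partial>lborel) +
         (\<integral>\<^sup>+z. ennreal (duhamel_kernel ?s' y z) * f' z \<partial>lborel) + ennreal (d * \<kappa>)"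
        using step[of ?s ?s' y] s r\<epsilon>[of j] dh unfolding eq by (simp add: rS)
    qed auto
    also have "\<dots> = (\<integral>\<^sup>+y. ennreal (poisson_kernel (t - ?s') (x - y)) * (\<integral>\<^sup>+w. ennreal (poisson_kernel d (y - w)) * g (w, ?s) \<partial>lborel) \<partial>lborel) +
         (\<integral>\<^sup>+y. ennreal (poisson_kernel (t - ?s') (x - y)) * (\<integral>\<^sup>+z. ennreal (duhamel_kernel ?s' y z) * f' z \<partial>lborel) \<partial>lborel) +
         (\<integral>\<^sup>+y. ennreal (poisson_kernel (t - ?s') (x - y)) * ennreal (d * \<kappa>) \<partial>lborel)"
      by (simp add: distrib_left nn_integral_add)
    also have "(\<integral>\<^sup>+y. ennreal (poisson_kernel (t - ?s') (x - y)) * (\<integral>\<^sup>+w. ennreal (poisson_kernel d (y - w)) * g (w, ?s) \<partial>lborel) \<partial>lborel) = a ?s"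
      using nn_integral_poisson_poisson[of "\<lambda>w. g (w, ?s)" "t - ?s'" d x] s d unfolding a_def rS by simp
    also have "(\<integral>\<^sup>+y. ennreal (poisson_kernel (t - ?s') (x - y)) * (\<integral>\<^sup>+z. ennreal (duhamel_kernel ?s' y z) * f' z \<partial>lborel) \<partial>lborel) =
       (\<integral>\<^sup>+z. ennreal (indicator {..<?s'} (snd z) * duhamel_kernel t x z) * f' z \<partial>lborel)"
      using s by (intro nn_integral_poisson_duhamel) auto
    also have "(\<integral>\<^sup>+y. ennreal (poisson_kernel (t - ?s') (x - y)) * ennreal (d * \<kappa>) \<partial>lborel) = ennreal (d * \<kappa>)"
      using s by (subst nn_integral_multc) (auto simp: nn_integral_poisson_kernel_shift)
    finally have "a ?s' \<le> a ?s + (\<integral>\<^sup>+z. ennreal (indicator {..<?s'} (snd z) * duhamel_kernel t x z) * f' z \<partial>lborel) + ennreal (d * \<kappa>)" .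
    also have "\<dots> \<le> (a \<epsilon> + J ?s + ennreal (real j * d * \<kappa>)) + (\<integral>\<^sup>+z. ennreal (indicator {..<?s'} (snd z) * duhamel_kernel t x z) * f' z \<partial>lborel) + ennreal (d * \<kappa>)"
      using Suc by (intro add_right_mono) auto
    also have "\<dots> = a \<epsilon> + (J ?s + (\<integral>\<^sup>+z. ennreal (indicator {..<?s'} (snd z) * duhamel_kernel t x z) * f' z \<partial>lborel)) + (ennreal (real j * d * \<kappa>) + ennreal (d * \<kappa>))"
      by (simp add: ac_simps)
    also have "J ?s + (\<integral>\<^sup>+z. ennreal (indicator {..<?s'} (snd z) * duhamel_kernel t x z) * f' z \<partial>lborel) = J ?s'"
      unfolding J_def f'_def using s
      by (subst nn_integral_add[symmetric]) (auto simp: indicator_def intro!: nn_integral_cong)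
    also have "ennreal (real j * d * \<kappa>) + ennreal (d * \<kappa>) = ennreal (real (Suc j) * d * \<kappa>)"
      using d \<kappa> by (simp add: ennreal_plus[symmetric] algebra_simps del: ennreal_plus)
    finally show ?case .
  qed
  \<comment> \<open>The last step lies outside the induction: \<open>a t\<close> should be g(x,t),
    but \<open>poisson_kernel 0\<close> is 0 by division by zero and not a point mass.\<close>
  have sN: "0 < r N" "r N < t" "t - r N = d" using r\<epsilon> rmono[of N] rS[of N] rN by auto
  have "g (x, t) \<le> a (r N) + (\<integral>\<^sup>+z. ennreal (indicator {r N..} (snd z) * duhamel_kernel t x z) * f z \<partial>lborel) + ennreal (d * \<kappa>)"
    using step[of "r N" t x] sN r\<epsilon>[of N] dh unfolding a_def f_def by simp
  also have "\<dots> \<le> (a \<epsilon> + J (r N) + ennreal (real N * d * \<kappa>)) + (\<integral>\<^sup>+z. ennreal (indicator {r N..} (snd z) * duhamel_kernel t x z) * f z \<partial>lborel) + ennreal (d * \<kappa>)"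
    using claim[of N] by (intro add_right_mono) auto
  also have "\<dots> = a \<epsilon> + (J (r N) + (\<integral>\<^sup>+z. ennreal (indicator {r N..} (snd z) * duhamel_kernel t x z) * f z \<partial>lborel)) + (ennreal (real N * d * \<kappa>) + ennreal (d * \<kappa>))"
    by (simp add: ac_simps)
  also have "J (r N) + (\<integral>\<^sup>+z. ennreal (indicator {r N..} (snd z) * duhamel_kernel t x z) * f z \<partial>lborel) = (\<integral>\<^sup>+z. ennreal (duhamel_kernel t x z) * f z \<partial>lborel)"
    unfolding J_def
    by (subst nn_integral_add[symmetric]) (auto simp: indicator_def intro!: nn_integral_cong)
  also have "ennreal (real N * d * \<kappa>) + ennreal (d * \<kappa>) = ennreal ((t - \<epsilon>) * \<kappa>)"
  proof -
    have "real N * d * \<kappa> + d * \<kappa> = (real (Suc N) * d) * \<kappa>" by (simp add: algebra_simps)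
    also have "real (Suc N) * d = t - \<epsilon>" unfolding d_def by simp
    finally show ?thesis using d \<kappa> by (simp add: ennreal_plus[symmetric] del: ennreal_plus)
  qed
  also have "ennreal ((t - \<epsilon>) * \<kappa>) \<le> ennreal e"
  proof (rule ennreal_leI)
    have "(t - \<epsilon>) * \<kappa> \<le> t * \<kappa>" using \<kappa> \<epsilon> by (intro mult_right_mono) auto
    also have "\<dots> = e" using t0 by (simp add: \<kappa>_def)
    finally show "(t - \<epsilon>) * \<kappa> \<le> e" .
  qed
  finally show "g (x, t) \<le> (\<integral>\<^sup>+y. ennreal (poisson_kernel (t - \<epsilon>) (x - y)) * g (y, \<epsilon>) \<partial>lborel) +
    (\<integral>\<^sup>+z. ennreal (duhamel_kernel t x z) * (g z * ennreal (G z)) \<partial>lborel) + ennreal e"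
    unfolding a_def f_def by (simp add: add_left_mono)
qed

text \<open>In |W(\<epsilon>)|^2 one factor is bounded by B and the other by the Duhamel integral of
  G, which the semigroup propagates to time t. The starting term of \<open>kato_from\<close> is thus
  at most B times the share of times before \<epsilon> in a finite integral, and dominated
  convergence sends it to 0.\<close>

lemma kato:
  assumes t: "0 < t" "ereal t < T"
  shows "g (x, t) \<le> (\<integral>\<^sup>+z. ennreal (duhamel_kernel t x z) * (g z * ennreal (G z)) \<partial>lborel)"
proof -
  define D where "D = (\<integral>\<^sup>+z. ennreal (duhamel_kernel t x z) * (g z * ennreal (G z)) \<partial>lborel)"
  \<comment> \<open>The shift by 2 keeps every member of the sequence strictly below t.\<close>
  define \<epsilon> where "\<epsilon> i = t / real (i + 2)" for i
  define E where "E i = (\<integral>\<^sup>+z. ennreal (indicator {..<\<epsilon> i} (snd z) * duhamel_kernel t x z) * ennreal (G z) \<partial>lborel)" for i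
  have \<epsilon>: "0 < \<epsilon> i" "\<epsilon> i < t" for i
  proof -
    show "0 < \<epsilon> i" unfolding \<epsilon>_def using t by simp
    have "t * 1 < t * real (i + 2)" using t by (intro mult_strict_left_mono) auto
    then show "\<epsilon> i < t" unfolding \<epsilon>_def by (simp add: divide_less_eq)
  qed
  have \<epsilon>T: "ereal (\<epsilon> i) < T" for i using \<epsilon>(2)[of i] t(2) by (metis less_ereal.simps(1) order_less_trans)
  have \<epsilon>_lim: "\<epsilon> \<longlonglongrightarrow> 0"
    unfolding \<epsilon>_def by (intro real_tendsto_divide_at_top[OF tendsto_const] filterlim_compose[OF filterlim_real_sequentially] filterlim_add_const_nat_at_top)
  have bound: "g (x, t) \<le> ennreal B * E i + D" for i
  proof -
    have "g (y, \<epsilon> i) \<le> ennreal B * (\<integral>\<^sup>+z. ennreal (duhamel_kernel (\<epsilon> i) y z) * ennreal (G z) \<partial>lborel)" for y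
    proof -
      have "g (y, \<epsilon> i) \<le> ennreal (B * norm (W (y, \<epsilon> i)))"
        unfolding g_def power2_eq_square using W_bound[OF \<epsilon>(1) \<epsilon>T] by (intro ennreal_leI mult_right_mono) auto
      also have "\<dots> = ennreal B * ennreal (norm (W (y, \<epsilon> i)))" using B_nonneg by (simp add: ennreal_mult)
      also have "\<dots> \<le> ennreal B * (\<integral>\<^sup>+z. ennreal (duhamel_kernel (\<epsilon> i) y z) * ennreal (G z) \<partial>lborel)"
        by (intro mult_left_mono W_le_nn_integral \<epsilon> \<epsilon>T) auto
      finally show ?thesis .
    qed
    then have "(\<integral>\<^sup>+y. ennreal (poisson_kernel (t - \<epsilon> i) (x - y)) * g (y, \<epsilon> i) \<partial>lborel) \<le>
      (\<integral>\<^sup>+y. ennreal B * (ennreal (poisson_kernel (t - \<epsilon> i) (x - y)) * (\<integral>\<^sup>+z. ennreal (duhamel_kernel (\<epsilon> i) y z) * ennreal (G z) \<partial>lborel)) \<partial>lborel)"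
      unfolding mult.left_commute[of "ennreal B"] by (intro nn_integral_mono mult_left_mono) auto
    also have "\<dots> = ennreal B * E i"
      unfolding E_def nn_integral_poisson_duhamel[OF _ \<epsilon>, of "\<lambda>z. ennreal (G z)", simplified, symmetric]
      by (rule nn_integral_cmult) measurable
    finally show ?thesis
      using kato_from[OF \<epsilon> t(2), of x i] unfolding D_def by (meson add_right_mono order_trans)
  qed
  have "E \<longlonglongrightarrow> (\<integral>\<^sup>+z. 0 \<partial>(lborel :: ((real^'n) \<times> real) measure))"
    unfolding E_def
  proof (rule nn_integral_dominated_convergence)
    show "(\<integral>\<^sup>+z. ennreal (duhamel_kernel t x z) * ennreal (G z) \<partial>lborel) < \<infinity>"
      using nn_integral_duhamel_G[OF t, of x] by (simp add: le_less_trans[OF _ ennreal_less_top])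
    show "AE z in lborel. ennreal (indicator {..<\<epsilon> i} (snd z) * duhamel_kernel t x z) * ennreal (G z) \<le>
       ennreal (duhamel_kernel t x z) * ennreal (G z)" for i
      by (intro AE_I2) (auto simp: indicator_def)
    show "AE z in lborel. (\<lambda>i. ennreal (indicator {..<\<epsilon> i} (snd z) * duhamel_kernel t x z) * ennreal (G z)) \<longlonglongrightarrow> 0"
    proof (intro AE_I2)
      fix z :: "(real^'n) \<times> real"
      have "eventually (\<lambda>i. ennreal (indicator {..<\<epsilon> i} (snd z) * duhamel_kernel t x z) * ennreal (G z) = 0) sequentially"
      proof (cases "snd z > 0")
        case True
        show ?thesis
          using order_tendstoD(2)[OF \<epsilon>_lim True] by eventually_elim (auto simp: indicator_def)
      qed (simp add: duhamel_kernel_def)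
      then show "(\<lambda>i. ennreal (indicator {..<\<epsilon> i} (snd z) * duhamel_kernel t x z) * ennreal (G z)) \<longlonglongrightarrow> 0"
        by (rule tendsto_eventually)
    qed
  qed measurable
  then have "E \<longlonglongrightarrow> 0" by simp
  then have "(\<lambda>i. ennreal B * E i + D) \<longlonglongrightarrow> ennreal B * 0 + D"
    by (intro tendsto_add tendsto_const ennreal_tendsto_cmult) auto
  then have "(\<lambda>i. ennreal B * E i + D) \<longlonglongrightarrow> D" by simp
  then show ?thesis unfolding D_def[symmetric] using bound by (intro LIMSEQ_le_const) auto
qed

text \<open>Let c be the supremum of g on times below t0. Kato's inequality and the hypothesis give
  c \<le> c/2. Restricting the hypothesis to the set where g is nonzero lets times at which g is
  already known to vanish drop out, as the continuation argument requires.\<close>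

lemma g_vanishes_if_half:
  assumes R: "ereal t0 \<le> T"
    and half: "\<And>x t. 0 < t \<Longrightarrow> t < t0 \<Longrightarrow>
      (\<integral>\<^sup>+z. ennreal (duhamel_kernel t x z) * (indicator {z. g z \<noteq> 0} z * ennreal (G z)) \<partial>lborel) \<le> ennreal (1/2)"
    and t: "0 < t" "t < t0"
  shows "g (x, t) = 0"
proof -
  define S where "S = {z :: (real^'n) \<times> real. 0 < snd z \<and> snd z < t0}"
  define c where "c = (SUP z\<in>S. g z)"
  have ST: "ereal (snd z) < T" if "z \<in> S" for z
  proof -
    have "ereal (snd z) < ereal t0" using that by (simp add: S_def)
    then show ?thesis using R by (rule order_less_le_trans)
  qed
  \<comment> \<open>Finiteness of c is what allows c \<le> c/2 to be resolved: \<open>top\<close>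
    would satisfy it too.\<close>
  have "c \<le> ennreal (B\<^sup>2)" unfolding c_def
  proof (rule SUP_least)
    fix z assume z: "z \<in> S"
    then show "g z \<le> ennreal (B\<^sup>2)" using g_finite_bound[of "snd z" "fst z"] ST[OF z] by (simp add: S_def)
  qed
  then have c_fin: "c < top" by (simp add: le_less_trans[OF _ ennreal_less_top])
  have "c \<le> c * ennreal (1/2)"
    unfolding c_def
  proof (rule SUP_least)
    fix z assume z: "z \<in> S"
    define x t where "x = fst z" and "t = snd z"
    have zt: "z = (x, t)" "0 < t" "t < t0" using z by (auto simp: x_def t_def S_def)
    have "g z \<le> (\<integral>\<^sup>+z. ennreal (duhamel_kernel t x z) * (g z * ennreal (G z)) \<partial>lborel)"
      unfolding zt(1) using zt ST[OF z] by (intro kato) (auto simp: t_def)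
    also have "\<dots> \<le> (\<integral>\<^sup>+z. c * (ennreal (duhamel_kernel t x z) * (indicator {z. g z \<noteq> 0} z * ennreal (G z))) \<partial>lborel)"
    proof (rule nn_integral_mono)
      fix w :: "(real^'n) \<times> real"
      show "ennreal (duhamel_kernel t x w) * (g w * ennreal (G w)) \<le> c * (ennreal (duhamel_kernel t x w) * (indicator {z. g z \<noteq> 0} w * ennreal (G w)))"
      proof (cases "0 < snd w \<and> snd w < t")
        case True
        then have "w \<in> S" using zt by (simp add: S_def)
        then have "g w \<le> c" unfolding c_def by (rule SUP_upper)
        then have "g w \<le> c * indicator {z. g z \<noteq> 0} w" by (auto simp: indicator_def)
        then have "ennreal (duhamel_kernel t x w) * ennreal (G w) * g w \<le> ennreal (duhamel_kernel t x w) * ennreal (G w) * (c * indicator {z. g z \<noteq> 0} w)"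
          by (rule mult_left_mono) simp
        then show ?thesis by (simp add: mult_ac)
      qed (auto simp: duhamel_kernel_def)
    qed
    also have "\<dots> = c * (\<integral>\<^sup>+z. ennreal (duhamel_kernel t x z) * (indicator {z. g z \<noteq> 0} z * ennreal (G z)) \<partial>lborel)"
      by (rule nn_integral_cmult) measurable
    also have "\<dots> \<le> c * ennreal (1/2)"
      by (intro mult_left_mono half zt) auto
    finally show "g z \<le> (SUP z\<in>S. g z) * ennreal (1/2)" unfolding c_def .
  qed
  moreover define r where "r = enn2real c"
  then have r: "c = ennreal r" "0 \<le> r" using c_fin by (simp_all add: ennreal_enn2real)
  moreover have eq: "ennreal (r * (1/2)) = ennreal r * ennreal (1/2)" using r(2) by (rule ennreal_mult) simp
  ultimately have "ennreal r \<le> ennreal (r * (1/2))" by metis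
  moreover have "0 \<le> r * (1/2)" using r(2) by simp
  ultimately have "r \<le> r * (1/2)" by (metis ennreal_le_iff)
  then have "r = 0" using r(2) by linarith
  then have "c = 0" using r(1) by simp
  moreover have "g (x, t) \<le> c" unfolding c_def using t by (intro SUP_upper) (simp add: S_def)
  ultimately show ?thesis by simp
qed

section \<open>Vanishing near time 0 and continuation up to T\<close>

lemma nn_integral_indicator_G_le:
  "(\<integral>\<^sup>+z. ennreal (duhamel_kernel t x z) * (indicator {z. g z \<noteq> 0} z * ennreal (G z)) \<partial>lborel) \<le>
   (\<integral>\<^sup>+z. ennreal (duhamel_kernel t x z) * ennreal (G z) \<partial>lborel)"
  by (intro nn_integral_mono mult_left_mono) (auto simp: indicator_def)

text \<open>Here \<kappa> is a second, small constant for times below t0, separate from the constant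
  k of the locale. Through \<open>duhamel_bound\<close> it makes the Duhamel integral of G at most
  1/2.\<close>

lemma g_vanishes_initially:
  assumes R: "ereal t0 \<le> T" and \<kappa>: "\<kappa> \<ge> 0" "duhamel_const CARD('n) * \<kappa> \<le> 1/2"
    and pw: "AE z in lborel. 0 < snd z \<and> snd z < t0 \<longrightarrow> snd z * G z \<le> \<kappa>"
    and carleson: "\<And>x r. 0 < r \<Longrightarrow> r < t0 \<Longrightarrow>
      (\<integral>\<^sup>+z. ennreal (G z) * indicator (ball x r \<times> {0<..<r}) z \<partial>lborel) \<le> ennreal (\<kappa> * r ^ CARD('n))"
    and t: "0 < t" "t < t0"
  shows "g (x, t) = 0"
proof (rule g_vanishes_if_half[OF R _ t])
  fix x t assume t: "0 < t" "t < t0"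
  have "(\<integral>\<^sup>+z. ennreal (duhamel_kernel t x z) * ennreal (G z) \<partial>lborel) \<le> ennreal (duhamel_const CARD('n) * \<kappa>)"
  proof (rule duhamel_bound)
    show "AE z in lborel. 0 < snd z \<and> snd z < t \<longrightarrow> snd z * G z \<le> \<kappa>"
      using pw by eventually_elim (use t in auto)
  qed (use t \<kappa> carleson[of "t/2"] in auto)
  also have "\<dots> \<le> ennreal (1/2)" using \<kappa> by (intro ennreal_leI)
  finally show "(\<integral>\<^sup>+z. ennreal (duhamel_kernel t x z) * (indicator {z. g z \<noteq> 0} z * ennreal (G z)) \<partial>lborel) \<le> ennreal (1/2)"
    by (rule order_trans[OF nn_integral_indicator_G_le])
qed

text \<open>From time t0 on G \<le> M = k/t0, so a window of length l with M l \<le> 1/2 contributes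
  at most 1/2 to the Duhamel integral. M bounds G on all later times, so l does not shrink and
  finitely many steps reach any t < T.\<close>

lemma g_vanishes_extend:
  assumes t0: "0 < t0" and init: "\<And>x t. 0 < t \<Longrightarrow> t < t0 \<Longrightarrow> ereal t < T \<Longrightarrow> g (x, t) = 0"
    and t: "0 < t" "ereal t < T"
  shows "g (x, t) = 0"
proof -
  define M where "M = k / t0"
  define l where "l = 1 / (2 * (M + 1))"
  have M: "M \<ge> 0" using t0 k_nonneg by (simp add: M_def)
  have l: "l > 0" using M by (simp add: l_def)
  have Ml: "M * l \<le> 1 / 2" unfolding l_def using M by (simp add: field_simps)
  have "\<forall>x t. 0 < t \<longrightarrow> t < t0 + real j * l \<longrightarrow> ereal t < T \<longrightarrow> g (x, t) = 0" for j
  proof (induction j)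
    case 0
    then show ?case using init by auto
  next
    case (Suc j)
    show ?case
    proof (intro allI impI)
      fix x :: "real^'n" and t assume t: "0 < t" "t < t0 + real (Suc j) * l" "ereal t < T"
      define a where "a = t0 + real j * l"
      have a: "a \<ge> t0" "a > 0" using t0 l by (auto simp: a_def intro!: add_pos_nonneg)
      \<comment> \<open>T may be infinite; a real t' beyond t, still below T and below the next
        endpoint, gives the finite window for \<open>g_vanishes_if_half\<close>.\<close>
      obtain t' where t': "t < t'" "t' < t0 + real (Suc j) * l" "ereal t' < T"
      proof -
        obtain q where q: "ereal t < ereal q" "ereal q < min T (ereal (t0 + real (Suc j) * l))"
          using ereal_dense2[of "ereal t" "min T (ereal (t0 + real (Suc j) * l))"] t by auto
        then show ?thesis by (intro that[of q]) auto
      qed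
      show "g (x, t) = 0"
      proof (rule g_vanishes_if_half[OF less_imp_le[OF t'(3)] _ t(1) t'(1)])
        fix x :: "real^'n" and s assume s: "0 < s" "s < t'"
        have sT: "ereal \<sigma> < T" if "\<sigma> \<le> s" for \<sigma>
          using that s t'(3) by (metis ereal_less_eq(3) le_less_trans less_le_trans less_imp_le)
        have "(\<integral>\<^sup>+z. ennreal (duhamel_kernel s x z) * (indicator {z. g z \<noteq> 0} z * ennreal (G z)) \<partial>lborel) \<le>
          (\<integral>\<^sup>+z. ennreal M * ennreal (duhamel_kernel s x z * indicator {a..} (snd z)) \<partial>lborel)"
        proof (rule nn_integral_mono)
          fix z :: "(real^'n) \<times> real"
          show "ennreal (duhamel_kernel s x z) * (indicator {z. g z \<noteq> 0} z * ennreal (G z)) \<le>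
            ennreal M * ennreal (duhamel_kernel s x z * indicator {a..} (snd z))"
          proof (cases "0 < snd z \<and> snd z < s")
            case z: True
            show ?thesis
            proof (cases "snd z < a")
              case True
              then have "g (fst z, snd z) = 0" using z sT[of "snd z"] unfolding a_def by (intro Suc[rule_format]) auto
              then show ?thesis by simp
            next
              case False
              have "G (fst z, snd z) \<le> M" unfolding M_def using False z a t0 sT[of "snd z"] by (intro G_bound) auto
              then have "ennreal (G z) \<le> ennreal M" by (simp add: ennreal_leI)
              then have "ennreal (duhamel_kernel s x z) * (indicator {z. g z \<noteq> 0} z * ennreal (G z)) \<le> ennreal (duhamel_kernel s x z) * (1 * ennreal M)"
                by (intro mult_left_mono mult_mono) (auto simp: indicator_def)
              then show ?thesis using False by (simp add: mult.commute)
            qed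
          qed (auto simp: duhamel_kernel_def)
        qed
        also have "\<dots> = ennreal M * (\<integral>\<^sup>+z. ennreal (duhamel_kernel s x z * indicator {a..} (snd z)) \<partial>lborel)"
          by (rule nn_integral_cmult) measurable
        also have "(\<integral>\<^sup>+z. ennreal (duhamel_kernel s x z * indicator {a..} (snd z)) \<partial>lborel) \<le> ennreal l"
        proof (cases "a \<le> s")
          case True
          then have "(\<integral>\<^sup>+z. ennreal (duhamel_kernel s x z * indicator {a..} (snd z)) \<partial>lborel) = ennreal (s - a)"
            using a by (intro nn_integral_duhamel_kernel_window) auto
          also have "\<dots> \<le> ennreal l" using s t' unfolding a_def by (intro ennreal_leI) (simp add: algebra_simps)
          finally show ?thesis .
        next
          case False
          then have "duhamel_kernel s x z * indicator {a..} (snd z) = 0" for z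
            by (auto simp: duhamel_kernel_def indicator_def)
          then have "(\<integral>\<^sup>+z. ennreal (duhamel_kernel s x z * indicator {a..} (snd z)) \<partial>lborel) = (\<integral>\<^sup>+z. 0 \<partial>(lborel :: ((real^'n) \<times> real) measure))"
            by (intro nn_integral_cong) (simp only: ennreal_0)
          then show ?thesis by simp
        qed
        also have "ennreal M * ennreal l = ennreal (M * l)" using M by (simp add: ennreal_mult')
        also have "\<dots> \<le> ennreal (1/2)" using Ml by (rule ennreal_leI)
        finally show "(\<integral>\<^sup>+z. ennreal (duhamel_kernel s x z) * (indicator {z. g z \<noteq> 0} z * ennreal (G z)) \<partial>lborel) \<le> ennreal (1/2)"
          by (simp add: mult_left_mono)
      qed
    qed
  qed
  moreover obtain j where "t / l < real j" using reals_Archimedean2 by blast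
  then have "t < t0 + real j * l" using l t0 by (simp add: field_simps)
  ultimately show ?thesis using t by blast
qed

end

section \<open>Borel representatives and the solution space\<close>

lemma slab_measurable [measurable]: "(slab R :: ((real^'n) \<times> real) set) \<in> sets borel"
proof -
  have "(slab R :: ((real^'n) \<times> real) set) = {z. 0 < snd z \<and> ereal (snd z) < R}"
    by (auto simp: slab_def)
  also have "\<dots> \<in> sets borel" by measurable
  finally show ?thesis .
qed

lemma AE_lebesgue_on_iff:
  assumes "S \<in> sets borel"
  shows "(AE z in lebesgue_on S. P z) \<longleftrightarrow> (AE z in lborel. z \<in> S \<longrightarrow> P z)"
  using assms by (subst AE_restrict_space_iff) (auto simp: AE_completion_iff)

lemma AE_slices:
  fixes P :: "'a::euclidean_space \<times> real \<Rightarrow> bool"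
  assumes "AE z in lborel. P z"
  shows "AE s in lborel. AE y in lborel. P (y, s)"
proof -
  obtain N where N: "N \<in> sets (lborel :: ('a \<times> real) measure)" "emeasure lborel N = 0" "{z. \<not> P z} \<subseteq> N"
    using assms by (auto elim: AE_E)
  have [measurable]: "N \<in> sets borel" using N(1) by simp
  have "(\<integral>\<^sup>+s. (\<integral>\<^sup>+y. indicator N (y, s) \<partial>lborel) \<partial>(lborel :: real measure)) = 0"
    using N by (subst nn_integral_slices[symmetric]) auto
  then have "AE s in (lborel :: real measure). (\<integral>\<^sup>+y. indicator N (y :: 'a, s) \<partial>lborel) = (0 :: ennreal)"
    by (subst (asm) nn_integral_0_iff_AE) auto
  then show ?thesis
  proof eventually_elim
    case (elim s)
    then have "AE y in (lborel :: 'a measure). indicator N (y, s) = (0 :: ennreal)"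
      by (subst (asm) nn_integral_0_iff_AE) auto
    then show ?case by eventually_elim (use N(3) in \<open>auto simp: indicator_def split: if_splits\<close>)
  qed
qed

lemma borel_version_vector:
  fixes f :: "'a \<Rightarrow> 'b::euclidean_space"
  assumes f: "f \<in> borel_measurable (completion M)"
  obtains f' where "f' \<in> borel_measurable M" "AE x in M. f x = f' x"
proof -
  have "\<exists>h. h \<in> borel_measurable M \<and> (AE x in M. f x \<bullet> b = h x)" for b
  proof -
    have "(\<lambda>x. f x \<bullet> b) \<in> borel_measurable (completion M)"
      by (intro borel_measurable_inner f borel_measurable_const)
    then show ?thesis using completion_ex_borel_measurable_real by blast
  qed
  then obtain h where h: "\<And>b. h b \<in> borel_measurable M" "\<And>b. AE x in M. f x \<bullet> b = h b x"
    by metis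
  have "AE x in M. \<forall>b\<in>Basis. f x \<bullet> b = h b x"
    using h(2) by (intro AE_finite_allI) auto
  then have "AE x in M. f x = (\<Sum>b\<in>Basis. h b x *\<^sub>R b)"
  proof eventually_elim
    case (elim x)
    have "f x = (\<Sum>b\<in>Basis. (f x \<bullet> b) *\<^sub>R b)" by (rule euclidean_representation[symmetric])
    also have "\<dots> = (\<Sum>b\<in>Basis. h b x *\<^sub>R b)" using elim by (intro sum.cong) auto
    finally show ?case .
  qed
  moreover have "(\<lambda>x. \<Sum>b\<in>Basis. h b x *\<^sub>R b) \<in> borel_measurable M"
    using h(1) by (intro borel_measurable_sum borel_measurable_scaleR) auto
  ultimately show ?thesis by (rule that[rotated])
qed

text \<open>By completeness, agreeing almost everywhere with a Borel function already implies
  Lebesgue measurability. Integrands taken from the definitions therefore carry no measurability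
  hypothesis of their own.\<close>

lemma borel_measurable_lebesgue_AE:
  fixes f f' :: "'a::euclidean_space \<Rightarrow> 'b::topological_space"
  assumes f': "f' \<in> borel_measurable borel" and ae: "AE x in lborel. f x = f' x"
  shows "f \<in> borel_measurable lebesgue"
proof (rule measurableI)
  fix A :: "'b set" assume A: "A \<in> sets borel"
  show "f -` A \<inter> space lebesgue \<in> sets lebesgue"
  proof (rule completion.in_sets_AE)
    show "f' -` A \<inter> space lebesgue \<in> sets lebesgue"
      using measurable_sets[OF measurable_completion[of f' lborel borel] A] f' by simp
    show "AE x in lebesgue. (x \<in> f' -` A \<inter> space lebesgue) = (x \<in> f -` A \<inter> space lebesgue)"
      unfolding AE_completion_iff using ae by eventually_elim simp
  qed simp
qed simp

lemma integral_lebesgue_AE: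
  fixes f f' :: "'a::euclidean_space \<Rightarrow> 'b::euclidean_space"
  assumes f': "f' \<in> borel_measurable borel" and ae: "AE x in lborel. f x = f' x"
  shows "(LINT x|lebesgue. f x) = (LINT x|lborel. f' x)"
proof -
  have "(LINT x|lebesgue. f x) = (LINT x|lebesgue. f' x)"
    using f' by (intro integral_cong_AE borel_measurable_lebesgue_AE[OF f' ae] measurable_completion)
      (auto simp: AE_completion_iff ae)
  also have "\<dots> = (LINT x|lborel. f' x)" using f' by (intro integral_completion) simp
  finally show ?thesis .
qed

lemma ennreal_sqrt_power2: "(ennreal_sqrt x)\<^sup>2 = x"
proof (cases "x = top")
  case False
  then have "(ennreal_sqrt x)\<^sup>2 = ennreal ((sqrt (enn2real x))\<^sup>2)"
    by (simp add: ennreal_sqrt_def ennreal_power)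
  also have "\<dots> = x" using False by (simp add: top.not_eq_extremum ennreal_enn2real)
  finally show ?thesis .
qed (simp add: ennreal_sqrt_def power2_eq_square)

text \<open>\<open>esssup\<close> is \<open>top\<close> for functions that are not measurable, so a
  finite seminorm itself yields the measurability of the half gradient. The modulus is recovered
  from the first integrand by multiplying with t^(-1/2) and squaring.\<close>

lemma X_part_0_bounds:
  fixes u :: "(real^'n) \<times> real \<Rightarrow> 'b::euclidean_space"
  assumes c: "c \<ge> 0" and X: "X_part 0 R u \<le> ennreal c"
  defines "E \<equiv> \<lambda>z. od_sq (\<lambda>y. u (y, snd z)) (fst z)"
  shows "E \<in> borel_measurable (lebesgue_on (slab R))"
    and "AE z in lborel. z \<in> slab R \<longrightarrow> ennreal (snd z) * E z \<le> ennreal (c\<^sup>2)"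
    and "AE z in lborel. z \<in> slab R \<longrightarrow>
      (\<integral>\<^sup>+s\<in>{0<..<snd z}. ball_average (fst z) (snd z) (\<lambda>y. E (y, s)) \<partial>lebesgue) \<le> ennreal (c\<^sup>2)"
proof -
  let ?L = "lebesgue_on (slab R :: ((real^'n) \<times> real) set)"
  define p where "p z = ennreal (snd z powr (1/2)) * ennreal_sqrt (E z)" for z :: "(real^'n) \<times> real"
  define q where "q z = ennreal_sqrt (\<integral>\<^sup>+s\<in>{0<..<snd z}. ball_average (fst z) (snd z) (\<lambda>y. E (y, s)) \<partial>lebesgue)"
    for z :: "(real^'n) \<times> real"
  have eq: "X_part 0 R u = esssup ?L p + esssup ?L q"
    unfolding X_part_def p_def q_def E_def od_def by (simp add: case_prod_beta')
  have pc: "esssup ?L p \<le> ennreal c" and qc: "esssup ?L q \<le> ennreal c"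
    by (rule order_trans[OF _ X], simp add: eq)+
  have pm: "p \<in> borel_measurable ?L"
  proof (rule ccontr)
    assume "p \<notin> borel_measurable ?L"
    then have "esssup ?L p = top" by (rule esssup_non_measurable)
    then show False using pc by (simp add: top_unique)
  qed
  have snd_m [measurable]: "snd \<in> borel_measurable ?L"
    by (rule measurable_restrict_space1) (simp add: measurable_completion)
  have "(\<lambda>z. (ennreal (snd z powr (- 1/2)) * p z)\<^sup>2) \<in> borel_measurable ?L"
    using pm by measurable
  moreover have E_eq: "E z = (ennreal (snd z powr (- 1/2)) * p z)\<^sup>2" if "z \<in> space ?L" for z
  proof -
    have "snd z > 0" using that by (auto simp: slab_def)
    then have "ennreal (snd z powr (- 1/2)) * ennreal (snd z powr (1/2)) = 1"
      by (simp add: ennreal_mult'[symmetric] powr_add[symmetric])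
    then show ?thesis unfolding p_def by (simp add: mult.assoc[symmetric] ennreal_sqrt_power2)
  qed
  moreover have "E \<in> borel_measurable ?L \<longleftrightarrow> (\<lambda>z. (ennreal (snd z powr (- 1/2)) * p z)\<^sup>2) \<in> borel_measurable ?L"
    by (rule measurable_cong) (rule E_eq)
  ultimately show "E \<in> borel_measurable ?L" by simp
  have sq: "x\<^sup>2 \<le> ennreal (c\<^sup>2)" if "x \<le> ennreal c" for x :: ennreal
    using power_mono[OF that, of 2] c by (simp add: ennreal_power)
  have "AE z in ?L. p z \<le> ennreal c"
    using esssup_AE[where M = ?L and f = p] by eventually_elim (use pc in auto)
  then have "AE z in lborel. z \<in> slab R \<longrightarrow> p z \<le> ennreal c"
    by (subst (asm) AE_lebesgue_on_iff) auto
  then show "AE z in lborel. z \<in> slab R \<longrightarrow> ennreal (snd z) * E z \<le> ennreal (c\<^sup>2)"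
  proof (eventually_elim, intro impI)
    fix z :: "(real^'n) \<times> real" assume z: "z \<in> slab R \<longrightarrow> p z \<le> ennreal c" "z \<in> slab R"
    have "snd z > 0" using z(2) by (auto simp: slab_def)
    then have "(p z)\<^sup>2 = ennreal (snd z) * E z"
      unfolding p_def power_mult_distrib ennreal_sqrt_power2 by (simp add: ennreal_power powr_half_sqrt)
    then show "ennreal (snd z) * E z \<le> ennreal (c\<^sup>2)" using sq[of "p z"] z by simp
  qed
  have "AE z in ?L. q z \<le> ennreal c"
    using esssup_AE[where M = ?L and f = q] by eventually_elim (use qc in auto)
  then have "AE z in lborel. z \<in> slab R \<longrightarrow> q z \<le> ennreal c"
    by (subst (asm) AE_lebesgue_on_iff) auto
  then show "AE z in lborel. z \<in> slab R \<longrightarrow>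
      (\<integral>\<^sup>+s\<in>{0<..<snd z}. ball_average (fst z) (snd z) (\<lambda>y. E (y, s)) \<partial>lebesgue) \<le> ennreal (c\<^sup>2)"
  proof (eventually_elim, intro impI)
    fix z :: "(real^'n) \<times> real" assume z: "z \<in> slab R \<longrightarrow> q z \<le> ennreal c" "z \<in> slab R"
    then show "(\<integral>\<^sup>+s\<in>{0<..<snd z}. ball_average (fst z) (snd z) (\<lambda>y. E (y, s)) \<partial>lebesgue) \<le> ennreal (c\<^sup>2)"
      using sq[of "q z"] by (simp add: q_def ennreal_sqrt_power2)
  qed
qed

text \<open>The volume of a ball of radius at most 2r is at most \<open>unit_ball_vol\<close> times
  2^n r^n. The summand 1 makes the constant at least 1, so that its product with c^2 also dominates
  the pointwise bound.\<close>

definition carleson_const :: "nat \<Rightarrow> real" where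
  "carleson_const n = 1 + unit_ball_vol (real n) * 2 ^ n"

lemma carleson_const_ge_1: "carleson_const n \<ge> 1"
  unfolding carleson_const_def by simp

text \<open>The bound on balls in \<open>X_part\<close> holds for almost all centres and radii only; every
  cylinder is contained in a good one of at most twice the radius.\<close>
lemma X_part_0_carleson:
  fixes u :: "(real^'n) \<times> real \<Rightarrow> 'b::euclidean_space" and G :: "(real^'n) \<times> real \<Rightarrow> real"
  assumes c: "c \<ge> 0" and X: "X_part 0 R u \<le> ennreal c"
    and [measurable]: "G \<in> borel_measurable borel"
    and G: "AE z in lborel. z \<in> slab R \<longrightarrow> ennreal (G z) = od_sq (\<lambda>y. u (y, snd z)) (fst z)"
    and r: "0 < r" "ereal r < R"
  shows "(\<integral>\<^sup>+z. ennreal (G z) * indicator (ball x r \<times> {0<..<r}) z \<partial>lborel) \<le>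
    ennreal (carleson_const CARD('n) * c\<^sup>2 * r ^ CARD('n))"
proof -
  define E where "E z = od_sq (\<lambda>y. u (y, snd z)) (fst z)" for z :: "(real^'n) \<times> real"
  define \<omega> where "\<omega> = unit_ball_vol (real CARD('n))"
  have \<omega>: "\<omega> > 0" by (simp add: \<omega>_def)
  \<comment> \<open>Radii between r and q are admissible for the slab and at most double r.\<close>
  obtain q where q: "r < q" "ereal q < R" "q < 2 * r"
  proof -
    obtain q where "ereal r < ereal q" "ereal q < min R (ereal (2 * r))"
      using ereal_dense2[of "ereal r" "min R (ereal (2 * r))"] r by auto
    then show ?thesis by (intro that[of q]) auto
  qed
  \<comment> \<open>Centres and radii whose ball contains \<open>ball x r\<close>, with radius in
    (r,q). The set is open and nonempty, hence not null, and so it contains a pair at which the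
    almost-everywhere bound holds.\<close>
  define Z where "Z = {z :: (real^'n) \<times> real. r < snd z \<and> snd z < q \<and> dist x (fst z) < snd z - r}"
  have "open Z"
    unfolding Z_def by (intro open_Collect_conj open_Collect_less continuous_intros)
  moreover have "(x, (r + q) / 2) \<in> Z" unfolding Z_def using q by simp
  ultimately have Z: "\<not> (AE z in lborel. z \<notin> Z)"
  proof -
    assume Z: "open Z" "(x, (r + q) / 2) \<in> Z"
    then obtain e where e: "e > 0" "ball (x, (r + q) / 2) e \<subseteq> Z" by (meson open_contains_ball)
    show ?thesis
    proof
      assume "AE z in lborel. z \<notin> Z"
      then have "AE z in lborel. z \<notin> ball (x, (r + q) / 2) e"
        by eventually_elim (use e in auto)
      then have "emeasure lborel (ball (x, (r + q) / 2) e) = 0"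
        by (subst (asm) AE_iff_measurable[OF _ refl]) (auto simp: ball_def)
      moreover have "unit_ball_vol (1 + real CARD('n)) * (e * e ^ CARD('n)) > 0"
        using e by (intro mult_pos_pos) auto
      ultimately show False using e by (simp add: emeasure_ball ennreal_eq_0_iff)
    qed
  qed
  have good: "AE z in lborel. z \<in> slab R \<longrightarrow>
      (\<integral>\<^sup>+s\<in>{0<..<snd z}. ball_average (fst z) (snd z) (\<lambda>y. E (y, s)) \<partial>lebesgue) \<le> ennreal (c\<^sup>2)"
    unfolding E_def by (rule X_part_0_bounds(3)[OF c X])
  have "\<exists>z\<in>Z. (\<integral>\<^sup>+s\<in>{0<..<snd z}. ball_average (fst z) (snd z) (\<lambda>y. E (y, s)) \<partial>lebesgue) \<le> ennreal (c\<^sup>2)"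
  proof (rule ccontr)
    assume no: "\<not> ?thesis"
    have "AE z in lborel. z \<notin> Z"
      using good
    proof (eventually_elim, intro notI)
      fix z assume z: "z \<in> slab R \<longrightarrow> (\<integral>\<^sup>+s\<in>{0<..<snd z}. ball_average (fst z) (snd z) (\<lambda>y. E (y, s)) \<partial>lebesgue) \<le> ennreal (c\<^sup>2)" "z \<in> Z"
      have "ereal (snd z) < ereal q" using z(2) by (simp add: Z_def)
      then have "ereal (snd z) < R" using q(2) by (rule order_less_trans)
      then have "z \<in> slab R" using z(2) r by (cases z) (auto simp: slab_def Z_def)
      then show False using no z by blast
    qed
    then show False using Z by simp
  qed
  then obtain z where z: "z \<in> Z" "(\<integral>\<^sup>+s\<in>{0<..<snd z}. ball_average (fst z) (snd z) (\<lambda>y. E (y, s)) \<partial>lebesgue) \<le> ennreal (c\<^sup>2)"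
    by blast
  define x' t' where "x' = fst z" and "t' = snd z"
  have t': "r < t'" "t' < q" "t' < 2 * r" "dist x x' < t' - r"
    using z(1) q unfolding Z_def x'_def t'_def by simp_all
  have "ereal t' < ereal q" using t'(2) by simp
  then have t'R: "ereal t' < R" using q(2) by (rule order_less_trans)
  have t'0: "t' > 0" using t' r by simp
  define b where "b = \<omega> * t' ^ CARD('n)"
  have b: "b > 0" using \<omega> t'0 by (simp add: b_def)
  define A where "A s = (\<integral>\<^sup>+y. ennreal (G (y, s)) * indicator (ball x' t') y \<partial>lborel)" for s
  have [measurable]: "ball x' t' \<in> sets borel" "ball x r \<in> sets borel" by auto
  have [measurable]: "A \<in> borel_measurable borel" unfolding A_def by measurable
  \<comment> \<open>On almost every time slice the modulus E agrees almost everywhere with the Borel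
    function G, so the averages can be computed from G.\<close>
  have eqs: "AE s in lborel. 0 < s \<and> s < t' \<longrightarrow> ball_average x' t' (\<lambda>y. E (y, s)) = A s / ennreal b"
    using AE_slices[OF G]
  proof eventually_elim
    case s: (elim s)
    show ?case
    proof
      assume st: "0 < s \<and> s < t'"
      have "ereal s < ereal t'" using st by simp
      then have "ereal s < R" using t'R by (rule order_less_trans)
      then have slab: "(y, s) \<in> slab R" for y :: "real^'n" using st by (simp add: slab_def)
      have "AE y in lborel. E (y, s) * indicator (ball x' t') y = ennreal (G (y, s)) * indicator (ball x' t') y"
        using s by eventually_elim (use slab in \<open>simp add: E_def\<close>)
      then have "(\<integral>\<^sup>+y. E (y, s) * indicator (ball x' t') y \<partial>lborel) = A s"
        unfolding A_def by (rule nn_integral_cong_AE)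
      then show "ball_average x' t' (\<lambda>y. E (y, s)) = A s / ennreal b"
        unfolding ball_average_def nn_integral_completion using t'0
        by (simp add: emeasure_ball b_def \<omega>_def)
    qed
  qed
  have "(\<integral>\<^sup>+s. A s * indicator {0<..<t'} s \<partial>lborel) / ennreal b = (\<integral>\<^sup>+s. A s * indicator {0<..<t'} s / ennreal b \<partial>lborel)"
    by (rule nn_integral_divide[symmetric]) measurable
  also have "\<dots> = (\<integral>\<^sup>+s. ball_average x' t' (\<lambda>y. E (y, s)) * indicator {0<..<t'} s \<partial>lborel)"
  proof (rule nn_integral_cong_AE, use eqs in eventually_elim)
    fix s
    assume "0 < s \<and> s < t' \<longrightarrow> ball_average x' t' (\<lambda>y. E (y, s)) = A s / ennreal b"
    then show "A s * indicator {0<..<t'} s / ennreal b = ball_average x' t' (\<lambda>y. E (y, s)) * indicator {0<..<t'} s"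
      by (cases "s \<in> {0<..<t'}") simp_all
  qed
  also have "\<dots> \<le> ennreal (c\<^sup>2)"
    using z(2) unfolding nn_integral_completion x'_def t'_def .
  finally have "(\<integral>\<^sup>+s. A s * indicator {0<..<t'} s \<partial>lborel) / ennreal b * ennreal b \<le> ennreal (c\<^sup>2) * ennreal b"
    by (rule mult_right_mono) simp
  moreover have "y / ennreal b * ennreal b = y" for y
  proof -
    have "ennreal b / ennreal b = 1" using b by (intro ennreal_divide_self) auto
    then show ?thesis unfolding ennreal_divide_times by simp
  qed
  ultimately have le: "(\<integral>\<^sup>+s. A s * indicator {0<..<t'} s \<partial>lborel) \<le> ennreal (c\<^sup>2 * b)"
    using b by (simp add: ennreal_mult')
  have "(\<integral>\<^sup>+z. ennreal (G z) * indicator (ball x r \<times> {0<..<r}) z \<partial>lborel) =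
     (\<integral>\<^sup>+s. (\<integral>\<^sup>+y. ennreal (G (y, s)) * indicator (ball x r) y \<partial>lborel) * indicator {0<..<r} s \<partial>lborel)"
  proof -
    have [measurable]: "ball x r \<times> {0<..<r} \<in> sets borel" by (intro borel_Times) auto
    have "(\<integral>\<^sup>+z. ennreal (G z) * indicator (ball x r \<times> {0<..<r}) z \<partial>lborel) =
       (\<integral>\<^sup>+s. (\<integral>\<^sup>+y. ennreal (G (y, s)) * indicator (ball x r \<times> {0<..<r}) (y, s) \<partial>lborel) \<partial>lborel)"
      by (rule nn_integral_slices) measurable
    also have "\<dots> = (\<integral>\<^sup>+s. (\<integral>\<^sup>+y. ennreal (G (y, s)) * indicator (ball x r) y \<partial>lborel) * indicator {0<..<r} s \<partial>lborel)"
      by (intro nn_integral_cong) (subst nn_integral_multc[symmetric], measurable, simp add: indicator_times mult.assoc)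
    finally show ?thesis .
  qed
  also have "\<dots> \<le> (\<integral>\<^sup>+s. A s * indicator {0<..<t'} s \<partial>lborel)"
  proof (rule nn_integral_mono, rule mult_mono)
    fix s :: real
    have sub: "ball x r \<subseteq> ball x' t'"
    proof
      fix y assume "y \<in> ball x r"
      then show "y \<in> ball x' t'" using t'(4) dist_triangle[of x' y x] by (simp add: dist_commute)
    qed
    show "(\<integral>\<^sup>+y. ennreal (G (y, s)) * indicator (ball x r) y \<partial>lborel) \<le> A s"
      unfolding A_def using sub by (intro nn_integral_mono mult_left_mono) (auto simp: indicator_def)
    show "indicator {0<..<r} s \<le> (indicator {0<..<t'} s :: ennreal)" using t' by (auto simp: indicator_def)
  qed auto
  also note le
  also have "ennreal (c\<^sup>2 * b) \<le> ennreal (carleson_const CARD('n) * c\<^sup>2 * r ^ CARD('n))"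
  proof (rule ennreal_leI)
    have "t' ^ CARD('n) \<le> (2 * r) ^ CARD('n)" using t' t'0 by (intro power_mono) auto
    then have "b \<le> \<omega> * (2 ^ CARD('n) * r ^ CARD('n))" unfolding b_def using \<omega> by (simp add: power_mult_distrib)
    also have "\<dots> \<le> carleson_const CARD('n) * r ^ CARD('n)"
      unfolding carleson_const_def \<omega>_def[symmetric] using r by (simp add: distrib_right)
    finally have "c\<^sup>2 * b \<le> c\<^sup>2 * (carleson_const CARD('n) * r ^ CARD('n))" by (rule mult_left_mono) simp
    then show "c\<^sup>2 * b \<le> carleson_const CARD('n) * c\<^sup>2 * r ^ CARD('n)" by (simp add: mult_ac)
  qed
  finally show ?thesis .
qed

text \<open>By \<open>AE_slices\<close> the inner Lebesgue integrals agree with Borel ones for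
  almost every s; integrability of the kernel against F then permits Fubini. Equality holds at every
  x and t, as a null set of sources affects neither integral.\<close>

lemma (in critical_source) duhamel_eq_W:
  assumes t: "0 < t" "ereal t < T"
    and src: "AE z in lborel. z \<in> slab T \<longrightarrow> source u (snd z) (fst z) = F z"
  shows "duhamel u t x = W (x, t)"
proof -
  define h where "h s = (LINT y|lborel. duhamel_kernel t x (y, s) *\<^sub>R F (y, s))" for s
  have h: "h \<in> borel_measurable borel" unfolding h_def by measurable
  have "AE s in lborel. indicator {0<..<t} s *\<^sub>R poisson_semigroup (t - s) (source u s) x = h s"
    using AE_slices[OF src]
  proof eventually_elim
    case (elim s)
    show ?case
    proof (cases "0 < s \<and> s < t")
      case True
      then have "ereal s < ereal t" by simp
      then have "ereal s < T" using t(2) by (rule order_less_trans)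
      then have slab: "(y, s) \<in> slab T" for y :: "real^'n" using True by (simp add: slab_def)
      have "AE y in lborel. poisson_kernel (t - s) (x - y) *\<^sub>R source u s y = poisson_kernel (t - s) (x - y) *\<^sub>R F (y, s)"
        using elim by eventually_elim (use slab in simp)
      from this have "poisson_semigroup (t - s) (source u s) x = (LINT y|lborel. poisson_kernel (t - s) (x - y) *\<^sub>R F (y, s))"
        unfolding poisson_semigroup_def by (intro integral_lebesgue_AE) auto
      then show ?thesis using True unfolding h_def by (simp add: duhamel_kernel_def)
    qed (auto simp: h_def duhamel_kernel_def)
  qed
  then have "duhamel u t x = (LINT s|lborel. h s)"
    unfolding duhamel_def set_lebesgue_integral_def by (intro integral_lebesgue_AE h)
  also have "\<dots> = (LINT z|(lborel \<Otimes>\<^sub>M lborel). (case z of (y, s) \<Rightarrow> duhamel_kernel t x (y, s) *\<^sub>R F (y, s)))"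
    unfolding h_def
  proof (rule lborel_pair.integral_snd)
    show "integrable (lborel \<Otimes>\<^sub>M lborel) (\<lambda>(y, s). duhamel_kernel t x (y, s) *\<^sub>R F (y, s))"
      using integrable_duhamel[OF t, of F 1 x] by (simp add: lborel_prod F_le case_prod_unfold)
  qed
  also have "\<dots> = W (x, t)" unfolding lborel_prod W_def by (simp add: case_prod_unfold)
  finally show ?thesis .
qed

text \<open>Borel versions of u and of its modulus satisfy the bounds almost everywhere; setting G
  to 0 at the exceptional points makes them valid everywhere and changes G on the slab only on a
  null set. The Carleson constant dominates both bounds, so one k serves for both.\<close>

lemma X_space_critical_source:
  fixes u :: "(real^'n) \<times> real \<Rightarrow> real^'m"
  assumes u: "u \<in> X_space T" and sphere: "AE z in lebesgue_on (slab T). norm (u z) = 1"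
  obtains F G k where "critical_source F G T k"
    "AE z in lborel. z \<in> slab T \<longrightarrow> ennreal (G z) = od_sq (\<lambda>y. u (y, snd z)) (fst z)"
    "AE z in lborel. z \<in> slab T \<longrightarrow> F z = G z *\<^sub>R u z"
proof -
  let ?S = "slab T :: ((real^'n) \<times> real) set"
  define E where "E z = od_sq (\<lambda>y. u (y, snd z)) (fst z)" for z
  have "X_part 0 T u < top"
    using u unfolding X_space_def X_norm_def X_seminorm_def X0_seminorm_def by auto
  then obtain c where c: "X_part 0 T u = ennreal c" "c \<ge> 0" by (cases "X_part 0 T u") auto
  note X = X_part_0_bounds[OF c(2) eq_refl[OF c(1)], folded E_def]
  define k where "k = carleson_const CARD('n) * c\<^sup>2"
  have kc: "c\<^sup>2 \<le> k" unfolding k_def using mult_right_mono[OF carleson_const_ge_1, of "c\<^sup>2"] by simp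
  then have k0: "k \<ge> 0" using zero_le_power2[of c] by linarith
  have S: "?S \<inter> space lebesgue \<in> sets lebesgue" by simp
  have "u \<in> borel_measurable (lebesgue_on ?S)" using u by (simp add: X_space_def)
  then have "(\<lambda>z. if z \<in> ?S then u z else 0) \<in> borel_measurable lebesgue"
    by (subst (asm) measurable_restrict_space_iff[OF S]) auto
  then obtain U where U: "U \<in> borel_measurable lborel" "AE z in lborel. (if z \<in> ?S then u z else 0) = U z"
    by (rule borel_version_vector)
  have "(\<lambda>z. if z \<in> ?S then E z else 0) \<in> borel_measurable lebesgue"
    using X(1) by (subst (asm) measurable_restrict_space_iff[OF S]) (auto simp: E_def)
  then obtain E' where E': "E' \<in> borel_measurable lborel" "AE z in lborel. (if z \<in> ?S then E z else 0) = E' z"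
    using completion_ex_borel_measurable by blast
  have [measurable]: "U \<in> borel_measurable borel" "E' \<in> borel_measurable borel" using U(1) E'(1) by auto
  \<comment> \<open>The set is cut out by Borel conditions on the versions themselves, so it is
    Borel, and it contains almost every point of the slab.\<close>
  define good where "good z \<longleftrightarrow> 0 < snd z \<and> ereal (snd z) < T \<and> norm (U z) = 1 \<and> E' z < top \<and> snd z * enn2real (E' z) \<le> k" for z
  define G where "G z = (if good z then enn2real (E' z) else 0)" for z
  define F where "F z = G z *\<^sub>R U z" for z
  have [measurable]: "G \<in> borel_measurable borel" unfolding G_def good_def by measurable
  have [measurable]: "F \<in> borel_measurable borel" unfolding F_def by measurable
  have sphere': "AE z in lborel. z \<in> ?S \<longrightarrow> norm (u z) = 1"
    using sphere by (subst (asm) AE_lebesgue_on_iff) auto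
  have all: "AE z in lborel. z \<in> ?S \<longrightarrow> U z = u z \<and> good z \<and> ennreal (G z) = E z"
    using U(2) E'(2) sphere' X(2)
  proof (eventually_elim, intro impI)
    fix z assume z: "(if z \<in> ?S then u z else 0) = U z" "(if z \<in> ?S then E z else 0) = E' z"
      "z \<in> ?S \<longrightarrow> norm (u z) = 1" "z \<in> ?S \<longrightarrow> ennreal (snd z) * E z \<le> ennreal (c\<^sup>2)" "z \<in> ?S"
    have eq: "u z = U z" "E z = E' z" using z by auto
    have s: "0 < snd z" "ereal (snd z) < T" using z(5) by (auto simp: slab_def)
    have le: "ennreal (snd z) * E' z \<le> ennreal (c\<^sup>2)" using z eq by simp
    have fin: "E' z < top"
    proof (rule ccontr)
      assume "\<not> E' z < top"
      then have "ennreal (snd z) * E' z = top" using s by (simp add: less_top[symmetric] ennreal_mult_top)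
      then show False using le by (simp add: top_unique)
    qed
    then have E'z: "ennreal (enn2real (E' z)) = E' z" by (simp add: ennreal_enn2real)
    have "ennreal (snd z * enn2real (E' z)) \<le> ennreal (c\<^sup>2)"
      using le s by (simp add: ennreal_mult' E'z)
    then have "snd z * enn2real (E' z) \<le> c\<^sup>2" by (simp add: ennreal_le_iff)
    then have "good z" unfolding good_def using s fin z eq kc by simp
    then show "U z = u z \<and> good z \<and> ennreal (G z) = E z" using eq E'z by (simp add: G_def)
  qed
  have G: "AE z in lborel. z \<in> ?S \<longrightarrow> ennreal (G z) = od_sq (\<lambda>y. u (y, snd z)) (fst z)"
    using all by eventually_elim (auto simp: E_def)
  have "critical_source F G T k"
  proof
    show "norm (F z) \<le> G z" for z
      unfolding F_def G_def by (auto simp: good_def)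
    show "s * G (y, s) \<le> k" if "0 < s" for s y
      using that k0 by (auto simp: G_def good_def)
    show "(\<integral>\<^sup>+z. ennreal (G z) * indicator (ball x r \<times> {0<..<r}) z \<partial>lborel) \<le> ennreal (k * r ^ CARD('n))"
      if "0 < r" "ereal r < T" for x r
      unfolding k_def using that by (intro X_part_0_carleson[OF c(2) eq_refl[OF c(1)] _ G]) auto
  qed (use k0 in auto)
  moreover have "AE z in lborel. z \<in> ?S \<longrightarrow> F z = G z *\<^sub>R u z"
    using all by eventually_elim (auto simp: F_def)
  ultimately show ?thesis using G that by blast
qed

section \<open>Choice of the threshold and the uniqueness argument\<close>

theorem theorem2:
  shows "\<exists>\<delta>::real. \<delta> > 0 \<and>
    (\<forall>(T::ereal) (u\<^sub>1 :: (real^'n) \<times> real \<Rightarrow> real^'m) (u\<^sub>2 :: (real^'n) \<times> real \<Rightarrow> real^'m)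
        (a :: real^'n \<Rightarrow> real^'m).
      0 < T \<longrightarrow>
      u\<^sub>1 \<in> X_space T \<longrightarrow> u\<^sub>2 \<in> X_space T \<longrightarrow>
      (AE z in lebesgue_on (slab T). norm (u\<^sub>1 z) = 1) \<longrightarrow>
      (AE z in lebesgue_on (slab T). norm (u\<^sub>2 z) = 1) \<longrightarrow>
      a \<in> A_space \<longrightarrow> (AE x in lebesgue. norm (a x) = 1) \<longrightarrow>
      mild_solution T a u\<^sub>1 \<longrightarrow> mild_solution T a u\<^sub>2 \<longrightarrow>
      Limsup (at_right 0) (\<lambda>R::real. X_seminorm (ereal R) u\<^sub>1) \<le> ennreal \<delta> \<longrightarrow>
      Limsup (at_right 0) (\<lambda>R::real. X_seminorm (ereal R) u\<^sub>2) \<le> ennreal \<delta> \<longrightarrow>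
      (AE z in lebesgue_on (slab T). u\<^sub>1 z = u\<^sub>2 z))"
proof -
  define L where "L = duhamel_const CARD('n) * carleson_const CARD('n)"
  have L: "L > 0" unfolding L_def using duhamel_const_pos[of "CARD('n)"] carleson_const_ge_1[of "CARD('n)"]
    by (intro mult_pos_pos) auto
  \<comment> \<open>Chosen so that 2 L (2 \<delta>)^2 = 1/2. The inner 2 is the loss from an upper
    limit \<le> \<delta> to a seminorm < 2 \<delta> at an actual R; the outer 2 adds the two
    solutions.\<close>
  define \<delta> where "\<delta> = 1 / (4 * sqrt L)"
  have \<delta>: "\<delta> > 0" using L by (simp add: \<delta>_def)
  define \<kappa> where "\<kappa> = carleson_const CARD('n) * (2 * \<delta>)\<^sup>2"
  have "\<delta>\<^sup>2 = 1 / (16 * L)" unfolding \<delta>_def using L by (simp add: power_divide power_mult_distrib)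
  then have "2 * (L * (2 * \<delta>)\<^sup>2) = 1 / 2" using L by (simp add: power_mult_distrib)
  then have small: "duhamel_const CARD('n) * (2 * \<kappa>) \<le> 1 / 2"
    unfolding \<kappa>_def L_def by (simp add: mult_ac)
  have \<kappa>\<delta>: "(2 * \<delta>)\<^sup>2 \<le> \<kappa>" unfolding \<kappa>_def
    using mult_right_mono[OF carleson_const_ge_1[of "CARD('n)"], of "(2 * \<delta>)\<^sup>2"] by simp
  then have \<kappa>0: "\<kappa> \<ge> 0" using zero_le_power2[of "2 * \<delta>"] by linarith
  have main: "AE z in lebesgue_on (slab T). u\<^sub>1 z = u\<^sub>2 z"
    if T: "0 < T" and u1: "u\<^sub>1 \<in> X_space T" and u2: "u\<^sub>2 \<in> X_space T"
      and sphere1: "AE z in lebesgue_on (slab T). norm (u\<^sub>1 z) = 1"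
      and sphere2: "AE z in lebesgue_on (slab T). norm (u\<^sub>2 z) = 1"
      and mild1: "mild_solution T a u\<^sub>1" and mild2: "mild_solution T a u\<^sub>2"
      and lim1: "Limsup (at_right 0) (\<lambda>R::real. X_seminorm (ereal R) u\<^sub>1) \<le> ennreal \<delta>"
      and lim2: "Limsup (at_right 0) (\<lambda>R::real. X_seminorm (ereal R) u\<^sub>2) \<le> ennreal \<delta>"
    for T and u\<^sub>1 u\<^sub>2 :: "(real^'n) \<times> real \<Rightarrow> real^'m" and a
  proof -
    let ?S = "slab T :: ((real^'n) \<times> real) set"
    obtain F1 G1 k1 where cs1: "critical_source F1 G1 T k1"
      and G1: "AE z in lborel. z \<in> ?S \<longrightarrow> ennreal (G1 z) = od_sq (\<lambda>y. u\<^sub>1 (y, snd z)) (fst z)"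
      and F1: "AE z in lborel. z \<in> ?S \<longrightarrow> F1 z = G1 z *\<^sub>R u\<^sub>1 z"
      by (rule X_space_critical_source[OF u1 sphere1])
    obtain F2 G2 k2 where cs2: "critical_source F2 G2 T k2"
      and G2: "AE z in lborel. z \<in> ?S \<longrightarrow> ennreal (G2 z) = od_sq (\<lambda>y. u\<^sub>2 (y, snd z)) (fst z)"
      and F2: "AE z in lborel. z \<in> ?S \<longrightarrow> F2 z = G2 z *\<^sub>R u\<^sub>2 z"
      by (rule X_space_critical_source[OF u2 sphere2])
    interpret s1: critical_source F1 G1 T k1 by (rule cs1)
    interpret s2: critical_source F2 G2 T k2 by (rule cs2)
    define F where "F z = F1 z - F2 z" for z
    define G where "G z = G1 z + G2 z" for z
    have [measurable]: "F \<in> borel_measurable borel" "G \<in> borel_measurable borel"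
      unfolding F_def G_def by measurable
    have carleson_add: "(\<integral>\<^sup>+z. ennreal (G z) * indicator (ball x r \<times> {0<..<r}) z \<partial>lborel) =
        (\<integral>\<^sup>+z. ennreal (G1 z) * indicator (ball x r \<times> {0<..<r}) z \<partial>lborel) +
        (\<integral>\<^sup>+z. ennreal (G2 z) * indicator (ball x r \<times> {0<..<r}) z \<partial>lborel)" for x r
    proof -
      have [measurable]: "ball x r \<times> {0<..<r} \<in> sets borel" by (intro borel_Times) auto
      show ?thesis
        unfolding G_def by (subst nn_integral_add[symmetric])
          (auto simp: s1.G_nonneg s2.G_nonneg distrib_right)
    qed
    interpret s: critical_source F G T "k1 + k2"
    proof
      show "norm (F z) \<le> G z" for z
        unfolding F_def G_def using s1.F_le[of z] s2.F_le[of z] norm_triangle_ineq4[of "F1 z" "F2 z"] by linarith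
      show "s * G (y, s) \<le> k1 + k2" if "0 < s" "ereal s < T" for s y
        unfolding G_def using s1.G_le[OF that, of y] s2.G_le[OF that, of y] by (simp add: distrib_left)
      show "(\<integral>\<^sup>+z. ennreal (G z) * indicator (ball x r \<times> {0<..<r}) z \<partial>lborel) \<le> ennreal ((k1 + k2) * r ^ CARD('n))"
        if r: "0 < r" "ereal r < T" for x r
        unfolding carleson_add
        using add_mono[OF s1.G_carleson[OF r, of x] s2.G_carleson[OF r, of x]] r s1.k_nonneg s2.k_nonneg
        by (simp add: ennreal_plus[symmetric] distrib_right del: ennreal_plus)
    qed (use s1.k_nonneg s2.k_nonneg in auto)
    have src1: "AE z in lborel. z \<in> ?S \<longrightarrow> source u\<^sub>1 (snd z) (fst z) = F1 z"
      using G1 F1 by eventually_elim (auto simp: source_def s1.G_nonneg dest!: sym[of "ennreal _"])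
    have src2: "AE z in lborel. z \<in> ?S \<longrightarrow> source u\<^sub>2 (snd z) (fst z) = F2 z"
      using G2 F2 by eventually_elim (auto simp: source_def s2.G_nonneg dest!: sym[of "ennreal _"])
    have W: "s.W (x, t) = s1.W (x, t) - s2.W (x, t)" if t: "0 < t" "ereal t < T" for x t
    proof -
      have "integrable lborel (\<lambda>z. duhamel_kernel t x z *\<^sub>R F1 z)" "integrable lborel (\<lambda>z. duhamel_kernel t x z *\<^sub>R F2 z)"
        by (rule s1.integrable_duhamel[OF t, of _ 1] s2.integrable_duhamel[OF t, of _ 1]; simp add: s1.F_le s2.F_le)+
      then show ?thesis
        unfolding s.W_def s1.W_def s2.W_def F_def by (simp add: scaleR_right_diff_distrib)
    qed
    have mild': "AE z in lborel. z \<in> ?S \<longrightarrow> u\<^sub>1 z = poisson_semigroup (snd z) a (fst z) + duhamel u\<^sub>1 (snd z) (fst z)"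
      "AE z in lborel. z \<in> ?S \<longrightarrow> u\<^sub>2 z = poisson_semigroup (snd z) a (fst z) + duhamel u\<^sub>2 (snd z) (fst z)"
      using mild1 mild2 unfolding mild_solution_def
      by (simp_all add: AE_lebesgue_on_iff case_prod_beta)
    \<comment> \<open>The semigroup terms S(t)a of the two mild formulas are equal and cancel, which
      is the only place where the common initial value enters.\<close>
    have WU: "AE z in lborel. z \<in> ?S \<longrightarrow> s.W z = u\<^sub>1 z - u\<^sub>2 z"
      using mild'
    proof (eventually_elim, intro impI)
      fix z assume z: "z \<in> ?S \<longrightarrow> u\<^sub>1 z = poisson_semigroup (snd z) a (fst z) + duhamel u\<^sub>1 (snd z) (fst z)"
        "z \<in> ?S \<longrightarrow> u\<^sub>2 z = poisson_semigroup (snd z) a (fst z) + duhamel u\<^sub>2 (snd z) (fst z)" "z \<in> ?S"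
      have t: "0 < snd z" "ereal (snd z) < T" using z(3) by (auto simp: slab_def)
      show "s.W z = u\<^sub>1 z - u\<^sub>2 z"
        using z s1.duhamel_eq_W[OF t src1, of "fst z"] s2.duhamel_eq_W[OF t src2, of "fst z"] W[OF t, of "fst z"]
        by simp
    qed
    have sphere': "AE z in lborel. z \<in> ?S \<longrightarrow> norm (u\<^sub>1 z) = 1" "AE z in lborel. z \<in> ?S \<longrightarrow> norm (u\<^sub>2 z) = 1"
      using sphere1 sphere2 by (simp_all add: AE_lebesgue_on_iff)
    interpret b: balanced_source F G T "k1 + k2"
    proof
      show "AE z in lborel. 0 < snd z \<and> ereal (snd z) < T \<longrightarrow> 2 * (s.W z \<bullet> F z) \<le> (norm (s.W z))\<^sup>2 * G z"
        using WU sphere' F1 F2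
      proof (eventually_elim, intro impI)
        fix z
        assume z: "z \<in> ?S \<longrightarrow> s.W z = u\<^sub>1 z - u\<^sub>2 z" "z \<in> ?S \<longrightarrow> norm (u\<^sub>1 z) = 1" "z \<in> ?S \<longrightarrow> norm (u\<^sub>2 z) = 1"
          "z \<in> ?S \<longrightarrow> F1 z = G1 z *\<^sub>R u\<^sub>1 z" "z \<in> ?S \<longrightarrow> F2 z = G2 z *\<^sub>R u\<^sub>2 z"
          and "0 < snd z \<and> ereal (snd z) < T"
        then have S: "z \<in> ?S" by (cases z) (auto simp: slab_def)
        have 1: "u\<^sub>1 z \<bullet> u\<^sub>1 z = 1" "u\<^sub>2 z \<bullet> u\<^sub>2 z = 1"
          using z S by (simp_all add: power2_norm_eq_inner[symmetric])
        have Wz: "s.W z = u\<^sub>1 z - u\<^sub>2 z" using z(1) S by simp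
        have Fz: "F z = G1 z *\<^sub>R u\<^sub>1 z - G2 z *\<^sub>R u\<^sub>2 z" using z S by (simp add: F_def)
        \<comment> \<open>With unit vectors, (u_1 - u_2) . (G_1 u_1 - G_2 u_2) = (1 - u_1 . u_2)(G_1
          + G_2), and |u_1 - u_2|^2 = 2 (1 - u_1 . u_2).\<close>
        have "2 * (s.W z \<bullet> F z) = 2 * (1 - u\<^sub>1 z \<bullet> u\<^sub>2 z) * G z"
          unfolding Wz Fz G_def using 1 by (simp add: inner_diff_left inner_diff_right inner_commute[of "u\<^sub>2 z" "u\<^sub>1 z"] algebra_simps)
        also have "2 * (1 - u\<^sub>1 z \<bullet> u\<^sub>2 z) = (norm (s.W z))\<^sup>2"
          unfolding Wz using 1 by (simp add: power2_norm_eq_inner inner_diff_left inner_diff_right inner_commute[of "u\<^sub>2 z" "u\<^sub>1 z"])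
        finally show "2 * (s.W z \<bullet> F z) \<le> (norm (s.W z))\<^sup>2 * G z" by simp
      qed
    qed
    have lt: "ennreal \<delta> < ennreal (2 * \<delta>)" using \<delta> by (simp add: ennreal_less_iff)
    have "eventually (\<lambda>R. X_seminorm (ereal R) u\<^sub>1 < ennreal (2 * \<delta>)) (at_right 0)"
      "eventually (\<lambda>R. X_seminorm (ereal R) u\<^sub>2 < ennreal (2 * \<delta>)) (at_right 0)"
      using Limsup_lessD lim1 lim2 lt by (metis order_le_less_trans)+
    moreover obtain q where q: "0 < ereal q" "ereal q < T" using ereal_dense2[OF T] by auto
    have "eventually (\<lambda>R. R \<in> {0<..<q}) (at_right (0::real))"
      using q by (intro eventually_at_right_real) simp
    ultimately have "eventually (\<lambda>R. X_seminorm (ereal R) u\<^sub>1 < ennreal (2 * \<delta>) \<and>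
        X_seminorm (ereal R) u\<^sub>2 < ennreal (2 * \<delta>) \<and> R \<in> {0<..<q}) (at_right 0)"
      by eventually_elim auto
    \<comment> \<open>A single R serves both solutions. Taking it below a real q < T keeps the short
      slab inside the given one, also for infinite T.\<close>
    then obtain R where R: "X_seminorm (ereal R) u\<^sub>1 < ennreal (2 * \<delta>)" "X_seminorm (ereal R) u\<^sub>2 < ennreal (2 * \<delta>)" "0 < R" "R < q"
      using eventually_happens' by (metis (no_types, lifting) greaterThanLessThan_iff trivial_limit_at_right_real)
    have "ereal R < ereal q" using R(4) by simp
    then have RT: "ereal R < T" using q(2) by (rule order_less_trans)
    have X: "X_part 0 (ereal R) u\<^sub>1 \<le> ennreal (2 * \<delta>)" "X_part 0 (ereal R) u\<^sub>2 \<le> ennreal (2 * \<delta>)"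
      using R(1,2) unfolding X_seminorm_def X0_seminorm_def
      by (meson add_increasing2 less_imp_le order_trans order_refl zero_le)+
    have \<delta>0: "2 * \<delta> \<ge> 0" using \<delta> by simp
    have RS: "slab (ereal R) \<subseteq> ?S" using RT by (auto simp: slab_def intro: order_less_trans[OF _ RT])
    have G1R: "AE z in lborel. z \<in> slab (ereal R) \<longrightarrow> ennreal (G1 z) = od_sq (\<lambda>y. u\<^sub>1 (y, snd z)) (fst z)"
      using G1 by eventually_elim (use RS in auto)
    have G2R: "AE z in lborel. z \<in> slab (ereal R) \<longrightarrow> ennreal (G2 z) = od_sq (\<lambda>y. u\<^sub>2 (y, snd z)) (fst z)"
      using G2 by eventually_elim (use RS in auto)
    \<comment> \<open>On (0,R) the constant 2 \<kappa> takes the place of k1 + k2: it comes from the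
      seminorms at R, which are small, and not from those at T.\<close>
    have init: "b.g (x, t) = 0" if "0 < t" "t < R" for x t
    proof (rule b.g_vanishes_initially[OF less_imp_le[OF RT] _ small _ _ that])
      show "0 \<le> 2 * \<kappa>" using \<kappa>0 by simp
      show "AE z in lborel. 0 < snd z \<and> snd z < R \<longrightarrow> snd z * G z \<le> 2 * \<kappa>"
        using G1R G2R X_part_0_bounds(2)[OF \<delta>0 X(1)] X_part_0_bounds(2)[OF \<delta>0 X(2)]
      proof (eventually_elim, intro impI)
        fix z assume z: "z \<in> slab (ereal R) \<longrightarrow> ennreal (G1 z) = od_sq (\<lambda>y. u\<^sub>1 (y, snd z)) (fst z)"
          "z \<in> slab (ereal R) \<longrightarrow> ennreal (G2 z) = od_sq (\<lambda>y. u\<^sub>2 (y, snd z)) (fst z)"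
          "z \<in> slab (ereal R) \<longrightarrow> ennreal (snd z) * od_sq (\<lambda>y. u\<^sub>1 (y, snd z)) (fst z) \<le> ennreal ((2 * \<delta>)\<^sup>2)"
          "z \<in> slab (ereal R) \<longrightarrow> ennreal (snd z) * od_sq (\<lambda>y. u\<^sub>2 (y, snd z)) (fst z) \<le> ennreal ((2 * \<delta>)\<^sup>2)"
          and s: "0 < snd z \<and> snd z < R"
        then have S: "z \<in> slab (ereal R)" by (cases z) (auto simp: slab_def)
        have "ennreal (snd z * G1 z) \<le> ennreal ((2 * \<delta>)\<^sup>2)" "ennreal (snd z * G2 z) \<le> ennreal ((2 * \<delta>)\<^sup>2)"
          using z S s by (simp_all add: ennreal_mult')
        then have "snd z * G1 z \<le> (2 * \<delta>)\<^sup>2" "snd z * G2 z \<le> (2 * \<delta>)\<^sup>2"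
          by (simp_all add: ennreal_le_iff)
        then show "snd z * G z \<le> 2 * \<kappa>" using \<kappa>\<delta> unfolding G_def distrib_left by linarith
      qed
      show "(\<integral>\<^sup>+z. ennreal (G z) * indicator (ball x r \<times> {0<..<r}) z \<partial>lborel) \<le> ennreal (2 * \<kappa> * r ^ CARD('n))"
        if r: "0 < r" "r < R" for x r
      proof -
        have "ereal r < ereal R" using r by simp
        note C1 = X_part_0_carleson[OF \<delta>0 X(1) s1.G_measurable G1R r(1) this, of x]
          and C2 = X_part_0_carleson[OF \<delta>0 X(2) s2.G_measurable G2R r(1) this, of x]
        have "ennreal (\<kappa> * r ^ CARD('n)) + ennreal (\<kappa> * r ^ CARD('n)) = ennreal (2 * \<kappa> * r ^ CARD('n))"
          using \<kappa>0 r by (simp add: ennreal_plus[symmetric] del: ennreal_plus)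
        then show ?thesis
          unfolding carleson_add using add_mono[OF C1 C2] unfolding \<kappa>_def by simp
      qed
    qed
    have "b.g (x, t) = 0" if "0 < t" "ereal t < T" for x t
      by (rule b.g_vanishes_extend[OF R(3) init that])
    then have "s.W z = 0" if "z \<in> ?S" for z
      using that by (cases z) (auto simp: slab_def b.g_def)
    then have "AE z in lborel. z \<in> ?S \<longrightarrow> u\<^sub>1 z = u\<^sub>2 z"
      using WU by (auto elim!: eventually_mono)
    then show ?thesis by (simp add: AE_lebesgue_on_iff)
  qed
  show ?thesis using \<delta> main by blast
qed

end
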